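(* Let $V$ be a finite set and $A$ the transition matrix of a reversible, irreducible, aperiodic Markov chain on $V$. For every $\varepsilon>0$ there exists $\delta>0$ (depending only on $\varepsilon$, $V$ and $A$) such that the following holds for every $n\ge 1$: if $g:V^n\to[0,1]$ is $\varepsilon$-far from independent, then $\langle g,Ag\rangle>\delta$. Moreover, one can take $\delta=\delta_2(\varepsilon):=1/\mathrm{Tower}(O(\log(1/\varepsilon)))$, i.e. $\delta_2(\varepsilon)=1/\mathrm{Tower}(h(\varepsilon))$ for a function $h:(0,\infty)\to\mathbb{N}$ depending only on $V$ and $A$ with $h(\varepsilon)=O(\log(1/\varepsilon))$ as $\varepsilon\to 0$.
   Context: Let $\mu$ be the unique stationary measure of $A$ on $V$. On $V^n$ we use the product measure $\mu^{\otimes n}$ (written $\mu$) and the product chain $A^{\otimes n}$ (written $A$), acting on functions by $(Ah)(x)=\sum_y A(x,y)h(y)$. Expectations $\mathbb{E}$ and the inner product $\langle f_1,f_2\rangle=\mathbb{E}[f_1f_2]$ of functions on $V^n$ are with respect to $\mu$. $\mathbb{1}_U$ is the indicator of $U$ and $\overline U$ its complement. A set $U\subseteq V^n$ is independent if $\langle \mathbb{1}_U,A\mathbb{1}_U\rangle=0$. A function $g:V^n\to[0,1]$ is $\varepsilon$-far from independent if for every independent set $U\subseteq V^n$ we have $\mathbb{E}[\mathbb{1}_{\overline U}\cdot g]>\varepsilon$. $\mathrm{Tower}$ is the tower function: $\mathrm{Tower}(0)=1$, $\mathrm{Tower}(t+1)=2^{\mathrm{Tower}(t)}$. *)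

theory Defs
  imports "HOL-Analysis.Analysis" "HOL-Library.Landau_Symbols"
begin

text \<open>
  A finite state space is a type of class \<open>finite\<close>; the entry \<open>A $ x $ y\<close> of a transition
  matrix is the probability of moving from \<open>x\<close> to \<open>y\<close>, so distributions act as row vectors.
\<close>

definition transition_matrix :: "real ^ 'v ^ 'v::finite \<Rightarrow> bool" where
  "transition_matrix A \<longleftrightarrow>
     (\<forall>x y. 0 \<le> A $ x $ y) \<and> (\<forall>x. (\<Sum>y\<in>UNIV. A $ x $ y) = 1)"

text \<open>
  The class power \<open>A ^ k\<close> on \<open>real ^ 'v ^ 'v\<close> is entrywise, so matrix powers are
  defined separately.
\<close>

primrec matpow :: "real ^ 'v ^ 'v::finite \<Rightarrow> nat \<Rightarrow> real ^ 'v ^ 'v" where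
  "matpow A 0 = mat 1"
| "matpow A (Suc k) = A ** matpow A k"

definition irreducible_chain :: "real ^ 'v ^ 'v::finite \<Rightarrow> bool" where
  "irreducible_chain A \<longleftrightarrow> (\<forall>x y. \<exists>k. 0 < matpow A k $ x $ y)"

definition aperiodic_chain :: "real ^ 'v ^ 'v::finite \<Rightarrow> bool" where
  "aperiodic_chain A \<longleftrightarrow> (\<forall>x. Gcd {k. 1 \<le> k \<and> 0 < matpow A k $ x $ x} = 1)"

text \<open>
  For irreducible \<open>A\<close> there is exactly one such \<open>\<mu>\<close>, so anything depending on \<open>A\<close> and
  \<open>\<mu>\<close> depends on \<open>A\<close> alone.
\<close>

definition stationary_measure :: "real ^ 'v ^ 'v::finite \<Rightarrow> real ^ 'v \<Rightarrow> bool" where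
  "stationary_measure A \<mu> \<longleftrightarrow>
     (\<forall>x. 0 \<le> \<mu> $ x) \<and> (\<Sum>x\<in>UNIV. \<mu> $ x) = 1 \<and> \<mu> v* A = \<mu>"

definition reversible_chain :: "real ^ 'v ^ 'v::finite \<Rightarrow> real ^ 'v \<Rightarrow> bool" where
  "reversible_chain A \<mu> \<longleftrightarrow> (\<forall>x y. \<mu> $ x * A $ x $ y = \<mu> $ y * A $ y $ x)"

text \<open>
  Since \<open>n\<close> varies within statements, \<open>V\<^sup>n\<close> is the set of functions on \<open>{..<n}\<close>, extended by
  \<open>undefined\<close>; functions on \<open>V\<^sup>n\<close> are relevant only through their values there.
\<close>

definition cube :: "nat \<Rightarrow> (nat \<Rightarrow> 'v::finite) set" where
  "cube n = {..<n} \<rightarrow>\<^sub>E UNIV"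

definition prod_expectation ::
    "real ^ 'v::finite \<Rightarrow> nat \<Rightarrow> ((nat \<Rightarrow> 'v) \<Rightarrow> real) \<Rightarrow> real" where
  "prod_expectation \<mu> n f = (\<Sum>x\<in>cube n. (\<Prod>i<n. \<mu> $ x i) * f x)"

definition prod_inner ::
    "real ^ 'v::finite \<Rightarrow> nat \<Rightarrow> ((nat \<Rightarrow> 'v) \<Rightarrow> real) \<Rightarrow> ((nat \<Rightarrow> 'v) \<Rightarrow> real) \<Rightarrow> real" where
  "prod_inner \<mu> n f g = prod_expectation \<mu> n (\<lambda>x. f x * g x)"

definition prod_chain ::
    "real ^ 'v ^ 'v::finite \<Rightarrow> nat \<Rightarrow> ((nat \<Rightarrow> 'v) \<Rightarrow> real) \<Rightarrow> (nat \<Rightarrow> 'v) \<Rightarrow> real" where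
  "prod_chain A n h x = (\<Sum>y\<in>cube n. (\<Prod>i<n. A $ x i $ y i) * h y)"

definition independent_set ::
    "real ^ 'v ^ 'v::finite \<Rightarrow> real ^ 'v \<Rightarrow> nat \<Rightarrow> (nat \<Rightarrow> 'v) set \<Rightarrow> bool" where
  "independent_set A \<mu> n U \<longleftrightarrow>
     U \<subseteq> cube n \<and> prod_inner \<mu> n (indicator U) (prod_chain A n (indicator U)) = 0"

definition far_from_independent ::
    "real ^ 'v ^ 'v::finite \<Rightarrow> real ^ 'v \<Rightarrow> nat \<Rightarrow> real \<Rightarrow> ((nat \<Rightarrow> 'v) \<Rightarrow> real) \<Rightarrow> bool" where
  "far_from_independent A \<mu> n \<epsilon> g \<longleftrightarrow>
     (\<forall>U. independent_set A \<mu> n U \<longrightarrow>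
        prod_expectation \<mu> n (\<lambda>x. indicator (cube n - U) x * g x) > \<epsilon>)"

primrec tower :: "nat \<Rightarrow> nat" where
  "tower 0 = 1"
| "tower (Suc t) = 2 ^ tower t"

end

theory Submission
  imports Defs
begin

text \<open>
  Suppose that \<open>\<langle>g, A g\<rangle>\<close> is tiny. Restrict \<open>g\<close> to the subcubes \<open>g\<^sub>x\<close> given by the values \<open>x\<close> of a set
  \<open>J\<close> of coordinates. If \<open>x\<close> and \<open>y\<close> are adjacent and \<open>g\<^sub>x\<close>, \<open>g\<^sub>y\<close> both have density at least a constant
  times \<open>\<epsilon>\<close>, then \<open>\<langle>g\<^sub>x, A g\<^sub>y\<rangle>\<close> is still tiny, and this forces \<open>g\<^sub>x\<close> or \<open>g\<^sub>y\<close> to be shattered: fixing a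
  bounded number of further coordinates moves its density by a constant factor on average. Indeed,
  keep the influential coordinates of the smoothed low-degree parts of the two functions and, by a
  Lindeberg argument, replace every other coordinate by independent bits that have the same
  correlations but whose joint law has full support; reverse hypercontractivity for these bits then
  bounds \<open>\<langle>g\<^sub>x, A g\<^sub>y\<rangle>\<close> from below unless the densities move.

  Hence the dense restrictions that are not shattered form an independent set, the shattered ones
  carry a fixed fraction of the mass of \<open>g\<close>, and refining \<open>J\<close>, which may exponentiate its size,
  increases the potential \<open>E[d ln d]\<close>, where \<open>d\<close> is the density on subcubes, by a constant fraction
  of that mass. As in Fox's proof of the removal lemma, \<open>g\<close> is first replaced by the part of it
  covered by a maximal fractional matching: then every independent set misses half of the mass, and
  the potential has room for \<open>O(log (1 / \<epsilon>))\<close> steps only.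
\<close>

section \<open>Product expectations\<close>

text \<open>Reverse hypercontractivity can fail for the chain itself, whose matrix may have zeros: a
  condition on a single coordinate may already define a dense independent set. So influential
  coordinates keep the true chain, and there it is only the near constancy of the densities that
  yields a bound. Smoothing is nearly invisible to the inner product by the spectral gap, while
  bounded degree gives the fourth moments that control the Lindeberg error. The exchange preserves
  mixed second moments exactly, so it does not change the bilinear form of the polynomials; its
  error enters only because they leave [0, 1] and have to be clipped. The potential lies between M
  ln M and 0, where M is the mean of the function, and a step gains a fixed fraction of M, whence
  O(ln (1 / M)) steps. Without the matching, M could be of order 1 while only mass \<epsilon> is
  known to lie outside an independent set, and the number of steps would be of order 1 / \<epsilon>.
  Each of the at most |V|^|J| pieces chooses its own further coordinates, which is why a step may
  exponentiate the size of \<open>J\<close>.\<close>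

definition pexp :: "'i set \<Rightarrow> ('i \<Rightarrow> 'w::finite \<Rightarrow> real) \<Rightarrow> (('i \<Rightarrow> 'w) \<Rightarrow> real) \<Rightarrow> real" where
  "pexp S p f = (\<Sum>x\<in>S \<rightarrow>\<^sub>E UNIV. (\<Prod>i\<in>S. p i (x i)) * f x)"

lemma pexp_empty [simp]: "pexp {} p f = f (\<lambda>_. undefined)"
  by (simp add: pexp_def PiE_empty_domain)

lemma sum_PiE_insert:
  fixes f :: "('i \<Rightarrow> 'w::finite) \<Rightarrow> real"
  assumes "finite S" "j \<notin> S"
  shows "(\<Sum>x\<in>insert j S \<rightarrow>\<^sub>E UNIV. f x) = (\<Sum>w\<in>UNIV. \<Sum>x\<in>S \<rightarrow>\<^sub>E UNIV. f (x(j := w)))"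
proof -
  have inj: "inj_on (\<lambda>(y, g). g(j := y)) ((UNIV :: 'w set) \<times> (S \<rightarrow>\<^sub>E UNIV))"
    using inj_combinator[OF assms(2), of "\<lambda>_. UNIV"] by simp
  show ?thesis
    by (subst PiE_insert_eq, subst sum.reindex[OF inj])
       (simp add: sum.cartesian_product comp_def case_prod_unfold)
qed

lemma pexp_insert:
  assumes "finite S" "j \<notin> S"
  shows "pexp (insert j S) p f = (\<Sum>w\<in>UNIV. p j w * pexp S p (\<lambda>x. f (x(j := w))))"
proof -
  have "pexp (insert j S) p f =
      (\<Sum>w\<in>UNIV. \<Sum>x\<in>S \<rightarrow>\<^sub>E UNIV. (\<Prod>i\<in>insert j S. p i ((x(j := w)) i)) * f (x(j := w)))"
    unfolding pexp_def using assms by (rule sum_PiE_insert)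
  also have "\<dots> = (\<Sum>w\<in>UNIV. \<Sum>x\<in>S \<rightarrow>\<^sub>E UNIV. p j w * ((\<Prod>i\<in>S. p i (x i)) * f (x(j := w))))"
  proof (intro sum.cong refl)
    fix w x
    have "(\<Prod>i\<in>S. p i ((x(j := w)) i)) = (\<Prod>i\<in>S. p i (x i))"
      using assms(2) by (intro prod.cong) auto
    then show "(\<Prod>i\<in>insert j S. p i ((x(j := w)) i)) * f (x(j := w))
        = p j w * ((\<Prod>i\<in>S. p i (x i)) * f (x(j := w)))"
      using assms by simp
  qed
  finally show ?thesis by (simp add: pexp_def sum_distrib_left)
qed

text \<open>Agreement is asked for only at points of nonzero weight. This matters once states and
  bit vectors share one type: the expansion of a function in eigenfunctions is valid only on the
  support of the chain's law.\<close>

lemma pexp_cong: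
  assumes "finite S"
    and "\<And>i w. i \<in> S \<Longrightarrow> p i w = q i w"
    and "\<And>x. x \<in> S \<rightarrow>\<^sub>E UNIV \<Longrightarrow> (\<And>i. i \<in> S \<Longrightarrow> p i (x i) \<noteq> 0) \<Longrightarrow> f x = g x"
  shows "pexp S p f = pexp S q g"
  unfolding pexp_def
proof (intro sum.cong refl)
  fix x :: "'a \<Rightarrow> 'b" assume x: "x \<in> S \<rightarrow>\<^sub>E UNIV"
  have e: "(\<Prod>i\<in>S. p i (x i)) = (\<Prod>i\<in>S. q i (x i))" using assms(2) by (intro prod.cong) auto
  show "(\<Prod>i\<in>S. p i (x i)) * f x = (\<Prod>i\<in>S. q i (x i)) * g x"
  proof (cases "\<forall>i\<in>S. p i (x i) \<noteq> 0")
    case T: True then show ?thesis using assms(3)[OF x] e by simp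
  next
    case False then have "(\<Prod>i\<in>S. p i (x i)) = 0" using assms(1) by (simp add: prod_zero_iff)
    then show ?thesis using e by simp
  qed
qed

lemma pexp_mono:
  assumes "finite S" and "\<And>i w. i \<in> S \<Longrightarrow> 0 \<le> p i w"
    and "\<And>x. x \<in> S \<rightarrow>\<^sub>E UNIV \<Longrightarrow> (\<And>i. i \<in> S \<Longrightarrow> p i (x i) \<noteq> 0) \<Longrightarrow> f x \<le> g x"
  shows "pexp S p f \<le> pexp S p g"
  unfolding pexp_def
proof (intro sum_mono)
  fix x :: "'a \<Rightarrow> 'b" assume x: "x \<in> S \<rightarrow>\<^sub>E UNIV"
  show "(\<Prod>i\<in>S. p i (x i)) * f x \<le> (\<Prod>i\<in>S. p i (x i)) * g x"
  proof (cases "\<forall>i\<in>S. p i (x i) \<noteq> 0")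
    case T: True then show ?thesis using assms(3)[OF x] by (intro mult_left_mono prod_nonneg assms(2)) auto
  next
    case False then have "(\<Prod>i\<in>S. p i (x i)) = 0" using assms(1) by (simp add: prod_zero_iff)
    then show ?thesis by simp
  qed
qed

lemma pexp_add: "pexp S p (\<lambda>x. f x + g x) = pexp S p f + pexp S p g"
  by (simp add: pexp_def algebra_simps sum.distrib)

lemma pexp_diff: "pexp S p (\<lambda>x. f x - g x) = pexp S p f - pexp S p g"
  by (simp add: pexp_def algebra_simps sum_subtractf)

lemma pexp_cmult: "pexp S p (\<lambda>x. c * f x) = c * pexp S p f"
  by (simp add: pexp_def sum_distrib_left mult.left_commute)

lemma pexp_sum: "pexp S p (\<lambda>x. \<Sum>k\<in>T. f k x) = (\<Sum>k\<in>T. pexp S p (f k))"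
  by (simp add: pexp_def sum_distrib_left) (rule sum.swap)

lemma pexp_swap: "pexp S p (\<lambda>x. pexp T q (\<lambda>y. f x y)) = pexp T q (\<lambda>y. pexp S p (\<lambda>x. f x y))"
proof -
  have "pexp S p (\<lambda>x. pexp T q (\<lambda>y. f x y)) = pexp S p (\<lambda>x. \<Sum>y\<in>T \<rightarrow>\<^sub>E UNIV. (\<Prod>i\<in>T. q i (y i)) * f x y)"
    by (simp add: pexp_def)
  also have "\<dots> = (\<Sum>y\<in>T \<rightarrow>\<^sub>E UNIV. (\<Prod>i\<in>T. q i (y i)) * pexp S p (\<lambda>x. f x y))"
    by (simp add: pexp_sum pexp_cmult)
  finally show ?thesis by (simp add: pexp_def)
qed

text \<open>The weights may have any sign and total here: the same factorisation serves laws,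
  transition kernels and the signed weights of multilinear forms.\<close>

lemma pexp_prod:
  assumes "finite S"
  shows "pexp S p (\<lambda>x. \<Prod>i\<in>S. f i (x i)) = (\<Prod>i\<in>S. \<Sum>w\<in>UNIV. p i w * f i w)"
  using assms
proof (induction S)
  case (insert j S)
  have "pexp (insert j S) p (\<lambda>x. \<Prod>i\<in>insert j S. f i (x i))
      = (\<Sum>w\<in>UNIV. p j w * pexp S p (\<lambda>x. f j w * (\<Prod>i\<in>S. f i (x i))))"
    unfolding pexp_insert[OF insert(1,2)]
  proof (intro sum.cong refl arg_cong2[where f="(*)"] pexp_cong)
    fix w x
    show "(\<Prod>i\<in>insert j S. f i ((x(j := w)) i)) = f j w * (\<Prod>i\<in>S. f i (x i))"
      using insert by (simp add: prod.insert) (intro disjI2 prod.cong, auto)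
  qed (use insert in auto)
  then show ?case using insert by (simp add: pexp_cmult sum_distrib_right mult.assoc)
qed simp

lemma pexp_const:
  assumes "finite S" "\<And>i. i \<in> S \<Longrightarrow> (\<Sum>w\<in>UNIV. p i w) = 1"
  shows "pexp S p (\<lambda>x. c) = c"
  using pexp_prod[OF assms(1), of p "\<lambda>_ _. 1"] assms(2) pexp_cmult[of S p c "\<lambda>_. 1"] by simp

lemma pexp_nonneg:
  assumes "finite S" and "\<And>i w. i \<in> S \<Longrightarrow> 0 \<le> p i w"
    and "\<And>x. x \<in> S \<rightarrow>\<^sub>E UNIV \<Longrightarrow> (\<And>i. i \<in> S \<Longrightarrow> p i (x i) \<noteq> 0) \<Longrightarrow> 0 \<le> f x"
  shows "0 \<le> pexp S p f"
  using pexp_mono[of S p "\<lambda>_. 0" f] assms pexp_cmult[of S p 0 "\<lambda>_. 0"] by simp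

lemma pexp_abs_le:
  assumes "finite S" and "\<And>i w. i \<in> S \<Longrightarrow> 0 \<le> p i w"
  shows "\<bar>pexp S p f\<bar> \<le> pexp S p (\<lambda>x. \<bar>f x\<bar>)"
  unfolding pexp_def by (rule order_trans[OF sum_abs])
    (auto intro!: sum_mono simp: abs_mult abs_of_nonneg prod_nonneg assms)

lemma pexp_Cauchy_Schwarz:
  assumes "finite S" and "\<And>i w. i \<in> S \<Longrightarrow> 0 \<le> p i w"
  shows "(pexp S p (\<lambda>x. f x * g x))\<^sup>2 \<le> pexp S p (\<lambda>x. (f x)\<^sup>2) * pexp S p (\<lambda>x. (g x)\<^sup>2)"
proof -
  let ?w = "\<lambda>x. sqrt (\<Prod>i\<in>S. p i (x i))"
  have w: "?w x * ?w x = (\<Prod>i\<in>S. p i (x i))" for x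
    by (simp add: prod_nonneg assms)
  have "(\<Sum>x\<in>S \<rightarrow>\<^sub>E UNIV. (?w x * f x) * (?w x * g x))\<^sup>2
     \<le> (\<Sum>x\<in>S \<rightarrow>\<^sub>E UNIV. (?w x * f x)\<^sup>2) * (\<Sum>x\<in>S \<rightarrow>\<^sub>E UNIV. (?w x * g x)\<^sup>2)"
    by (rule Cauchy_Schwarz_ineq_sum)
  moreover have "(?w x * f x) * (?w x * g x) = (\<Prod>i\<in>S. p i (x i)) * (f x * g x)" for x
    using w[of x] by (metis (no_types, lifting) mult.assoc mult.left_commute)
  moreover have "(?w x * f x)\<^sup>2 = (\<Prod>i\<in>S. p i (x i)) * (f x)\<^sup>2" for x f
    using w[of x] by (metis power2_eq_square power_mult_distrib)
  ultimately show ?thesis by (simp add: pexp_def)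
qed

lemma pexp_mult_le:
  assumes "finite S" and "\<And>i w. i \<in> S \<Longrightarrow> 0 \<le> p i w"
    and "pexp S p (\<lambda>x. (f x)\<^sup>2) \<le> a\<^sup>2" "pexp S p (\<lambda>x. (g x)\<^sup>2) \<le> b\<^sup>2" "0 \<le> a" "0 \<le> b"
  shows "pexp S p (\<lambda>x. f x * g x) \<le> a * b"
proof -
  have "(pexp S p (\<lambda>x. f x * g x))\<^sup>2 \<le> pexp S p (\<lambda>x. (f x)\<^sup>2) * pexp S p (\<lambda>x. (g x)\<^sup>2)"
    using assms by (intro pexp_Cauchy_Schwarz)
  also have "\<dots> \<le> a\<^sup>2 * b\<^sup>2"
    using assms by (intro mult_mono pexp_nonneg) auto
  finally have "(pexp S p (\<lambda>x. f x * g x))\<^sup>2 \<le> (a * b)\<^sup>2" by (simp add: power_mult_distrib)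
  then show ?thesis using assms by (simp add: power2_le_iff_abs_le abs_le_square_iff)
qed

lemma pexp_le:
  assumes "finite S" and "\<And>i w. i \<in> S \<Longrightarrow> 0 \<le> p i w"
    and "pexp S p (\<lambda>x. (f x)\<^sup>2) \<le> a\<^sup>2" "0 \<le> a" "\<And>i. i \<in> S \<Longrightarrow> (\<Sum>w\<in>UNIV. p i w) = 1"
  shows "pexp S p (\<lambda>x. \<bar>f x\<bar>) \<le> a"
  using pexp_mult_le[where S = S and p = p and f = "\<lambda>x. \<bar>f x\<bar>" and a = a and g = "\<lambda>_. 1" and b = 1] assms by (simp add: pexp_const)

text \<open>\<open>override_on y x J\<close> takes its values from \<open>x\<close> on
  \<open>J\<close> and from \<open>y\<close> elsewhere; with \<open>x\<close> fixed it restricts a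
  function on the cube to a subcube. All conditioning below is written in this way.\<close>

lemma pexp_split:
  assumes "finite J" "finite S" "J \<inter> S = {}"
  shows "pexp (J \<union> S) p f = pexp J p (\<lambda>x. pexp S p (\<lambda>y. f (override_on y x J)))"
  using assms
proof (induction J arbitrary: f)
  case (insert j J)
  have "pexp (insert j J \<union> S) p f = (\<Sum>w\<in>UNIV. p j w * pexp (J \<union> S) p (\<lambda>x. f (x(j := w))))"
    using insert by (simp add: pexp_insert)
  also have "\<dots> = (\<Sum>w\<in>UNIV. p j w * pexp J p (\<lambda>x. pexp S p (\<lambda>y. f ((override_on y x J)(j := w)))))"
    using insert by simp
  also have "\<dots> = (\<Sum>w\<in>UNIV. p j w * pexp J p (\<lambda>x. pexp S p (\<lambda>y. f (override_on y (x(j := w)) (insert j J)))))"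
  proof -
    have "(override_on y x J)(j := w) = override_on y (x(j := w)) (insert j J)" for x y :: "'a \<Rightarrow> 'b" and w
      using insert by (auto simp: override_on_def fun_eq_iff)
    then show ?thesis by simp
  qed
  finally show ?case using insert by (simp add: pexp_insert)
qed simp

lemma pexp_split_subset:
  assumes "finite N" "J \<subseteq> N"
  shows "pexp N p f = pexp J p (\<lambda>x. pexp (N - J) p (\<lambda>y. f (override_on y x J)))"
  using pexp_split[of J "N - J" p f] assms finite_subset[of J N] by (simp add: Un_absorb1)

text \<open>The L1 distance of the conditional density given the coordinates in \<open>K\<close>
  from the overall mean. L1 is chosen because noise does not increase it and because half of it is
  the mean negative part, the quantity that raises the entropy.\<close>

definition deviation :: "('w::finite \<Rightarrow> real) \<Rightarrow> 'i set \<Rightarrow> 'i set \<Rightarrow> (('i \<Rightarrow> 'w) \<Rightarrow> real) \<Rightarrow> real" where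
  "deviation p N K F = pexp K (\<lambda>_. p)
     (\<lambda>a. \<bar>pexp (N - K) (\<lambda>_. p) (\<lambda>y. F (override_on y a K)) - pexp N (\<lambda>_. p) F\<bar>)"

text \<open>A pair of points is a single point with values in a product, so \<open>pexp\<close> serves couplings too.\<close>

definition pexp2 :: "'i set \<Rightarrow> ('i \<Rightarrow> 'w::finite \<Rightarrow> 'w \<Rightarrow> real) \<Rightarrow> (('i \<Rightarrow> 'w) \<Rightarrow> ('i \<Rightarrow> 'w) \<Rightarrow> real) \<Rightarrow> real" where
  "pexp2 S \<pi> h = pexp S (\<lambda>i (u, v). \<pi> i u v)
     (\<lambda>z. h (restrict (\<lambda>i. fst (z i)) S) (restrict (\<lambda>i. snd (z i)) S))"

lemma pexp2_empty [simp]: "pexp2 {} \<pi> h = h (\<lambda>_. undefined) (\<lambda>_. undefined)"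
  by (simp add: pexp2_def restrict_def)

lemma pexp2_insert:
  assumes "finite S" "j \<notin> S"
  shows "pexp2 (insert j S) \<pi> h = (\<Sum>u\<in>UNIV. \<Sum>v\<in>UNIV. \<pi> j u v * pexp2 S \<pi> (\<lambda>x y. h (x(j := u)) (y(j := v))))"
proof -
  have "restrict (\<lambda>i. fst ((z(j := w)) i)) (insert j S) = (restrict (\<lambda>i. fst (z i)) S)(j := fst w)"
       "restrict (\<lambda>i. snd ((z(j := w)) i)) (insert j S) = (restrict (\<lambda>i. snd (z i)) S)(j := snd w)"
    for z :: "'a \<Rightarrow> 'b \<times> 'b" and w
    using assms by (auto simp: fun_eq_iff restrict_def)
  then show ?thesis
    unfolding pexp2_def pexp_insert[OF assms]
    by (simp add: sum.cartesian_product case_prod_unfold del: fun_upd_apply)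
qed

lemma pexp2_cong:
  assumes "finite S"
    and "\<And>i u v. i \<in> S \<Longrightarrow> \<pi> i u v = \<rho> i u v"
    and "\<And>x y. x \<in> S \<rightarrow>\<^sub>E UNIV \<Longrightarrow> y \<in> S \<rightarrow>\<^sub>E UNIV \<Longrightarrow> (\<And>i. i \<in> S \<Longrightarrow> \<pi> i (x i) (y i) \<noteq> 0) \<Longrightarrow> f x y = g x y"
  shows "pexp2 S \<pi> f = pexp2 S \<rho> g"
  unfolding pexp2_def using assms(1,2)
  by (intro pexp_cong) (auto intro!: assms(3) simp: case_prod_unfold split: prod.splits)

lemma pexp2_mono:
  assumes "finite S"
    and "\<And>i u v. i \<in> S \<Longrightarrow> 0 \<le> \<pi> i u v"
    and "\<And>x y. x \<in> S \<rightarrow>\<^sub>E UNIV \<Longrightarrow> y \<in> S \<rightarrow>\<^sub>E UNIV \<Longrightarrow> (\<And>i. i \<in> S \<Longrightarrow> \<pi> i (x i) (y i) \<noteq> 0) \<Longrightarrow> f x y \<le> g x y"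
  shows "pexp2 S \<pi> f \<le> pexp2 S \<pi> g"
  unfolding pexp2_def using assms(1,2)
  by (intro pexp_mono) (auto intro!: assms(3) simp: case_prod_unfold split: prod.splits)

lemma pexp2_nonneg:
  assumes "finite S"
    and "\<And>i u v. i \<in> S \<Longrightarrow> 0 \<le> \<pi> i u v"
    and "\<And>x y. x \<in> S \<rightarrow>\<^sub>E UNIV \<Longrightarrow> y \<in> S \<rightarrow>\<^sub>E UNIV \<Longrightarrow> (\<And>i. i \<in> S \<Longrightarrow> \<pi> i (x i) (y i) \<noteq> 0) \<Longrightarrow> 0 \<le> f x y"
  shows "0 \<le> pexp2 S \<pi> f"
  unfolding pexp2_def using assms(1,2)
  by (intro pexp_nonneg) (auto intro!: assms(3) simp: case_prod_unfold split: prod.splits)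

lemma pexp2_add: "pexp2 S \<pi> (\<lambda>x y. f x y + g x y) = pexp2 S \<pi> f + pexp2 S \<pi> g"
  by (simp add: pexp2_def pexp_add)

lemma pexp2_diff: "pexp2 S \<pi> (\<lambda>x y. f x y - g x y) = pexp2 S \<pi> f - pexp2 S \<pi> g"
  by (simp add: pexp2_def pexp_diff)

lemma pexp2_cmult: "pexp2 S \<pi> (\<lambda>x y. c * f x y) = c * pexp2 S \<pi> f"
  by (simp add: pexp2_def pexp_cmult)

lemma pexp2_sum: "pexp2 S \<pi> (\<lambda>x y. \<Sum>k\<in>T. f k x y) = (\<Sum>k\<in>T. pexp2 S \<pi> (f k))"
  by (simp add: pexp2_def pexp_sum)

lemma pexp2_prod:
  assumes "finite S"
  shows "pexp2 S \<pi> (\<lambda>x y. \<Prod>i\<in>S. f i (x i) (y i)) = (\<Prod>i\<in>S. \<Sum>u\<in>UNIV. \<Sum>v\<in>UNIV. \<pi> i u v * f i u v)"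
  unfolding pexp2_def using pexp_prod[OF assms, of "\<lambda>i (u, v). \<pi> i u v" "\<lambda>i (u, v). f i u v"]
  by (simp add: case_prod_unfold sum.cartesian_product)

lemma pexp2_kernel:
  assumes "finite S"
  shows "pexp2 S (\<lambda>i u v. p i u * k i u v) h = pexp S p (\<lambda>x. pexp S (\<lambda>i. k i (x i)) (\<lambda>y. h x y))"
  using assms
proof (induction S arbitrary: h)
  case (insert j S)
  have "pexp (insert j S) p (\<lambda>x. pexp (insert j S) (\<lambda>i. k i (x i)) (\<lambda>y. h x y))
    = (\<Sum>u\<in>UNIV. p j u * pexp S p (\<lambda>x. \<Sum>v\<in>UNIV. k j u v * pexp S (\<lambda>i. k i (x i)) (\<lambda>y. h (x(j := u)) (y(j := v)))))"
    unfolding pexp_insert[OF insert(1,2)]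
    using insert(1,2) by (intro sum.cong refl arg_cong2[where f="(*)"] pexp_cong) (auto intro!: pexp_cong)
  also have "\<dots> = (\<Sum>u\<in>UNIV. \<Sum>v\<in>UNIV. p j u * k j u v * pexp S p (\<lambda>x. pexp S (\<lambda>i. k i (x i)) (\<lambda>y. h (x(j := u)) (y(j := v)))))"
    by (simp add: pexp_sum pexp_cmult sum_distrib_left mult.assoc)
  finally show ?case using insert by (simp add: pexp2_insert)
qed simp

lemma pexp2_fst:
  assumes "finite S" "\<And>i u. i \<in> S \<Longrightarrow> (\<Sum>v\<in>UNIV. \<pi> i u v) = p i u"
  shows "pexp2 S \<pi> (\<lambda>x y. f x) = pexp S p f"
  using assms
proof (induction S arbitrary: f)
  case (insert j S)
  then show ?case by (simp add: pexp2_insert pexp_insert flip: sum_distrib_right)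
qed simp

lemma pexp2_snd:
  assumes "finite S" "\<And>i v. i \<in> S \<Longrightarrow> (\<Sum>u\<in>UNIV. \<pi> i u v) = p i v"
  shows "pexp2 S \<pi> (\<lambda>x y. f y) = pexp S p f"
  using assms
proof (induction S arbitrary: f)
  case (insert j S)
  have "pexp2 (insert j S) \<pi> (\<lambda>x y. f y) = (\<Sum>v\<in>UNIV. \<Sum>u\<in>UNIV. \<pi> j u v * pexp S p (\<lambda>y. f (y(j := v))))"
    using insert by (simp add: pexp2_insert) (rule sum.swap)
  with insert show ?case by (simp add: pexp_insert flip: sum_distrib_right)
qed simp

lemma pexp2_split:
  assumes "finite J" "finite S" "J \<inter> S = {}"
  shows "pexp2 (J \<union> S) \<pi> h = pexp2 J \<pi> (\<lambda>a b. pexp2 S \<pi> (\<lambda>x y. h (override_on x a J) (override_on y b J)))"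
  using assms
proof (induction J arbitrary: h)
  case (insert j J)
  have "(override_on y x J)(j := w) = override_on y (x(j := w)) (insert j J)" for x y :: "'a \<Rightarrow> 'b" and w
    using insert by (auto simp: override_on_def fun_eq_iff)
  then show ?case using insert by (simp add: pexp2_insert del: fun_upd_apply)
qed simp

lemma pexp2_split_subset:
  assumes "finite N" "J \<subseteq> N"
  shows "pexp2 N \<pi> h = pexp2 J \<pi> (\<lambda>a b. pexp2 (N - J) \<pi> (\<lambda>x y. h (override_on x a J) (override_on y b J)))"
  using pexp2_split[of J "N - J" \<pi> h] assms finite_subset[of J N] by (simp add: Un_absorb1)

text \<open>The hypothesis says, tested on all functions, that \<open>p i\<close> is the
  push-forward of \<open>q i\<close> along \<open>\<iota>\<close>. It moves expectations from the
  joint type of states and bits back to the states.\<close>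

lemma pexp_push:
  assumes "finite S" "\<And>i f. i \<in> S \<Longrightarrow> (\<Sum>w\<in>UNIV. p i w * f w) = (\<Sum>v\<in>UNIV. q i v * f (\<iota> v))"
  shows "pexp S p f = pexp S q (\<lambda>x. f (restrict (\<lambda>i. \<iota> (x i)) S))"
  using assms
proof (induction S arbitrary: f)
  case (insert j S)
  have e: "restrict (\<lambda>i. \<iota> ((x(j := v)) i)) (insert j S) = (restrict (\<lambda>i. \<iota> (x i)) S)(j := \<iota> v)" for x v
    using insert by (auto simp: fun_eq_iff restrict_def)
  show ?case using insert by (simp add: pexp_insert e del: fun_upd_apply restrict_apply)
qed (simp add: restrict_def)

lemma pexp2_push:
  assumes "finite S" "\<And>i f. i \<in> S \<Longrightarrow> (\<Sum>u\<in>UNIV. \<Sum>v\<in>UNIV. \<pi> i u v * f u v) = (\<Sum>u\<in>UNIV. \<Sum>v\<in>UNIV. \<rho> i u v * f (\<iota> u) (\<iota> v))"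
  shows "pexp2 S \<pi> h = pexp2 S \<rho> (\<lambda>x y. h (restrict (\<lambda>i. \<iota> (x i)) S) (restrict (\<lambda>i. \<iota> (y i)) S))"
  using assms
proof (induction S arbitrary: h)
  case (insert j S)
  have e: "restrict (\<lambda>i. \<iota> ((x(j := v)) i)) (insert j S) = (restrict (\<lambda>i. \<iota> (x i)) S)(j := \<iota> v)" for x v
    using insert by (auto simp: fun_eq_iff restrict_def)
  show ?case using insert by (simp add: pexp2_insert e del: fun_upd_apply restrict_apply)
qed (simp add: restrict_def)

section \<open>Reverse hypercontractivity for correlated bits\<close>

text \<open>Usually stated as <F, TG> >= ||F|| ||G|| in the norm of exponent 1 / r. The substitution
  F = f^r, G = g^r removes the fractional powers, since the norm of F becomes (E f)^r.\<close>

definition reverse_hyper :: "('w::finite \<Rightarrow> 'w \<Rightarrow> real) \<Rightarrow> ('w \<Rightarrow> real) \<Rightarrow> nat \<Rightarrow> bool" where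
  "reverse_hyper \<pi> p r \<longleftrightarrow> (\<forall>f g. (\<forall>w. 0 \<le> f w) \<longrightarrow> (\<forall>w. 0 \<le> g w) \<longrightarrow>
     (\<Sum>w\<in>UNIV. p w * f w) ^ r * (\<Sum>w\<in>UNIV. p w * g w) ^ r
       \<le> (\<Sum>u\<in>UNIV. \<Sum>v\<in>UNIV. \<pi> u v * (f u ^ r * g v ^ r)))"

text \<open>Tensorisation: the one-coordinate inequality is applied to the conditional means over
  the other coordinates, and induction bounds each product of r-th powers of these means.\<close>

lemma reverse_hyper_prod:
  assumes "finite S" "\<And>i. i \<in> S \<Longrightarrow> reverse_hyper (\<pi> i) (p i) r"
    and "\<And>i u v. i \<in> S \<Longrightarrow> 0 \<le> \<pi> i u v" "\<And>i u. i \<in> S \<Longrightarrow> 0 \<le> p i u"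
    and "\<And>x. 0 \<le> f x" "\<And>x. 0 \<le> g x"
  shows "pexp S p f ^ r * pexp S p g ^ r \<le> pexp2 S \<pi> (\<lambda>x y. f x ^ r * g y ^ r)"
  using assms
proof (induction S arbitrary: f g)
  case (insert j S)
  let ?F = "\<lambda>u. pexp S p (\<lambda>x. f (x(j := u)))" and ?G = "\<lambda>u. pexp S p (\<lambda>x. g (x(j := u)))"
  have "0 \<le> ?F u" "0 \<le> ?G u" for u
    by (intro pexp_nonneg insert.hyps insert.prems insertI2; assumption)+
  then have "(\<Sum>w\<in>UNIV. p j w * ?F w) ^ r * (\<Sum>w\<in>UNIV. p j w * ?G w) ^ r
      \<le> (\<Sum>u\<in>UNIV. \<Sum>v\<in>UNIV. \<pi> j u v * (?F u ^ r * ?G v ^ r))"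
    using insert.prems(1)[OF insertI1] unfolding reverse_hyper_def by presburger
  also have "\<dots> \<le> (\<Sum>u\<in>UNIV. \<Sum>v\<in>UNIV. \<pi> j u v * pexp2 S \<pi> (\<lambda>x y. f (x(j := u)) ^ r * g (y(j := v)) ^ r))"
    by (intro sum_mono mult_left_mono insert.IH insert.prems insertI1 insertI2)
  finally show ?case using insert by (simp add: pexp_insert pexp2_insert)
qed simp

definition bit_sign :: "bool \<Rightarrow> real" where "bit_sign b = (if b then 1 else -1)"

lemma bit_sign_sq [simp]: "bit_sign b * bit_sign b = 1" "(bit_sign b)\<^sup>2 = 1"
  by (simp_all add: bit_sign_def)

text \<open>This is cosh x >= 1 + x^2 / 2, obtained by squaring sinh y >= y at y = x / 2.\<close>

lemma exp_sum_ge: "2 + x\<^sup>2 \<le> exp x + exp (- x)" for x :: real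
proof -
  have nonneg: "2 + x\<^sup>2 \<le> exp x + exp (- x)" if "0 \<le> x" for x :: real
  proof -
    define y where "y = x / 2"
    define q where "q = 1 + y + y\<^sup>2 / 2"
    have y: "0 \<le> y" using that by (simp add: y_def)
    have q: "0 < q" "q \<le> exp y" using y exp_lower_Taylor_quadratic[of y] by (auto simp: q_def add_pos_nonneg)
    have "q * q - 2 * y * q - 1 = (y\<^sup>2)\<^sup>2 / 4"
      by (simp add: q_def power2_eq_square algebra_simps)
    then have "2 * y * q \<le> q * q - 1" using zero_le_power2[of "y\<^sup>2"] by linarith
    then have "2 * y \<le> q - 1 / q" using q by (simp add: field_simps)
    moreover have "exp (- y) \<le> 1 / q" using q by (simp add: exp_minus inverse_eq_divide frac_le)
    ultimately have "2 * y \<le> exp y - exp (- y)" using q by linarith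
    then have "(2 * y)\<^sup>2 \<le> (exp y - exp (- y))\<^sup>2" using y by (intro power_mono) auto
    also have "\<dots> = exp x + exp (- x) - 2"
      by (simp add: y_def power2_diff flip: exp_add exp_double)
    finally show ?thesis by (simp add: y_def)
  qed
  show ?thesis using nonneg[of x] nonneg[of "- x"] by (cases "0 \<le> x") auto
qed

lemma one_plus_ge_exp: "exp (x - 2 * x\<^sup>2) \<le> 1 + x" if "\<bar>x\<bar> \<le> 1 / 2" for x :: real
proof -
  have "x - 2 * x\<^sup>2 \<le> ln (1 + x)"
  proof (cases "0 \<le> x")
    case True
    then show ?thesis using that ln_one_plus_pos_lower_bound[of x] zero_le_power2[of x] by linarith
  next
    case False
    then show ?thesis using that ln_one_minus_pos_lower_bound[of "- x"] by simp
  qed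
  moreover have "0 < 1 + x" using that by linarith
  ultimately show ?thesis by (metis exp_le_cancel_iff exp_ln)
qed

text \<open>
  If one of \<open>a\<close>, \<open>b\<close> is not small, a single atom already contributes enough; otherwise \<open>1 + x\<close> is
  close to \<open>exp x\<close>, and the Laplace transform of a pair of bits with correlation bounded away
  from \<open>\<plusminus>1\<close> beats the quadratic error.
\<close>

lemma two_point:
  fixes a b \<rho> \<rho>m :: real
  assumes "0 \<le> \<rho>m" "\<rho>m < 1" "\<bar>\<rho>\<bar> \<le> \<rho>m" and r: "64 \<le> real r * (1 - \<rho>m)\<^sup>2"
    and ab: "\<bar>a\<bar> \<le> 1" "\<bar>b\<bar> \<le> 1"
  shows "1 \<le> (\<Sum>u\<in>UNIV. \<Sum>v\<in>UNIV. (1 + \<rho> * bit_sign u * bit_sign v) / 4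
      * ((1 + a * bit_sign u) * (1 + b * bit_sign v)) ^ r)"
proof -
  define \<gamma> where "\<gamma> = 1 - \<rho>m"
  have \<gamma>: "0 < \<gamma>" "\<gamma> \<le> 1" using assms by (auto simp: \<gamma>_def)
  have w: "\<gamma> / 4 \<le> (1 + \<rho> * bit_sign u * bit_sign v) / 4" for u v
    using assms(3) by (cases u; cases v) (auto simp: bit_sign_def \<gamma>_def)
  have r0: "0 < real r" using r by (cases r) auto
  have r1: "64 \<le> real r * \<gamma>"
  proof -
    have "\<gamma>\<^sup>2 \<le> \<gamma>" using \<gamma> by (simp add: power2_eq_square mult_left_le)
    then have "real r * \<gamma>\<^sup>2 \<le> real r * \<gamma>" using r0 by (intro mult_left_mono) auto
    then show ?thesis using r unfolding \<gamma>_def[symmetric] by linarith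
  qed
  have nn: "0 \<le> 1 + a * bit_sign u" "0 \<le> 1 + b * bit_sign u" for u
    using ab by (auto simp: bit_sign_def)
  let ?t = "\<lambda>u v. (1 + \<rho> * bit_sign u * bit_sign v) / 4 * ((1 + a * bit_sign u) * (1 + b * bit_sign v)) ^ r"
  have tnn: "0 \<le> ?t u v" for u v
    using w[of u v] \<gamma> nn by (intro mult_nonneg_nonneg zero_le_power) linarith+
  \<comment> \<open>Threshold between the two cases. Above it Bernoulli gives at least r * s = 4 /
    \<gamma>, which cancels the lower bound \<gamma> / 4 for the weight of an atom. Below it r *
    \<bar>a\<bar> and r * \<bar>b\<bar> are at most 4 / \<gamma>, and the assumption on
    \<open>r\<close> makes the quadratic error \<open>E\<close> at most 1.\<close>
  define s where "s = 4 / (\<gamma> * real r)"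
  have s: "0 < s" "s \<le> 1 / 2" using r1 r0 \<gamma> by (auto simp: s_def divide_le_eq mult.commute)
  show ?thesis
  proof (cases "s \<le> \<bar>a\<bar> \<or> s \<le> \<bar>b\<bar>")
    case True
    define u v where "u = (0 \<le> a)" and "v = (0 \<le> b)"
    have "1 + s \<le> (1 + \<bar>a\<bar>) * (1 + \<bar>b\<bar>)"
    proof -
      have "(1 + \<bar>a\<bar>) * (1 + \<bar>b\<bar>) = 1 + \<bar>a\<bar> + \<bar>b\<bar> + \<bar>a\<bar> * \<bar>b\<bar>" by (simp add: algebra_simps)
      moreover have "0 \<le> \<bar>a\<bar> * \<bar>b\<bar>" by simp
      ultimately show ?thesis using True abs_ge_zero[of a] abs_ge_zero[of b] by linarith
    qed
    also have "\<dots> = (1 + a * bit_sign u) * (1 + b * bit_sign v)"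
      by (auto simp: u_def v_def bit_sign_def)
    finally have "(1 + s) ^ r \<le> ((1 + a * bit_sign u) * (1 + b * bit_sign v)) ^ r"
      using s by (intro power_mono) auto
    moreover have "1 + real r * s \<le> (1 + s) ^ r" using s by (intro Bernoulli_inequality) auto
    moreover have "real r * s = 4 / \<gamma>" using r0 \<gamma> by (simp add: s_def)
    ultimately have "4 / \<gamma> \<le> ((1 + a * bit_sign u) * (1 + b * bit_sign v)) ^ r" by linarith
    from mult_mono[OF w[of u v] this] have "1 \<le> ?t u v"
      using \<gamma> w[of u v] by simp
    also have "\<dots> \<le> (\<Sum>v\<in>UNIV. ?t u v)" using tnn by (intro member_le_sum) auto
    also have "\<dots> \<le> (\<Sum>u\<in>UNIV. \<Sum>v\<in>UNIV. ?t u v)" using tnn by (intro member_le_sum) (auto intro: sum_nonneg)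
    finally show ?thesis .
  next
    case False
    define \<alpha> \<beta> where "\<alpha> = real r * a" and "\<beta> = real r * b"
    define E where "E = 2 * (\<alpha>\<^sup>2 + \<beta>\<^sup>2) / real r"
    have "(real r * \<bar>x\<bar>)\<^sup>2 \<le> (4 / \<gamma>)\<^sup>2" if "\<bar>x\<bar> \<le> s" for x
    proof -
      have "real r * \<bar>x\<bar> \<le> real r * s" using that by (intro mult_left_mono) auto
      also have "\<dots> = 4 / \<gamma>" using r0 \<gamma> by (simp add: s_def)
      finally show ?thesis by (intro power_mono) auto
    qed
    from this[of a] this[of b] have "\<alpha>\<^sup>2 + \<beta>\<^sup>2 \<le> 32 / \<gamma>\<^sup>2"
      using False by (simp add: \<alpha>_def \<beta>_def power_mult_distrib power_divide)
    then have "2 * (\<alpha>\<^sup>2 + \<beta>\<^sup>2) \<le> 64 / \<gamma>\<^sup>2" by simp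
    also have "\<dots> \<le> real r" using r \<gamma> by (simp add: \<gamma>_def divide_le_eq)
    finally have E1: "0 \<le> E" "E \<le> 1" using r0 by (auto simp: E_def divide_le_eq)
    have "4 / real r \<le> \<gamma> / 2" using r1 r0 by (simp add: divide_le_eq mult.commute)
    then have "2 * E \<le> \<gamma> / 2 * (\<alpha>\<^sup>2 + \<beta>\<^sup>2)"
      using mult_right_mono[of "4 / real r" "\<gamma> / 2" "\<alpha>\<^sup>2 + \<beta>\<^sup>2"] by (simp add: E_def)
    moreover have "exp E \<le> 1 + E + E\<^sup>2" using E1 by (rule exp_bound)
    moreover have "E\<^sup>2 \<le> E" using E1 by (simp add: power2_eq_square mult_left_le)
    ultimately have expE: "exp E \<le> 1 + \<gamma> / 2 * (\<alpha>\<^sup>2 + \<beta>\<^sup>2)" by linarith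
    have atom: "exp (\<alpha> * bit_sign u + \<beta> * bit_sign v) * exp (- E) \<le> ((1 + a * bit_sign u) * (1 + b * bit_sign v)) ^ r" for u v
    proof -
      have f: "exp (a * bit_sign u - 2 * a\<^sup>2) \<le> 1 + a * bit_sign u" "exp (b * bit_sign v - 2 * b\<^sup>2) \<le> 1 + b * bit_sign v"
        using one_plus_ge_exp[of "a * bit_sign u"] one_plus_ge_exp[of "b * bit_sign v"] False s
        by (auto simp: abs_mult power_mult_distrib bit_sign_def split: if_splits)
      have "\<alpha> * bit_sign u + \<beta> * bit_sign v + (- E)
          = real r * ((a * bit_sign u - 2 * a\<^sup>2) + (b * bit_sign v - 2 * b\<^sup>2))"
        using r0 by (simp add: \<alpha>_def \<beta>_def E_def power2_eq_square field_simps)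
      then have "exp (\<alpha> * bit_sign u + \<beta> * bit_sign v) * exp (- E)
          = (exp (a * bit_sign u - 2 * a\<^sup>2) * exp (b * bit_sign v - 2 * b\<^sup>2)) ^ r"
        by (simp only: exp_add [symmetric] exp_of_nat_mult)
      also have "\<dots> \<le> ((1 + a * bit_sign u) * (1 + b * bit_sign v)) ^ r"
        using f nn by (intro power_mono mult_mono) auto
      finally show ?thesis .
    qed
    have cross: "- (\<rho>m * (\<alpha>\<^sup>2 + \<beta>\<^sup>2)) \<le> 2 * \<rho> * (\<alpha> * \<beta>)"
    proof -
      have "\<bar>2 * \<rho> * (\<alpha> * \<beta>)\<bar> = \<bar>\<rho>\<bar> * (2 * \<bar>\<alpha>\<bar> * \<bar>\<beta>\<bar>)" by (simp add: abs_mult)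
      also have "\<dots> \<le> \<rho>m * (\<alpha>\<^sup>2 + \<beta>\<^sup>2)"
        using assms(1,3) zero_le_power2[of "\<bar>\<alpha>\<bar> - \<bar>\<beta>\<bar>"]
        by (intro mult_mono) (auto simp: power2_diff)
      finally show ?thesis by linarith
    qed
    have quad: "\<gamma> / 2 * (\<alpha>\<^sup>2 + \<beta>\<^sup>2) \<le> (\<alpha>\<^sup>2 + \<beta>\<^sup>2 + 2 * \<rho> * (\<alpha> * \<beta>)) / 2"
    proof -
      have "\<gamma> / 2 * (\<alpha>\<^sup>2 + \<beta>\<^sup>2) = (\<alpha>\<^sup>2 + \<beta>\<^sup>2 + - (\<rho>m * (\<alpha>\<^sup>2 + \<beta>\<^sup>2))) / 2"
        by (simp add: \<gamma>_def left_diff_distrib)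
      also have "\<dots> \<le> (\<alpha>\<^sup>2 + \<beta>\<^sup>2 + 2 * \<rho> * (\<alpha> * \<beta>)) / 2"
        by (intro divide_right_mono add_left_mono cross) simp
      finally show ?thesis .
    qed
    have r12: "0 \<le> 1 + \<rho>" "0 \<le> 1 - \<rho>" using assms by linarith+
    have "exp E \<le> 1 + (\<alpha>\<^sup>2 + \<beta>\<^sup>2 + 2 * \<rho> * (\<alpha> * \<beta>)) / 2" using expE quad by linarith
    \<comment> \<open>The two bits are equal with probability (1 + \<rho>) / 2 and opposite
      otherwise, so the Laplace transform is a mixture of cosh (\<alpha> + \<beta>) and cosh
      (\<alpha> - \<beta>).\<close>
    also have "\<dots> = ((1 + \<rho>) * (2 + (\<alpha> + \<beta>)\<^sup>2) + (1 - \<rho>) * (2 + (\<alpha> - \<beta>)\<^sup>2)) / 4"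
      by (simp add: power2_eq_square algebra_simps)
    also have "\<dots> \<le> ((1 + \<rho>) * (exp (\<alpha> + \<beta>) + exp (- (\<alpha> + \<beta>))) + (1 - \<rho>) * (exp (\<alpha> - \<beta>) + exp (- (\<alpha> - \<beta>)))) / 4"
      using r12 by (intro divide_right_mono add_mono mult_left_mono exp_sum_ge) auto
    also have "\<dots> = (\<Sum>u\<in>UNIV. \<Sum>v\<in>UNIV. (1 + \<rho> * bit_sign u * bit_sign v) / 4 * exp (\<alpha> * bit_sign u + \<beta> * bit_sign v))"
      by (simp add: UNIV_bool bit_sign_def algebra_simps add_divide_distrib diff_divide_distrib)
    finally have "exp E * exp (- E)
       \<le> (\<Sum>u\<in>UNIV. \<Sum>v\<in>UNIV. (1 + \<rho> * bit_sign u * bit_sign v) / 4 * exp (\<alpha> * bit_sign u + \<beta> * bit_sign v)) * exp (- E)"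
      by (intro mult_right_mono) auto
    also have "\<dots> = (\<Sum>u\<in>UNIV. \<Sum>v\<in>UNIV. (1 + \<rho> * bit_sign u * bit_sign v) / 4 * (exp (\<alpha> * bit_sign u + \<beta> * bit_sign v) * exp (- E)))"
      by (simp only: sum_distrib_right mult.assoc)
    also have "\<dots> \<le> (\<Sum>u\<in>UNIV. \<Sum>v\<in>UNIV. ?t u v)"
    proof (intro sum_mono mult_left_mono atom)
      show "0 \<le> (1 + \<rho> * bit_sign u * bit_sign v) / 4" for u v using w[of u v] \<gamma> by linarith
    qed
    finally show ?thesis by (simp flip: exp_add)
  qed
qed

text \<open>By homogeneity one divides by the means: a nonnegative function on two points is its
  mean times 1 + a * sign with \<bar>a\<bar> <= 1, which leaves the normalised inequality
  \<open>two_point\<close>. If a mean vanishes, so does the left-hand side, as \<open>r\<close> is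
  positive.\<close>

lemma reverse_hyper_bit:
  assumes "0 \<le> \<rho>m" "\<rho>m < 1" "\<bar>\<rho>\<bar> \<le> \<rho>m" "64 \<le> real r * (1 - \<rho>m)\<^sup>2"
  shows "reverse_hyper (\<lambda>u v. (1 + \<rho> * bit_sign u * bit_sign v) / 4) (\<lambda>_. 1 / 2) r"
  unfolding reverse_hyper_def
proof (intro allI impI)
  fix f g :: "bool \<Rightarrow> real" assume f: "\<forall>w. 0 \<le> f w" and g: "\<forall>w. 0 \<le> g w"
  define A where "A = (f True + f False) / 2"
  define B where "B = (g True + g False) / 2"
  have AB: "(\<Sum>w\<in>UNIV. 1 / 2 * f w) = A" "(\<Sum>w\<in>UNIV. 1 / 2 * g w) = B"
    by (simp_all add: UNIV_bool A_def B_def)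
  have r: "0 < r" using assms(4) by (cases r) auto
  have w: "0 \<le> (1 + \<rho> * bit_sign u * bit_sign v) / 4" for u v
    using assms(2,3) by (cases u; cases v) (auto simp: bit_sign_def)
  show "(\<Sum>w\<in>UNIV. 1 / 2 * f w) ^ r * (\<Sum>w\<in>UNIV. 1 / 2 * g w) ^ r
       \<le> (\<Sum>u\<in>UNIV. \<Sum>v\<in>UNIV. (1 + \<rho> * bit_sign u * bit_sign v) / 4 * (f u ^ r * g v ^ r))"
  proof (cases "A = 0 \<or> B = 0")
    case True
    then have "A ^ r * B ^ r = 0" using r by (auto simp: zero_power)
    moreover have "0 \<le> (\<Sum>u\<in>UNIV. \<Sum>v\<in>UNIV. (1 + \<rho> * bit_sign u * bit_sign v) / 4 * (f u ^ r * g v ^ r))"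
      using f g by (intro sum_nonneg mult_nonneg_nonneg zero_le_power w) auto
    ultimately show ?thesis unfolding AB by linarith
  next
    case False
    then have pos: "0 < A" "0 < B" using f g by (auto simp: A_def B_def order_less_le add_nonneg_eq_0_iff)
    define a where "a = (f True - f False) / (2 * A)"
    define b where "b = (g True - g False) / (2 * B)"
    have "A * a = (f True - f False) / 2" "B * b = (g True - g False) / 2"
      using pos by (simp_all add: a_def b_def)
    moreover have "A = (f True + f False) / 2" "B = (g True + g False) / 2"
      by (simp_all add: A_def B_def)
    ultimately have vals: "f True = A + A * a" "f False = A - A * a" "g True = B + B * b" "g False = B - B * b"
      by argo+
    then have fu: "f u = A * (1 + a * bit_sign u)" and gu: "g u = B * (1 + b * bit_sign u)" for u
      by (cases u; simp add: bit_sign_def algebra_simps)+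
    have bounds: "\<bar>c\<bar> \<le> 1" if "0 \<le> C + C * c" "0 \<le> C - C * c" "0 < C" for c C :: real
    proof -
      have "0 \<le> C * (1 + c)" "0 \<le> C * (1 - c)" using that by (simp_all add: algebra_simps)
      then show ?thesis using that(3) by (simp add: zero_le_mult_iff abs_le_iff)
    qed
    have "\<bar>a\<bar> \<le> 1" "\<bar>b\<bar> \<le> 1"
      using bounds[of A a] bounds[of B b] pos f g vals by metis+
    note main = two_point[OF assms this]
    have pw: "f u ^ r * g v ^ r = (A * B) ^ r * ((1 + a * bit_sign u) * (1 + b * bit_sign v)) ^ r" for u v
    proof -
      have "f u * g v = A * B * ((1 + a * bit_sign u) * (1 + b * bit_sign v))"
        unfolding fu gu by (simp only: mult_ac)
      then show ?thesis by (simp only: power_mult_distrib [symmetric])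
    qed
    have "A ^ r * B ^ r = (A * B) ^ r" by (simp only: power_mult_distrib)
    also have "\<dots> \<le> (A * B) ^ r * (\<Sum>u\<in>UNIV. \<Sum>v\<in>UNIV. (1 + \<rho> * bit_sign u * bit_sign v) / 4
        * ((1 + a * bit_sign u) * (1 + b * bit_sign v)) ^ r)"
    proof -
      have "0 \<le> (A * B) ^ r" using pos by (intro zero_le_power) simp
      from mult_left_mono[OF main this] show ?thesis by (simp only: mult_1_right)
    qed
    also have "\<dots> = (\<Sum>u\<in>UNIV. \<Sum>v\<in>UNIV. (1 + \<rho> * bit_sign u * bit_sign v) / 4 * (f u ^ r * g v ^ r))"
      unfolding pw by (simp only: sum_distrib_left mult.left_commute)
    finally show ?thesis unfolding AB .
  qed
qed

section \<open>Spectrum of a reversible chain\<close>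

text \<open>A maximiser of the quadratic form on the unit sphere of \<open>S\<close> works: its
  first variation vanishes in every direction of \<open>S\<close> orthogonal to \<open>x\<close>, so
  \<open>f x\<close> has no component orthogonal to \<open>x\<close>.\<close>

lemma self_adjoint_eigenvector:
  fixes f :: "'a::euclidean_space \<Rightarrow> 'a"
  assumes lin: "linear f" and sa: "\<And>x y. f x \<bullet> y = x \<bullet> f y"
    and sub: "subspace S" and inv: "\<And>x. x \<in> S \<Longrightarrow> f x \<in> S" and ne: "S \<noteq> {0}"
  obtains x c where "x \<in> S" "norm x = 1" "f x = c *\<^sub>R x"
proof -
  let ?K = "S \<inter> sphere 0 1"
  have comp: "compact ?K"
    by (intro closed_Int_compact closed_subspace sub compact_sphere)
  obtain z where z: "z \<in> S" "z \<noteq> 0" using ne subspace_0[OF sub] by blast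
  have "(1 / norm z) *\<^sub>R z \<in> ?K" using z sub by (simp add: subspace_scale)
  then have Kne: "?K \<noteq> {}" by blast
  have "continuous_on ?K (\<lambda>x. x \<bullet> f x)"
    using lin by (intro continuous_intros linear_continuous_on) (simp add: linear_conv_bounded_linear)
  from continuous_attains_sup[OF comp Kne this]
  obtain x where x: "x \<in> ?K" and mx: "\<And>y. y \<in> ?K \<Longrightarrow> y \<bullet> f y \<le> x \<bullet> f x" by blast
  define c where "c = x \<bullet> f x"
  have xS: "x \<in> S" and nx: "x \<bullet> x = 1" using x by (auto simp: dot_square_norm)
  have bound: "y \<bullet> f y \<le> c * (y \<bullet> y)" if "y \<in> S" for y
  proof (cases "y = 0")
    case False
    let ?u = "(1 / norm y) *\<^sub>R y"
    have "?u \<in> ?K" using that sub False by (simp add: subspace_scale)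
    from mx[OF this] have "(y \<bullet> f y) / (norm y)\<^sup>2 \<le> c"
      by (simp add: linear_scale[OF lin] c_def power2_eq_square)
    then show ?thesis using False by (simp add: divide_le_eq dot_square_norm)
  qed simp
  have orth: "f x \<bullet> y = 0" if "y \<in> S" "x \<bullet> y = 0" for y
  proof -
    define a where "a = f x \<bullet> y"
    define b where "b = c * (y \<bullet> y) - y \<bullet> f y"
    have ineq: "2 * t * a \<le> t\<^sup>2 * b" for t
    proof -
      have "x + t *\<^sub>R y \<in> S" using that xS sub by (simp add: subspace_add subspace_scale)
      from bound[OF this] show ?thesis
        using that(2) nx sa[of x y]
        by (simp add: linear_add[OF lin] linear_scale[OF lin] inner_add_left inner_add_right
            a_def b_def c_def inner_commute power2_eq_square algebra_simps)
    qed
    \<comment> \<open>This value of t is so small that the quadratic term cannot absorb the linear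
      one unless \<open>a\<close> vanishes; the summand 1 excludes a zero denominator.\<close>
    have "2 * (a / (\<bar>b\<bar> + 1)) * a \<le> (a / (\<bar>b\<bar> + 1))\<^sup>2 * b" by (rule ineq)
    also have "\<dots> \<le> (a / (\<bar>b\<bar> + 1))\<^sup>2 * (\<bar>b\<bar> + 1)" by (intro mult_left_mono) auto
    also have "\<dots> = a * a / (\<bar>b\<bar> + 1)" by (simp add: power2_eq_square)
    finally have "a * a / (\<bar>b\<bar> + 1) \<le> 0" by simp
    moreover have "0 < \<bar>b\<bar> + 1" by linarith
    ultimately have "a * a \<le> 0" by (simp add: divide_le_0_iff not_less)
    then show ?thesis unfolding a_def by (metis mult_eq_0_iff zero_le_square antisym)
  qed
  define y where "y = f x - c *\<^sub>R x"
  have "y \<in> S" using inv xS sub by (simp add: y_def subspace_diff subspace_scale)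
  moreover have xy: "x \<bullet> y = 0" by (simp add: y_def inner_diff_right c_def nx)
  ultimately have "f x \<bullet> y = 0" by (rule orth)
  then have "y \<bullet> y = 0" using xy by (simp add: y_def inner_diff_left)
  then have "f x = c *\<^sub>R x" by (simp add: y_def)
  then show thesis using that xS x by simp
qed

text \<open>Induction on the dimension: an eigenvector is split off, and its orthogonal complement
  within \<open>S\<close> is again invariant because \<open>f\<close> is self-adjoint.\<close>

lemma self_adjoint_eigenbasis:
  fixes f :: "'a::euclidean_space \<Rightarrow> 'a"
  assumes lin: "linear f" and sa: "\<And>x y. f x \<bullet> y = x \<bullet> f y"
    and "subspace S" "\<And>x. x \<in> S \<Longrightarrow> f x \<in> S"
  shows "\<exists>B\<subseteq>S. pairwise orthogonal B \<and> (\<forall>b\<in>B. norm b = 1) \<and> S \<subseteq> span B \<and> (\<forall>b\<in>B. \<exists>c. f b = c *\<^sub>R b)"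
  using assms(3,4)
proof (induction "dim S" arbitrary: S rule: less_induct)
  case less
  show ?case
  proof (cases "S = {0}")
    case True
    then show ?thesis by (intro exI[of _ "{}"]) auto
  next
    case False
    obtain x c where x: "x \<in> S" "norm x = 1" "f x = c *\<^sub>R x"
      using self_adjoint_eigenvector[OF lin sa less.prems(1,2) False] by metis
    define S' where "S' = {y \<in> S. x \<bullet> y = 0}"
    have nx: "x \<bullet> x = 1" using x by (simp add: dot_square_norm)
    have sub: "subspace S'" using less.prems(1)
      unfolding subspace_def S'_def by (auto simp: inner_add_right)
    have inv: "f y \<in> S'" if "y \<in> S'" for y
      using that less.prems(2) x(3) sa[of x y] by (simp add: S'_def)
    have "dim S' < dim S"
    proof (rule dim_psubset)
      have "x \<notin> S'" "S' \<subseteq> S" using nx by (auto simp: S'_def)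
      then have "S' \<subset> S" using x(1) by blast
      then show "span S' \<subset> span S"
        using sub less.prems(1) by (simp only: span_eq_iff [THEN iffD2])
    qed
    from less.hyps[OF this sub inv] obtain B where B: "B \<subseteq> S'" "pairwise orthogonal B"
      "\<forall>b\<in>B. norm b = 1" "S' \<subseteq> span B" "\<forall>b\<in>B. \<exists>c. f b = c *\<^sub>R b" by blast
    have "S \<subseteq> span (insert x B)"
    proof
      fix s assume s: "s \<in> S"
      have "s - (x \<bullet> s) *\<^sub>R x \<in> S'"
        using s x less.prems(1) nx by (simp add: S'_def subspace_diff subspace_scale inner_diff_right)
      then have "s - (x \<bullet> s) *\<^sub>R x \<in> span (insert x B)"
        using B(4) span_mono[of B "insert x B"] by blast
      moreover have "(x \<bullet> s) *\<^sub>R x \<in> span (insert x B)"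
        by (intro span_scale span_base) simp
      ultimately show "s \<in> span (insert x B)" using span_add by fastforce
    qed
    moreover have "pairwise orthogonal (insert x B)"
      using B by (auto simp: pairwise_insert orthogonal_def S'_def inner_commute)
    ultimately show ?thesis using B x by (intro exI[of _ "insert x B"]) (auto simp: S'_def)
  qed
qed

text \<open>The predicate carries the number of steps made so far: constancy along paths ignores it,
  while the alternation of signs behind aperiodicity needs its parity.\<close>

lemma matpow_path_induct:
  assumes "transition_matrix A" "0 < matpow A k $ x $ y" "P j x"
    and "\<And>j u v. 0 < A $ u $ v \<Longrightarrow> P j u \<Longrightarrow> P (Suc j) v"
  shows "P (j + k) y"
  using assms(2,3)
proof (induction k arbitrary: x j)
  case 0
  then show ?case by (simp add: mat_def split: if_splits)
next
  case (Suc k)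
  have "0 < (\<Sum>z\<in>UNIV. A $ x $ z * matpow A k $ z $ y)"
    using Suc.prems by (simp add: matrix_matrix_mult_def)
  moreover have "(\<Sum>z\<in>UNIV. A $ x $ z * matpow A k $ z $ y) \<le> 0"
    if "\<And>z. A $ x $ z * matpow A k $ z $ y \<le> 0" using that by (intro sum_nonpos)
  ultimately obtain z where z: "0 < A $ x $ z * matpow A k $ z $ y"
    by (meson not_less)
  moreover have "0 \<le> A $ x $ z" using assms(1) by (simp add: transition_matrix_def)
  ultimately have "0 < A $ x $ z" "0 < matpow A k $ z $ y" by (auto simp: zero_less_mult_iff)
  then show ?case using Suc.IH[of z "Suc j"] Suc.prems assms(4) by simp
qed

lemma stationary_measure_pos:
  assumes "transition_matrix A" "irreducible_chain A" "stationary_measure A \<mu>"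
  shows "0 < \<mu> $ y"
proof -
  have nn: "0 \<le> \<mu> $ x" for x using assms(3) by (simp add: stationary_measure_def)
  have "(\<Sum>x\<in>UNIV. \<mu> $ x) = 1" using assms(3) by (simp add: stationary_measure_def)
  then obtain x where "\<mu> $ x \<noteq> 0" by (metis sum.neutral zero_neq_one)
  then have x: "0 < \<mu> $ x" using nn[of x] by simp
  obtain k where k: "0 < matpow A k $ x $ y" using assms(2) unfolding irreducible_chain_def by metis
  show ?thesis
  proof (rule matpow_path_induct[where P = "\<lambda>_ u. 0 < \<mu> $ u" and j = 0, OF assms(1) k x])
    fix j :: nat and u v assume uv: "0 < A $ u $ v" "0 < \<mu> $ u"
    have "\<mu> $ v = (\<Sum>x\<in>UNIV. A $ x $ v * \<mu> $ x)"
    proof -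
      have "\<mu> v* A = \<mu>" using assms(3) by (simp add: stationary_measure_def)
      then have "\<mu> $ v = (\<mu> v* A) $ v" by simp
      then show ?thesis by (simp add: vector_matrix_mult_def mult.commute)
    qed
    moreover have "A $ u $ v * \<mu> $ u \<le> (\<Sum>x\<in>UNIV. A $ x $ v * \<mu> $ x)"
      using assms(1) nn by (intro member_le_sum) (auto simp: transition_matrix_def)
    ultimately show "0 < \<mu> $ v" using mult_pos_pos[OF uv] by linarith
  qed
qed

text \<open>Conjugating \<open>A\<close> by the diagonal matrix of the square roots of \<mu> gives
  the symmetric matrix \<open>C\<close>; its eigenvectors divided by these roots are the \<phi>.
  There are as many as states, so the state type itself indexes them, and \<open>e0\<close> belongs
  to the constant. Irreducibility excludes the eigenvalue 1 elsewhere, aperiodicity the eigenvalue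
  -1.\<close>

lemma reversible_spectrum:
  fixes A :: "real ^ 'v ^ 'v::finite" and \<mu> :: "real ^ 'v"
  assumes tr: "transition_matrix A" and irr: "irreducible_chain A" and ap: "aperiodic_chain A"
    and st: "stationary_measure A \<mu>" and rev: "reversible_chain A \<mu>"
  obtains \<phi> :: "'v \<Rightarrow> 'v \<Rightarrow> real" and lam :: "'v \<Rightarrow> real" and e0 and L
  where "\<And>x. \<phi> e0 x = 1"
    and "\<And>k l. (\<Sum>x\<in>UNIV. \<mu> $ x * (\<phi> k x * \<phi> l x)) = (if k = l then 1 else 0)"
    and "\<And>x y. (\<Sum>k\<in>UNIV. \<phi> k x * \<phi> k y * \<mu> $ y) = (if x = y then 1 else 0)"
    and "\<And>k x. (\<Sum>y\<in>UNIV. A $ x $ y * \<phi> k y) = lam k * \<phi> k x"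
    and "0 \<le> L" "L < 1" "\<And>k. k \<noteq> e0 \<Longrightarrow> \<bar>lam k\<bar> \<le> L"
proof -
  have pos: "0 < \<mu> $ x" for x using stationary_measure_pos[OF tr irr st] .
  have sum1: "(\<Sum>x\<in>UNIV. \<mu> $ x) = 1" using st by (simp add: stationary_measure_def)
  have Ann: "0 \<le> A $ x $ y" and Asum: "(\<Sum>y\<in>UNIV. A $ x $ y) = 1" for x y
    using tr by (auto simp: transition_matrix_def)
  have bal: "\<mu> $ x * A $ x $ y = \<mu> $ y * A $ y $ x" for x y
    using rev by (simp add: reversible_chain_def)
  define s where "s = (\<chi> x. sqrt (\<mu> $ x))"
  have spos: "0 < s $ x" for x using pos by (simp add: s_def)
  have ss: "s $ x * s $ x = \<mu> $ x" for x using pos[of x] by (simp add: s_def)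
  define C where "C = (\<chi> x y. s $ x * A $ x $ y / s $ y)"
  have Csym: "C $ x $ y = C $ y $ x" for x y
  proof -
    have "s $ x * s $ x * A $ x $ y = s $ y * s $ y * A $ y $ x" using bal ss by metis
    then show ?thesis using spos[of x] spos[of y] by (simp add: C_def field_simps)
  qed
  let ?f = "\<lambda>w. C *v w"
  have lin: "linear ?f" by simp
  have sa: "?f x \<bullet> y = x \<bullet> ?f y" for x y
  proof -
    have "?f x \<bullet> y = (\<Sum>i\<in>UNIV. \<Sum>j\<in>UNIV. C $ i $ j * x $ j * y $ i)"
      by (simp add: inner_vec_def matrix_vector_mult_def sum_distrib_right)
    also have "\<dots> = (\<Sum>j\<in>UNIV. \<Sum>i\<in>UNIV. C $ i $ j * x $ j * y $ i)" by (rule sum.swap)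
    also have "\<dots> = x \<bullet> ?f y"
      unfolding inner_vec_def matrix_vector_mult_def
      by (simp add: sum_distrib_left) (intro sum.cong refl, subst Csym, simp add: mult_ac)
    finally show ?thesis .
  qed
  have fs: "?f s = s"
  proof -
    have "(\<Sum>y\<in>UNIV. C $ x $ y * s $ y) = s $ x" for x
    proof -
      have "C $ x $ y * s $ y = s $ x * A $ x $ y" for y using spos[of y] by (simp add: C_def)
      then show ?thesis using Asum[of x] by (simp flip: sum_distrib_left)
    qed
    then show ?thesis by (simp add: vec_eq_iff matrix_vector_mult_def)
  qed
  have ns: "s \<bullet> s = 1" using ss sum1 by (simp add: inner_vec_def)
  define S where "S = {w. s \<bullet> w = 0}"
  have "subspace S" by (auto simp: S_def subspace_def inner_add_right)
  moreover have "?f w \<in> S" if "w \<in> S" for w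
    using that sa[of s w] fs by (simp add: S_def)
  ultimately obtain B where B: "B \<subseteq> S" "pairwise orthogonal B"
      "\<forall>b\<in>B. norm b = 1" "S \<subseteq> span B" "\<forall>b\<in>B. \<exists>c. ?f b = c *\<^sub>R b"
    using self_adjoint_eigenbasis[OF lin sa, of S] by blast
  define B0 where "B0 = insert s B"
  have B0: "pairwise orthogonal B0" "\<And>b. b \<in> B0 \<Longrightarrow> norm b = 1" "\<And>b. b \<in> B0 \<Longrightarrow> \<exists>c. ?f b = c *\<^sub>R b"
    using B ns fs by (auto simp: B0_def S_def pairwise_insert orthogonal_def inner_commute norm_eq_1 intro: exI[of _ 1])
  have span: "span B0 = UNIV"
  proof -
    have "w \<in> span B0" for w
    proof -
      have "w - (s \<bullet> w) *\<^sub>R s \<in> S" by (simp add: S_def inner_diff_right ns)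
      then have "w - (s \<bullet> w) *\<^sub>R s \<in> span B0"
        using B(4) span_mono[of B B0] by (auto simp: B0_def)
      moreover have "(s \<bullet> w) *\<^sub>R s \<in> span B0" by (intro span_scale span_base) (simp add: B0_def)
      ultimately show ?thesis using span_add by fastforce
    qed
    then show ?thesis by blast
  qed
  have "0 \<notin> B0" using B0(2) by force
  then have ind: "independent B0" using B0(1) pairwise_orthogonal_independent by blast
  then have fin: "finite B0" using independent_imp_finite by blast
  have "card B0 = CARD('v)"
    using dim_eq_card_independent[OF ind] span dim_span[of B0] by (simp add: dim_UNIV)
  then obtain b where b: "bij_betw b (UNIV :: 'v set) B0"
    using finite_same_card_bij[of "UNIV :: 'v set" B0] fin by auto
  have bB: "b k \<in> B0" for k using b by (auto simp: bij_betw_def)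
  have bn: "b k \<bullet> b l = (if k = l then 1 else 0)" for k l
  proof (cases "k = l")
    case True then show ?thesis using B0(2)[OF bB] by (simp add: norm_eq_1)
  next
    case False
    then have "b k \<noteq> b l" using b by (auto simp: bij_betw_def inj_on_def)
    then show ?thesis using B0(1) bB False by (auto simp: pairwise_def orthogonal_def)
  qed
  obtain e0 where e0: "b e0 = s" using b by (metis B0_def bij_betw_iff_bijections insertI1)
  define \<phi> where "\<phi> k x = b k $ x / s $ x" for k x
  have b\<phi>: "b k $ x = s $ x * \<phi> k x" for k x using spos[of x] by (simp add: \<phi>_def)
  obtain lam where lam: "?f (b k) = lam k *\<^sub>R b k" for k using B0(3)[OF bB] by metis
  have p1: "\<phi> e0 x = 1" for x using spos[of x] by (simp add: \<phi>_def e0)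
  have p2: "(\<Sum>x\<in>UNIV. \<mu> $ x * (\<phi> k x * \<phi> l x)) = (if k = l then 1 else 0)" for k l
  proof -
    have "\<mu> $ x * (\<phi> k x * \<phi> l x) = b k $ x * b l $ x" for x
      unfolding b\<phi> ss[symmetric] by simp
    then show ?thesis using bn[of k l] by (simp add: inner_vec_def)
  qed
  have p3: "(\<Sum>k\<in>UNIV. \<phi> k x * \<phi> k y * \<mu> $ y) = (if x = y then 1 else 0)" for x y
  proof -
    have "(\<Sum>i\<in>B0. (axis y 1 \<bullet> i) *\<^sub>R i) = axis y (1::real)"
      using B0 fin span by (intro orthonormal_basis_expand) auto
    then have "(\<Sum>k\<in>UNIV. (axis y 1 \<bullet> b k) *\<^sub>R b k) = axis y (1::real)"
      using sum.reindex_bij_betw[OF b, of "\<lambda>i. (axis y 1 \<bullet> i) *\<^sub>R i"] by simp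
    then have "(\<Sum>k\<in>UNIV. (axis y 1 \<bullet> b k) *\<^sub>R b k) $ x = axis y (1::real) $ x" by simp
    then have e: "(\<Sum>k\<in>UNIV. b k $ y * b k $ x) = (if x = y then 1 else 0)"
      by (simp add: inner_axis') (simp add: axis_def)
    have "\<phi> k x * \<phi> k y * \<mu> $ y = (s $ y / s $ x) * (b k $ y * b k $ x)" for k
      unfolding b\<phi> ss[symmetric] using spos[of x] by simp
    then have "(\<Sum>k\<in>UNIV. \<phi> k x * \<phi> k y * \<mu> $ y) = (s $ y / s $ x) * (if x = y then 1 else 0)"
      by (simp only: e flip: sum_distrib_left)
    then show ?thesis using spos[of x] by (auto simp: less_imp_neq [symmetric])
  qed
  have p4: "(\<Sum>y\<in>UNIV. A $ x $ y * \<phi> k y) = lam k * \<phi> k x" for k x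
  proof -
    have "(\<Sum>y\<in>UNIV. C $ x $ y * b k $ y) = lam k * b k $ x"
      using arg_cong[OF lam[of k], of "\<lambda>w. w $ x"] by (simp add: matrix_vector_mult_def)
    moreover have "C $ x $ y * b k $ y = s $ x * (A $ x $ y * \<phi> k y)" for y
      unfolding b\<phi> using spos[of y] by (simp add: C_def)
    ultimately have "s $ x * (\<Sum>y\<in>UNIV. A $ x $ y * \<phi> k y) = s $ x * (lam k * \<phi> k x)"
      by (simp only: sum_distrib_left) (simp add: b\<phi> mult.left_commute)
    then show ?thesis using spos[of x] by simp
  qed
  \<comment> \<open>For c = 1 this is the Dirichlet form, for c = -1 its counterpart at the other
    end of the spectrum. Nonnegativity gives \<bar>lam k\<bar> <= 1; where the form vanishes, \<phi>
    changes by the factor c along every edge.\<close>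
  have dirichlet: "(\<Sum>x\<in>UNIV. \<Sum>y\<in>UNIV. \<mu> $ x * A $ x $ y * (\<phi> k x - c * \<phi> k y)\<^sup>2) = 2 - 2 * c * lam k"
    if "c * c = 1" for c k
  proof -
    have 1: "(\<Sum>x\<in>UNIV. \<Sum>y\<in>UNIV. \<mu> $ x * A $ x $ y * (\<phi> k x)\<^sup>2) = 1"
      using p2[of k k] Asum by (simp add: power2_eq_square mult.assoc mult.commute mult.left_commute flip: sum_distrib_left sum_distrib_right)
    have "(\<Sum>x\<in>UNIV. \<Sum>y\<in>UNIV. \<mu> $ x * A $ x $ y * (\<phi> k y)\<^sup>2)
        = (\<Sum>y\<in>UNIV. \<Sum>x\<in>UNIV. \<mu> $ y * A $ y $ x * (\<phi> k y)\<^sup>2)"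
      by (subst sum.swap) (simp add: bal)
    then have 2: "(\<Sum>x\<in>UNIV. \<Sum>y\<in>UNIV. \<mu> $ x * A $ x $ y * (\<phi> k y)\<^sup>2) = 1" using 1 by simp
    have "(\<Sum>x\<in>UNIV. \<Sum>y\<in>UNIV. \<mu> $ x * A $ x $ y * (\<phi> k x * \<phi> k y))
        = (\<Sum>x\<in>UNIV. \<mu> $ x * \<phi> k x * (\<Sum>y\<in>UNIV. A $ x $ y * \<phi> k y))"
      by (simp add: sum_distrib_left mult_ac)
    also have "\<dots> = lam k * (\<Sum>x\<in>UNIV. \<mu> $ x * (\<phi> k x * \<phi> k x))"
      unfolding p4 by (simp add: sum_distrib_left mult_ac)
    finally have 3: "(\<Sum>x\<in>UNIV. \<Sum>y\<in>UNIV. \<mu> $ x * A $ x $ y * (\<phi> k x * \<phi> k y)) = lam k"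
      by (simp add: p2)
    have "\<mu> $ x * A $ x $ y * (\<phi> k x - c * \<phi> k y)\<^sup>2 = \<mu> $ x * A $ x $ y * (\<phi> k x)\<^sup>2
       + \<mu> $ x * A $ x $ y * (\<phi> k y)\<^sup>2 - 2 * c * (\<mu> $ x * A $ x $ y * (\<phi> k x * \<phi> k y))" for x y
    proof -
      have "(\<phi> k x - c * \<phi> k y)\<^sup>2 = (\<phi> k x)\<^sup>2 + (c * c) * (\<phi> k y)\<^sup>2 - 2 * c * (\<phi> k x * \<phi> k y)"
        by (simp add: power2_eq_square algebra_simps)
      then show ?thesis unfolding that by (simp only:) (simp add: algebra_simps)
    qed
    then show ?thesis using 1 2 3 by (simp add: sum.distrib sum_subtractf flip: sum_distrib_left)
  qed
  have edge: "\<phi> k x = c * \<phi> k y" if "c * c = 1" "c * lam k = 1" "0 < A $ x $ y" for c k x y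
  proof -
    let ?t = "\<lambda>x y. \<mu> $ x * A $ x $ y * (\<phi> k x - c * \<phi> k y)\<^sup>2"
    have nn: "0 \<le> ?t x y" for x y using pos[of x] Ann by (simp add: less_imp_le)
    have "(\<Sum>x\<in>UNIV. \<Sum>y\<in>UNIV. ?t x y) = 0" using dirichlet[OF that(1), of k] that(2) by simp
    then have "(\<Sum>y\<in>UNIV. ?t x y) = 0"
      using nn by (subst (asm) sum_nonneg_eq_0_iff) (auto intro: sum_nonneg)
    then have "?t x y = 0" using nn by (subst (asm) sum_nonneg_eq_0_iff) auto
    then show ?thesis using pos[of x] that(3) by simp
  qed
  have nz: "\<exists>x. \<phi> k x \<noteq> 0" for k
    using p2[of k k] by (metis (no_types, lifting) mult_zero_right sum.neutral zero_neq_one)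
  have lt: "\<bar>lam k\<bar> < 1" if "k \<noteq> e0" for k
  proof -
    have le: "\<bar>lam k\<bar> \<le> 1"
    proof -
      have "0 \<le> 2 - 2 * c * lam k" if "c * c = 1" for c :: real
        unfolding dirichlet[OF that, symmetric]
        using pos Ann by (intro sum_nonneg mult_nonneg_nonneg) (auto simp: less_imp_le)
      from this[of 1] this[of "-1"] show ?thesis by simp
    qed
    have "lam k \<noteq> 1"
    proof
      assume l1: "lam k = 1"
      obtain x where x: "\<phi> k x \<noteq> 0" using nz by blast
      have const: "\<phi> k y = \<phi> k x" for y
      proof -
        obtain m where "0 < matpow A m $ x $ y" using irr unfolding irreducible_chain_def by metis
        from matpow_path_induct[OF tr this, of "\<lambda>_ u. \<phi> k u = \<phi> k x" 0] edge[of 1 k] l1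
        show ?thesis by simp
      qed
      have "(\<Sum>y\<in>UNIV. \<mu> $ y * (\<phi> k y * \<phi> e0 y)) = \<phi> k x"
      proof -
        have "\<mu> $ y * (\<phi> k y * \<phi> e0 y) = \<mu> $ y * \<phi> k x" for y
          by (subst const) (simp add: p1)
        then show ?thesis by (simp only: flip: sum_distrib_right) (simp add: sum1)
      qed
      then show False using p2[of k e0] that x by simp
    qed
    moreover have "lam k \<noteq> -1"
    proof
      assume l1: "lam k = -1"
      obtain x where x: "\<phi> k x \<noteq> 0" using nz by blast
      \<comment> \<open>\<phi> changes sign at every step, so a return to a point where it is
        nonzero takes an even number of steps.\<close>
      have "2 dvd m" if "1 \<le> m" "0 < matpow A m $ x $ x" for m
      proof -
        have "\<phi> k x = (- 1) ^ (0 + m) * \<phi> k x"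
        proof (rule matpow_path_induct[OF tr that(2), of "\<lambda>j u. \<phi> k u = (- 1) ^ j * \<phi> k x" 0])
          fix j u v assume "0 < A $ u $ v" "\<phi> k u = (- 1) ^ j * \<phi> k x"
          then show "\<phi> k v = (- 1) ^ Suc j * \<phi> k x" using edge[of "-1" k u v] l1 by simp
        qed simp
        then show ?thesis using x by (cases "even m") auto
      qed
      then have "2 dvd Gcd {m. 1 \<le> m \<and> 0 < matpow A m $ x $ x}" by (intro Gcd_greatest) auto
      then show False using ap by (simp add: aperiodic_chain_def)
    qed
    ultimately show ?thesis using le by linarith
  qed
  \<comment> \<open>The 0 keeps the maximum defined and nonnegative when there is a single
    state.\<close>
  define L where "L = Max (insert 0 ((\<lambda>k. \<bar>lam k\<bar>) ` {k. k \<noteq> e0}))"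
  have "0 \<le> L" "L < 1" "k \<noteq> e0 \<Longrightarrow> \<bar>lam k\<bar> \<le> L" for k
    using lt by (auto simp: L_def)
  then show thesis using that[of \<phi> e0 lam L] p1 p2 p3 p4 by blast
qed

section \<open>Polynomial chaos, hypercontractivity and invariance\<close>

text \<open>
  The multilinear form with coefficients \<open>c\<close> is an expectation over multi-indices with signed weights,
  so that the lemmas on \<open>pexp\<close> apply to it.
\<close>

definition chaos :: "'i set \<Rightarrow> ('k::finite \<Rightarrow> 'w \<Rightarrow> real) \<Rightarrow> (('i \<Rightarrow> 'k) \<Rightarrow> real) \<Rightarrow> ('i \<Rightarrow> 'w) \<Rightarrow> real" where
  "chaos N X c z = pexp N (\<lambda>i k. X k (z i)) c"

definition sqnorm :: "'i set \<Rightarrow> (('i \<Rightarrow> 'k::finite) \<Rightarrow> real) \<Rightarrow> real" where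
  "sqnorm N c = pexp N (\<lambda>_ _. 1) (\<lambda>\<sigma>. (c \<sigma>)\<^sup>2)"

lemma chaos_insert_upd:
  assumes "finite N" "j \<notin> N"
  shows "chaos (insert j N) X c (z(j := w)) = (\<Sum>k\<in>UNIV. X k w * chaos N X (\<lambda>\<sigma>. c (\<sigma>(j := k))) z)"
  unfolding chaos_def pexp_insert[OF assms]
  using assms by (intro sum.cong refl arg_cong2[where f = "(*)"] pexp_cong) auto

lemma sqnorm_insert:
  assumes "finite N" "j \<notin> N"
  shows "sqnorm (insert j N) c = (\<Sum>k\<in>UNIV. sqnorm N (\<lambda>\<sigma>. c (\<sigma>(j := k))))"
  unfolding sqnorm_def pexp_insert[OF assms] by simp

lemma sqnorm_nonneg [simp]: "finite N \<Longrightarrow> 0 \<le> sqnorm N c"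
  unfolding sqnorm_def by (intro pexp_nonneg) auto

lemma chaos_eq_sum: "chaos N X c z = (\<Sum>\<sigma>\<in>N \<rightarrow>\<^sub>E UNIV. c \<sigma> * (\<Prod>i\<in>N. X (\<sigma> i) (z i)))"
  by (simp add: chaos_def pexp_def mult.commute)

lemma prod_eq_on_PiE:
  assumes "finite N" "\<sigma> \<in> N \<rightarrow>\<^sub>E UNIV" "\<tau> \<in> N \<rightarrow>\<^sub>E UNIV"
  shows "(\<Prod>i\<in>N. if \<sigma> i = \<tau> i then f (\<sigma> i) else (0::real)) = (if \<sigma> = \<tau> then \<Prod>i\<in>N. f (\<sigma> i) else 0)"
proof (cases "\<sigma> = \<tau>")
  case False
  then obtain i where "i \<in> N" "\<sigma> i \<noteq> \<tau> i" using assms(2,3) by (metis PiE_ext)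
  then show ?thesis using assms(1) False by (auto simp: prod_zero_iff)
qed simp

text \<open>Expanding both forms leaves a product over the coordinates for each pair of
  multi-indices, and only mixed second moments enter. Hence two couplings with the same moments
  \<open>lam\<close> give the same value: for the bilinear form the exchange of coordinates is free
  of error.\<close>

lemma pexp2_chaos:
  assumes fin: "finite N"
    and m: "\<And>i k l. i \<in> N \<Longrightarrow> (\<Sum>u\<in>UNIV. \<Sum>v\<in>UNIV. \<pi> i u v * (X k u * X l v)) = (if k = l then lam k else 0)"
  shows "pexp2 N \<pi> (\<lambda>x y. chaos N X c x * chaos N X d y) = pexp N (\<lambda>_. lam) (\<lambda>\<sigma>. c \<sigma> * d \<sigma>)"
proof -
  have "pexp2 N \<pi> (\<lambda>x y. chaos N X c x * chaos N X d y)
      = pexp2 N \<pi> (\<lambda>x y. \<Sum>\<sigma>\<in>N \<rightarrow>\<^sub>E UNIV. \<Sum>\<tau>\<in>N \<rightarrow>\<^sub>E UNIV. (c \<sigma> * d \<tau>) * (\<Prod>i\<in>N. X (\<sigma> i) (x i) * X (\<tau> i) (y i)))"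
    by (simp add: chaos_eq_sum sum_product prod.distrib mult_ac)
  also have "\<dots> = (\<Sum>\<sigma>\<in>N \<rightarrow>\<^sub>E UNIV. \<Sum>\<tau>\<in>N \<rightarrow>\<^sub>E UNIV. (c \<sigma> * d \<tau>) * (\<Prod>i\<in>N. if \<sigma> i = \<tau> i then lam (\<sigma> i) else 0))"
    unfolding pexp2_sum pexp2_cmult
    using pexp2_prod[OF fin, of \<pi> "\<lambda>i u v. X (\<sigma> i) u * X (\<tau> i) v" for \<sigma> \<tau>]
    by (simp add: m cong: prod.cong)
  also have "\<dots> = (\<Sum>\<sigma>\<in>N \<rightarrow>\<^sub>E UNIV. \<Sum>\<tau>\<in>N \<rightarrow>\<^sub>E UNIV. if \<sigma> = \<tau> then (c \<sigma> * d \<sigma>) * (\<Prod>i\<in>N. lam (\<sigma> i)) else 0)"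
    by (intro sum.cong refl) (auto simp: prod_eq_on_PiE[OF fin])
  also have "\<dots> = (\<Sum>\<sigma>\<in>N \<rightarrow>\<^sub>E UNIV. (c \<sigma> * d \<sigma>) * (\<Prod>i\<in>N. lam (\<sigma> i)))"
    using fin by (intro sum.cong refl) (simp add: finite_PiE)
  finally show ?thesis by (simp add: pexp_def mult.commute)
qed

lemma sum_diag:
  fixes p :: "'w::finite \<Rightarrow> real"
  shows "(\<Sum>u\<in>UNIV. \<Sum>v\<in>UNIV. (p u * (if u = v then 1 else 0)) * f u v) = (\<Sum>u\<in>UNIV. p u * f u u)"
proof -
  have "(\<Sum>v\<in>UNIV. (p u * (if u = v then 1 else 0)) * f u v) = p u * f u u" for u
  proof -
    have "(p u * (if u = v then 1 else 0)) * f u v = (if u = v then p u * f u u else 0)" for v by simp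
    then show ?thesis by simp
  qed
  then show ?thesis by simp
qed

lemma pexp_as_pexp2:
  assumes "finite N"
  shows "pexp2 N (\<lambda>i u v. p i u * (if u = v then 1 else 0)) h = pexp N p (\<lambda>x. h x x)"
  using assms
proof (induction N arbitrary: h)
  case (insert j N)
  then show ?case by (simp add: pexp2_insert pexp_insert sum_diag)
qed simp

text \<open>The law is not part of the locale: the same functions \<open>X\<close> are orthonormal
  under several laws, and the Lindeberg exchange passes from one to another.\<close>

locale ensemble =
  fixes X :: "'k::finite \<Rightarrow> 'w::finite \<Rightarrow> real" and e0 :: 'k and Bd :: real
  assumes X_e0 [simp]: "X e0 w = 1"
    and X_bound: "(\<Sum>k\<in>UNIV. (X k w)\<^sup>2) \<le> Bd"
begin

definition orthonormal :: "('w \<Rightarrow> real) \<Rightarrow> bool" where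
  "orthonormal p \<longleftrightarrow> (\<forall>w. 0 \<le> p w) \<and>
     (\<forall>k l. (\<Sum>w\<in>UNIV. p w * (X k w * X l w)) = (if k = l then 1 else 0))"

lemma orthonormal_nonneg: "orthonormal p \<Longrightarrow> 0 \<le> p w"
  by (simp add: orthonormal_def)

lemma orthonormal_mean: "orthonormal p \<Longrightarrow> (\<Sum>w\<in>UNIV. p w * X k w) = (if k = e0 then 1 else 0)"
  unfolding orthonormal_def using X_e0 by (metis (no_types, lifting) mult.right_neutral sum.cong)

lemma orthonormal_sum: "orthonormal p \<Longrightarrow> (\<Sum>w\<in>UNIV. p w) = 1"
  using orthonormal_mean[of p e0] by simp

lemma Bd_ge_1: "1 \<le> Bd"
proof -
  have "(X e0 w)\<^sup>2 \<le> (\<Sum>k\<in>UNIV. (X k w)\<^sup>2)" for w by (intro member_le_sum) auto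
  then show ?thesis using X_bound by (metis X_e0 one_power2 order_trans)
qed

lemma pexp_chaos:
  assumes "finite N" "\<And>i. i \<in> N \<Longrightarrow> orthonormal (p i)"
  shows "pexp N p (\<lambda>z. chaos N X c z * chaos N X d z) = pexp N (\<lambda>_ _. 1) (\<lambda>\<sigma>. c \<sigma> * d \<sigma>)"
  using pexp2_chaos[OF assms(1), of "\<lambda>i u v. p i u * (if u = v then 1 else 0)" X "\<lambda>_. 1" c d] assms
  by (simp add: pexp_as_pexp2 sum_diag orthonormal_def)

lemma pexp_chaos_sq:
  assumes "finite N" "\<And>i. i \<in> N \<Longrightarrow> orthonormal (p i)"
  shows "pexp N p (\<lambda>z. (chaos N X c z)\<^sup>2) = sqnorm N c"
  using pexp_chaos[where N = N and p = p and c = c and d = c] assms by (simp add: sqnorm_def power2_eq_square)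

section \<open>Hypercontractivity in bounded degree\<close>

definition lin :: "('k \<Rightarrow> real) \<Rightarrow> 'w \<Rightarrow> real" where
  "lin q w = (\<Sum>k\<in>UNIV - {e0}. X k w * q k)"

definition var :: "('k \<Rightarrow> real) \<Rightarrow> real" where
  "var q = (\<Sum>k\<in>UNIV - {e0}. (q k)\<^sup>2)"

lemma var_nonneg [simp]: "0 \<le> var q" by (simp add: var_def sum_nonneg)

lemma sum_split_e0: "(\<Sum>k\<in>UNIV. f k) = f e0 + (\<Sum>k\<in>UNIV - {e0}. f k)" for f :: "'k \<Rightarrow> real"
  by (simp add: sum.remove)

lemma sum_X: "(\<Sum>k\<in>UNIV. X k w * q k) = q e0 + lin q w"
  by (simp add: sum_split_e0 lin_def)

lemma lin_sq_le: "(lin q w)\<^sup>2 \<le> Bd * var q"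
proof -
  have "(lin q w)\<^sup>2 \<le> (\<Sum>k\<in>UNIV - {e0}. (X k w)\<^sup>2) * var q"
    unfolding lin_def var_def by (rule Cauchy_Schwarz_ineq_sum)
  also have "(\<Sum>k\<in>UNIV - {e0}. (X k w)\<^sup>2) \<le> Bd"
    using X_bound[of w] by (simp add: sum_split_e0)
  finally show ?thesis by (simp add: mult_right_mono)
qed

lemma lin_mean:
  assumes "orthonormal p" shows "(\<Sum>w\<in>UNIV. p w * lin q w) = 0"
proof -
  have "(\<Sum>w\<in>UNIV. p w * lin q w) = (\<Sum>k\<in>UNIV - {e0}. (\<Sum>w\<in>UNIV. p w * X k w) * q k)"
    unfolding lin_def sum_distrib_left sum_distrib_right by (subst sum.swap) (simp add: mult.assoc)
  then show ?thesis using orthonormal_mean[OF assms] by simp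
qed

lemma lin_var:
  assumes "orthonormal p" shows "(\<Sum>w\<in>UNIV. p w * (lin q w)\<^sup>2) = var q"
proof -
  have "p w * (lin q w)\<^sup>2 = (\<Sum>k\<in>UNIV - {e0}. \<Sum>l\<in>UNIV - {e0}. (p w * (X k w * X l w)) * (q k * q l))" for w
  proof -
    have "(lin q w)\<^sup>2 = (\<Sum>k\<in>UNIV - {e0}. \<Sum>l\<in>UNIV - {e0}. (X k w * X l w) * (q k * q l))"
      unfolding lin_def power2_eq_square sum_product by (intro sum.cong refl) (simp only: mult_ac)
    then show ?thesis by (simp only: sum_distrib_left mult.assoc)
  qed
  then have "(\<Sum>w\<in>UNIV. p w * (lin q w)\<^sup>2)
      = (\<Sum>k\<in>UNIV - {e0}. \<Sum>l\<in>UNIV - {e0}. (\<Sum>w\<in>UNIV. p w * (X k w * X l w)) * (q k * q l))"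
    by (simp only: sum_distrib_right) (subst sum.swap, intro sum.cong refl, rule sum.swap)
  also have "\<dots> = (\<Sum>k\<in>UNIV - {e0}. \<Sum>l\<in>UNIV - {e0}. if k = l then (q k)\<^sup>2 else 0)"
    using assms unfolding orthonormal_def by (intro sum.cong refl) (auto simp: power2_eq_square)
  also have "\<dots> = var q" by (simp add: var_def)
  finally show ?thesis .
qed

text \<open>In the expansion of (x + y)^4 the term 4 x y^3 is absorbed by 2 x^2 y^2 + 2 y^4, and the
  term linear in y averages to 0. The conditions on \<open>b\<close> reduce the remaining
  coefficients to those of the square on the right.\<close>

lemma hypercontractive_one:
  assumes "orthonormal p" "0 \<le> b" "4 * b\<^sup>2 \<le> 1" "3 * b ^ 4 * Bd \<le> 1"
  shows "(\<Sum>w\<in>UNIV. p w * (\<Sum>k\<in>UNIV. (if k = e0 then 1 else b * X k w) * q k) ^ 4) \<le> (\<Sum>k\<in>UNIV. (q k)\<^sup>2)\<^sup>2"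
proof -
  let ?q = "q e0"
  have e: "(\<Sum>k\<in>UNIV. (if k = e0 then 1 else b * X k w) * q k) = ?q + b * lin q w" for w
    by (simp add: sum_split_e0 lin_def sum_distrib_left mult.assoc)
  have pt: "(x + y) ^ 4 \<le> x ^ 4 + 4 * x ^ 3 * y + 8 * x\<^sup>2 * y\<^sup>2 + 3 * y ^ 4" for x y :: real
  proof -
    have "0 \<le> 2 * (y * (x - y))\<^sup>2" by simp
    then show ?thesis by (simp add: power2_eq_square power4_eq_xxxx power3_eq_cube algebra_simps)
  qed
  have "(?q + b * lin q w) ^ 4 \<le> ?q ^ 4 + (4 * ?q ^ 3 * b) * lin q w + (8 * ?q\<^sup>2 * b\<^sup>2 + 3 * b ^ 4 * Bd * var q) * (lin q w)\<^sup>2" for w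
  proof -
    have "3 * b ^ 4 * (lin q w)\<^sup>2 * (lin q w)\<^sup>2 \<le> 3 * b ^ 4 * (Bd * var q) * (lin q w)\<^sup>2"
      by (intro mult_right_mono mult_left_mono lin_sq_le) auto
    moreover have "(b * lin q w) ^ 4 = b ^ 4 * (lin q w)\<^sup>2 * (lin q w)\<^sup>2"
      by (simp add: power_mult_distrib power4_eq_xxxx power2_eq_square)
    ultimately show ?thesis using pt[of ?q "b * lin q w"]
      by (simp add: algebra_simps power_mult_distrib)
  qed
  then have "(\<Sum>w\<in>UNIV. p w * (?q + b * lin q w) ^ 4)
    \<le> (\<Sum>w\<in>UNIV. p w * (?q ^ 4 + (4 * ?q ^ 3 * b) * lin q w + (8 * ?q\<^sup>2 * b\<^sup>2 + 3 * b ^ 4 * Bd * var q) * (lin q w)\<^sup>2))"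
    using orthonormal_nonneg[OF assms(1)] by (intro sum_mono mult_left_mono) auto
  also have "\<dots> = ?q ^ 4 * (\<Sum>w\<in>UNIV. p w) + (4 * ?q ^ 3 * b) * (\<Sum>w\<in>UNIV. p w * lin q w)
      + (8 * ?q\<^sup>2 * b\<^sup>2 + 3 * b ^ 4 * Bd * var q) * (\<Sum>w\<in>UNIV. p w * (lin q w)\<^sup>2)"
    by (simp add: distrib_left sum.distrib sum_distrib_left sum_distrib_right mult_ac)
  also have "\<dots> = ?q ^ 4 + (2 * ?q\<^sup>2 * (4 * b\<^sup>2) + (3 * b ^ 4 * Bd) * var q) * var q"
    by (simp add: orthonormal_sum[OF assms(1)] lin_mean[OF assms(1)] lin_var[OF assms(1)] mult_ac)
  also have "\<dots> \<le> ?q ^ 4 + (2 * ?q\<^sup>2 * 1 + 1 * var q) * var q"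
    using assms by (intro add_mono mult_right_mono mult_left_mono order_refl) auto
  also have "\<dots> = (?q\<^sup>2 + var q)\<^sup>2"
    by (simp add: power2_eq_square power4_eq_xxxx algebra_simps)
  also have "?q\<^sup>2 + var q = (\<Sum>k\<in>UNIV. (q k)\<^sup>2)" by (simp add: sum_split_e0 var_def)
  finally show ?thesis by (simp only: e)
qed

text \<open>Minkowski's inequality in L2, applied to the squares of the \<open>C k\<close>: the
  cross terms are bounded by Cauchy-Schwarz.\<close>

lemma pexp_sum_sq_sq:
  assumes "finite N" "\<And>i w. i \<in> N \<Longrightarrow> 0 \<le> p i w" "finite T"
    and "\<And>k. k \<in> T \<Longrightarrow> pexp N p (\<lambda>z. (C k z) ^ 4) \<le> (s k)\<^sup>2" "\<And>k. k \<in> T \<Longrightarrow> 0 \<le> s k"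
  shows "pexp N p (\<lambda>z. (\<Sum>k\<in>T. (C k z)\<^sup>2)\<^sup>2) \<le> (\<Sum>k\<in>T. s k)\<^sup>2"
proof -
  have "pexp N p (\<lambda>z. (\<Sum>k\<in>T. (C k z)\<^sup>2)\<^sup>2) = (\<Sum>k\<in>T. \<Sum>l\<in>T. pexp N p (\<lambda>z. (C k z)\<^sup>2 * (C l z)\<^sup>2))"
    by (simp add: power2_eq_square[of "sum _ _"] sum_product pexp_sum)
  also have "\<dots> \<le> (\<Sum>k\<in>T. \<Sum>l\<in>T. s k * s l)"
    using assms by (intro sum_mono pexp_mult_le) (auto simp flip: power_mult)
  finally show ?thesis by (simp add: power2_eq_square sum_product)
qed

lemma hypercontractive:
  assumes "finite N" "\<And>i. i \<in> N \<Longrightarrow> orthonormal (p i)" "0 \<le> b" "4 * b\<^sup>2 \<le> 1" "3 * b ^ 4 * Bd \<le> 1"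
  shows "pexp N p (\<lambda>z. chaos N (\<lambda>k w. if k = e0 then 1 else b * X k w) c z ^ 4) \<le> (sqnorm N c)\<^sup>2"
  using assms(1,2)
proof (induction N arbitrary: c)
  case empty
  then show ?case by (simp add: chaos_def sqnorm_def flip: power_mult)
next
  case (insert j N)
  let ?Y = "\<lambda>k w. if k = e0 then 1 else b * X k w"
  let ?C = "\<lambda>k. chaos N ?Y (\<lambda>\<sigma>. c (\<sigma>(j := k)))"
  have on: "\<And>i. i \<in> N \<Longrightarrow> orthonormal (p i)" "orthonormal (p j)" using insert.prems by auto
  have nn: "\<And>i w. i \<in> N \<Longrightarrow> 0 \<le> p i w" using on(1) orthonormal_nonneg by blast
  have "pexp (insert j N) p (\<lambda>z. chaos (insert j N) ?Y c z ^ 4)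
      = pexp N p (\<lambda>z. \<Sum>w\<in>UNIV. p j w * (\<Sum>k\<in>UNIV. ?Y k w * ?C k z) ^ 4)"
    unfolding pexp_insert[OF insert.hyps] chaos_insert_upd[OF insert.hyps] pexp_sum pexp_cmult ..
  also have "\<dots> \<le> pexp N p (\<lambda>z. (\<Sum>k\<in>UNIV. (?C k z)\<^sup>2)\<^sup>2)"
    by (intro pexp_mono insert.hyps nn hypercontractive_one on assms)
  also have "\<dots> \<le> (\<Sum>k\<in>UNIV. sqnorm N (\<lambda>\<sigma>. c (\<sigma>(j := k))))\<^sup>2"
    by (intro pexp_sum_sq_sq insert.hyps nn insert.IH on sqnorm_nonneg) auto
  finally show ?case by (simp only: sqnorm_insert[OF insert.hyps])
qed

definition degree :: "'i set \<Rightarrow> ('i \<Rightarrow> 'k) \<Rightarrow> nat" where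
  "degree N \<sigma> = card {i \<in> N. \<sigma> i \<noteq> e0}"

lemma prod_degree:
  assumes "finite N"
  shows "(\<Prod>i\<in>N. if \<sigma> i = e0 then 1 else \<theta>) = (\<theta>::real) ^ degree N \<sigma>"
proof -
  have "{i \<in> N. \<sigma> i \<noteq> e0} = N \<inter> - {i. \<sigma> i = e0}" by auto
  then show ?thesis using assms by (simp add: prod.If_cases degree_def)
qed

text \<open>Each coefficient is divided by b^degree, which compensates for the scaled functions b *
  X; this enlarges the squared norm by at most the factor b^(-2 D).\<close>

lemma hypercontractive_degree:
  assumes fin: "finite N" and on: "\<And>i. i \<in> N \<Longrightarrow> orthonormal (p i)"
    and b: "0 < b" "4 * b\<^sup>2 \<le> 1" "3 * b ^ 4 * Bd \<le> 1"
    and D: "\<And>\<sigma>. \<sigma> \<in> N \<rightarrow>\<^sub>E UNIV \<Longrightarrow> c \<sigma> \<noteq> 0 \<Longrightarrow> degree N \<sigma> \<le> D"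
  shows "pexp N p (\<lambda>z. chaos N X c z ^ 4) \<le> ((1 / b) ^ (2 * D) * sqnorm N c)\<^sup>2"
proof -
  let ?Y = "\<lambda>k w. if k = e0 then 1 else b * X k w"
  define d where "d \<sigma> = c \<sigma> / b ^ degree N \<sigma>" for \<sigma>
  have b1: "b \<le> 1" using b power2_le_imp_le[of b 1] by simp
  have "chaos N X c z = chaos N ?Y d z" for z
    unfolding chaos_eq_sum
  proof (intro sum.cong refl)
    fix \<sigma>
    have "(\<Prod>i\<in>N. ?Y (\<sigma> i) (z i)) = (\<Prod>i\<in>N. (if \<sigma> i = e0 then 1 else b) * X (\<sigma> i) (z i))"
      by (intro prod.cong) auto
    also have "\<dots> = b ^ degree N \<sigma> * (\<Prod>i\<in>N. X (\<sigma> i) (z i))"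
      by (simp only: prod.distrib prod_degree[OF fin])
    finally show "c \<sigma> * (\<Prod>i\<in>N. X (\<sigma> i) (z i)) = d \<sigma> * (\<Prod>i\<in>N. ?Y (\<sigma> i) (z i))"
      using b by (simp add: d_def)
  qed
  then have "pexp N p (\<lambda>z. chaos N X c z ^ 4) \<le> (sqnorm N d)\<^sup>2"
    using hypercontractive[where N = N and p = p and b = b and c = d] fin on b by simp
  moreover have "sqnorm N d \<le> (1 / b) ^ (2 * D) * sqnorm N c"
    unfolding sqnorm_def pexp_cmult[symmetric]
  proof (intro pexp_mono fin)
    fix \<sigma> :: "'a \<Rightarrow> 'k" assume \<sigma>: "\<sigma> \<in> N \<rightarrow>\<^sub>E UNIV"
    show "(d \<sigma>)\<^sup>2 \<le> (1 / b) ^ (2 * D) * (c \<sigma>)\<^sup>2"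
    proof (cases "c \<sigma> = 0")
      case False
      have "(d \<sigma>)\<^sup>2 = (1 / b) ^ (2 * degree N \<sigma>) * (c \<sigma>)\<^sup>2"
        by (simp add: d_def power_divide mult.commute flip: power_mult)
      also have "\<dots> \<le> (1 / b) ^ (2 * D) * (c \<sigma>)\<^sup>2"
        using D[OF \<sigma> False] b b1 by (intro mult_right_mono power_increasing) auto
      finally show ?thesis .
    qed (simp add: d_def)
  qed simp
  ultimately show ?thesis using sqnorm_nonneg[OF fin, of d] by (meson order_trans power_mono)
qed

text \<open>Under an orthonormal law this is the usual influence, the mean conditional variance in
  coordinate \<open>j\<close>. Written through coefficients it is the same for all such
  laws.\<close>

definition influence :: "'i set \<Rightarrow> (('i \<Rightarrow> 'k) \<Rightarrow> real) \<Rightarrow> 'i \<Rightarrow> real" where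
  "influence N c j = pexp N (\<lambda>_ _. 1) (\<lambda>\<sigma>. (if \<sigma> j = e0 then 0 else 1) * (c \<sigma>)\<^sup>2)"

lemma influence_nonneg: "finite N \<Longrightarrow> 0 \<le> influence N c j"
  unfolding influence_def by (intro pexp_nonneg) auto

lemma influence_insert:
  assumes "finite N" "j \<notin> N"
  shows "influence (insert j N) c j = (\<Sum>k\<in>UNIV - {e0}. sqnorm N (\<lambda>\<sigma>. c (\<sigma>(j := k))))"
  unfolding influence_def pexp_insert[OF assms] sum_split_e0 sqnorm_def
  by (simp add: pexp_cmult[where c = 0, simplified])

text \<open>Summed over the coordinates, a squared coefficient is counted as often as its
  degree.\<close>

lemma sum_influence_le:
  assumes fin: "finite N" and D: "\<And>\<sigma>. \<sigma> \<in> N \<rightarrow>\<^sub>E UNIV \<Longrightarrow> c \<sigma> \<noteq> 0 \<Longrightarrow> degree N \<sigma> \<le> D"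
  shows "(\<Sum>j\<in>N. influence N c j) \<le> real D * sqnorm N c"
proof -
  have "(\<Sum>j\<in>N. influence N c j) = pexp N (\<lambda>_ _. 1) (\<lambda>\<sigma>. \<Sum>j\<in>N. (if \<sigma> j = e0 then 0 else 1) * (c \<sigma>)\<^sup>2)"
    by (simp add: influence_def pexp_sum)
  also have "\<dots> \<le> pexp N (\<lambda>_ _. 1) (\<lambda>\<sigma>. real D * (c \<sigma>)\<^sup>2)"
  proof (intro pexp_mono fin)
    fix \<sigma> :: "'a \<Rightarrow> 'k" assume \<sigma>: "\<sigma> \<in> N \<rightarrow>\<^sub>E UNIV"
    have "(\<Sum>j\<in>N. (if \<sigma> j = e0 then 0 else 1::real)) = real (degree N \<sigma>)"
    proof -
      have "{i \<in> N. \<sigma> i \<noteq> e0} = N \<inter> - {i. \<sigma> i = e0}" by auto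
      then show ?thesis using fin by (simp add: sum.If_cases degree_def)
    qed
    then have "(\<Sum>j\<in>N. (if \<sigma> j = e0 then 0 else 1) * (c \<sigma>)\<^sup>2) = real (degree N \<sigma>) * (c \<sigma>)\<^sup>2"
      by (simp only: flip: sum_distrib_right)
    also have "\<dots> \<le> real D * (c \<sigma>)\<^sup>2" using D[OF \<sigma>] by (cases "c \<sigma> = 0") (auto intro: mult_right_mono)
    finally show "(\<Sum>j\<in>N. (if \<sigma> j = e0 then 0 else 1) * (c \<sigma>)\<^sup>2) \<le> real D * (c \<sigma>)\<^sup>2" .
  qed simp
  finally show ?thesis by (simp add: pexp_cmult sqnorm_def)
qed

section \<open>Lindeberg replacement, one coordinate at a time\<close>

lemma cube_le: "0 < s \<Longrightarrow> \<bar>y\<bar> ^ 3 \<le> (s * y\<^sup>2 + y ^ 4 / s) / 2" for s y :: real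
proof -
  assume s: "0 < s"
  have "0 \<le> y\<^sup>2 * (s - \<bar>y\<bar>)\<^sup>2 / s" using s by simp
  also have "\<dots> = y\<^sup>2 * (s\<^sup>2 + y\<^sup>2 - 2 * s * \<bar>y\<bar>) / s" by (simp add: power2_diff)
  also have "\<dots> = s * y\<^sup>2 + y ^ 4 / s - 2 * \<bar>y\<bar> ^ 3"
    using s by (simp add: field_simps power2_eq_square power4_eq_xxxx power3_eq_cube abs_mult_self_eq)
  finally show ?thesis by simp
qed

text \<open>To second order the average depends on \<open>p\<close> only through mean and variance,
  which orthonormality fixes; two laws are compared by comparing each with the same expression.
  \<open>\<Psi>''\<close> is the Taylor coefficient, half of the second derivative. The third
  absolute moment is interpolated between the second and the fourth, and \<open>s\<close> balances
  the two.\<close>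

lemma taylor_one:
  assumes p: "orthonormal p" and s: "0 < s" and M: "0 \<le> M"
    and T: "\<And>t y. \<bar>\<Psi> (t + y) - \<Psi> t - \<Psi>' t * y - \<Psi>'' t * y\<^sup>2\<bar> \<le> M * \<bar>y\<bar> ^ 3"
  shows "\<bar>(\<Sum>w\<in>UNIV. p w * \<Psi> (\<Sum>k\<in>UNIV. X k w * q k)) - (\<Psi> (q e0) + \<Psi>'' (q e0) * var q)\<bar>
    \<le> M * (s * var q + Bd * (var q)\<^sup>2 / s) / 2"
proof -
  let ?t = "q e0"
  note nn = orthonormal_nonneg[OF p]
  have "(\<Sum>w\<in>UNIV. p w * \<Psi> (?t + lin q w)) - (\<Psi> ?t + \<Psi>'' ?t * var q)
     = (\<Sum>w\<in>UNIV. p w * \<Psi> (?t + lin q w)) - \<Psi> ?t * (\<Sum>w\<in>UNIV. p w) - \<Psi>' ?t * (\<Sum>w\<in>UNIV. p w * lin q w)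
       - \<Psi>'' ?t * (\<Sum>w\<in>UNIV. p w * (lin q w)\<^sup>2)"
    by (simp add: orthonormal_sum[OF p] lin_mean[OF p] lin_var[OF p])
  also have "\<dots> = (\<Sum>w\<in>UNIV. p w * (\<Psi> (?t + lin q w) - \<Psi> ?t - \<Psi>' ?t * lin q w - \<Psi>'' ?t * (lin q w)\<^sup>2))"
    by (simp add: right_diff_distrib sum_subtractf sum_distrib_left sum_distrib_right mult_ac)
  finally have "\<bar>(\<Sum>w\<in>UNIV. p w * \<Psi> (?t + lin q w)) - (\<Psi> ?t + \<Psi>'' ?t * var q)\<bar>
     \<le> (\<Sum>w\<in>UNIV. p w * \<bar>\<Psi> (?t + lin q w) - \<Psi> ?t - \<Psi>' ?t * lin q w - \<Psi>'' ?t * (lin q w)\<^sup>2\<bar>)"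
    using nn by (simp only:) (rule order_trans[OF sum_abs], simp add: abs_mult)
  also have "\<dots> \<le> (\<Sum>w\<in>UNIV. p w * (M * ((s * (lin q w)\<^sup>2 + Bd * var q * (lin q w)\<^sup>2 / s) / 2)))"
  proof (intro sum_mono mult_left_mono nn order_trans[OF T] M)
    fix w
    have "(lin q w) ^ 4 \<le> Bd * var q * (lin q w)\<^sup>2"
      using mult_right_mono[OF lin_sq_le, of "(lin q w)\<^sup>2" q w]
      by (simp add: power4_eq_xxxx power2_eq_square mult.assoc)
    then show "\<bar>lin q w\<bar> ^ 3 \<le> (s * (lin q w)\<^sup>2 + Bd * var q * (lin q w)\<^sup>2 / s) / 2"
      using s by (intro order_trans[OF cube_le[OF s]] divide_right_mono add_left_mono) auto
  qed
  also have "\<dots> = M * (s + Bd * var q / s) / 2 * (\<Sum>w\<in>UNIV. p w * (lin q w)\<^sup>2)"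
    by (simp add: sum_distrib_left) (intro sum.cong refl, simp add: field_simps)
  also have "\<dots> = M * (s * var q + Bd * (var q)\<^sup>2 / s) / 2"
    unfolding lin_var[OF p] by (simp add: power2_eq_square algebra_simps)
  finally show ?thesis by (simp only: sum_X)
qed

text \<open>The law of coordinate \<open>j\<close> is replaced with the others fixed. Averaging over
  them turns the variance into the influence of \<open>j\<close> and, by hypercontractivity, bounds
  the mean of its square by the squared influence times b^(-4 D).\<close>

lemma replace_one:
  assumes fin: "finite N" and j: "j \<notin> N"
    and on: "\<And>i. i \<in> insert j N \<Longrightarrow> orthonormal (p i)" "orthonormal q"
    and b: "0 < b" "4 * b\<^sup>2 \<le> 1" "3 * b ^ 4 * Bd \<le> 1"
    and D: "\<And>\<sigma>. \<sigma> \<in> insert j N \<rightarrow>\<^sub>E UNIV \<Longrightarrow> c \<sigma> \<noteq> 0 \<Longrightarrow> degree (insert j N) \<sigma> \<le> D"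
    and s: "0 < s" and M: "0 \<le> M"
    and T: "\<And>t y. \<bar>\<Psi> (t + y) - \<Psi> t - \<Psi>' t * y - \<Psi>'' t * y\<^sup>2\<bar> \<le> M * \<bar>y\<bar> ^ 3"
  shows "\<bar>pexp (insert j N) p (\<lambda>z. \<Psi> (chaos (insert j N) X c z)) - pexp (insert j N) (p(j := q)) (\<lambda>z. \<Psi> (chaos (insert j N) X c z))\<bar>
    \<le> M * (s * influence (insert j N) c j + Bd * ((1 / b) ^ (2 * D) * influence (insert j N) c j)\<^sup>2 / s)"
proof -
  define C where "C z k = chaos N X (\<lambda>\<sigma>. c (\<sigma>(j := k))) z" for z k
  let ?I = "influence (insert j N) c j"
  note nn = orthonormal_nonneg[OF on(1)]
  have main: "pexp (insert j N) p' (\<lambda>z. \<Psi> (chaos (insert j N) X c z)) = pexp N p (\<lambda>z. \<Sum>w\<in>UNIV. p' j w * \<Psi> (\<Sum>k\<in>UNIV. X k w * C z k))"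
    if "\<And>i. i \<in> N \<Longrightarrow> p' i = p i" for p'
  proof -
    have "pexp N p' f = pexp N p f" for f using fin that by (intro pexp_cong) auto
    then show ?thesis
      unfolding pexp_insert[OF fin j] chaos_insert_upd[OF fin j] pexp_sum pexp_cmult C_def by simp
  qed
  have degk: "degree N \<sigma> \<le> D" if "\<sigma> \<in> N \<rightarrow>\<^sub>E UNIV" "c (\<sigma>(j := k)) \<noteq> 0" for \<sigma> k
  proof -
    have "\<sigma>(j := k) \<in> insert j N \<rightarrow>\<^sub>E UNIV" using that(1) by (simp add: PiE_iff extensional_def)
    from D[OF this that(2)] have "degree (insert j N) (\<sigma>(j := k)) \<le> D" .
    moreover have "degree N \<sigma> \<le> degree (insert j N) (\<sigma>(j := k))"
      unfolding degree_def using fin j by (intro card_mono) auto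
    ultimately show ?thesis by linarith
  qed
  have var2: "pexp N p (\<lambda>z. (var (C z))\<^sup>2) \<le> ((1 / b) ^ (2 * D) * ?I)\<^sup>2"
    unfolding var_def influence_insert[OF fin j] sum_distrib_left
  proof (intro pexp_sum_sq_sq fin)
    show "pexp N p (\<lambda>z. C z k ^ 4) \<le> ((1 / b) ^ (2 * D) * sqnorm N (\<lambda>\<sigma>. c (\<sigma>(j := k))))\<^sup>2" for k
      unfolding C_def using on degk by (intro hypercontractive_degree fin b) auto
  qed (use nn b fin in auto)
  have "pexp (insert j N) p (\<lambda>z. \<Psi> (chaos (insert j N) X c z)) - pexp (insert j N) (p(j := q)) (\<lambda>z. \<Psi> (chaos (insert j N) X c z))
     = pexp N p (\<lambda>z. (\<Sum>w\<in>UNIV. p j w * \<Psi> (\<Sum>k\<in>UNIV. X k w * C z k)) - (\<Sum>w\<in>UNIV. q w * \<Psi> (\<Sum>k\<in>UNIV. X k w * C z k)))"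
    using j by (subst (1 2) main) (auto simp: pexp_diff)
  also have "\<bar>\<dots>\<bar> \<le> pexp N p (\<lambda>z. \<bar>(\<Sum>w\<in>UNIV. p j w * \<Psi> (\<Sum>k\<in>UNIV. X k w * C z k)) - (\<Sum>w\<in>UNIV. q w * \<Psi> (\<Sum>k\<in>UNIV. X k w * C z k))\<bar>)"
    using fin nn by (intro pexp_abs_le) auto
  also have "\<dots> \<le> pexp N p (\<lambda>z. (M * s) * var (C z) + (M * Bd / s) * (var (C z))\<^sup>2)"
  proof (intro pexp_mono fin)
    fix z
    have tri: "\<bar>x - x'\<bar> \<le> h + h" if "\<bar>x - y\<bar> \<le> h" "\<bar>x' - y\<bar> \<le> h" for x x' y h :: real
      using that by linarith
    have "M * s * var (C z) + M * Bd / s * (var (C z))\<^sup>2 = M * (s * var (C z) + Bd * (var (C z))\<^sup>2 / s) / 2 + M * (s * var (C z) + Bd * (var (C z))\<^sup>2 / s) / 2"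
      by (simp add: distrib_left)
    then show "\<bar>(\<Sum>w\<in>UNIV. p j w * \<Psi> (\<Sum>k\<in>UNIV. X k w * C z k)) - (\<Sum>w\<in>UNIV. q w * \<Psi> (\<Sum>k\<in>UNIV. X k w * C z k))\<bar>
       \<le> M * s * var (C z) + M * Bd / s * (var (C z))\<^sup>2"
      using tri[OF taylor_one[OF on(1)[OF insertI1] s M T, of "C z"] taylor_one[OF on(2) s M T, of "C z"]] by simp
  qed (use nn in auto)
  also have "\<dots> = (M * s) * pexp N p (\<lambda>z. var (C z)) + (M * Bd / s) * pexp N p (\<lambda>z. (var (C z))\<^sup>2)"
    by (simp only: pexp_add pexp_cmult)
  also have "pexp N p (\<lambda>z. var (C z)) = ?I"
    unfolding var_def pexp_sum C_def influence_insert[OF fin j]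
    using on by (intro sum.cong refl pexp_chaos_sq fin) auto
  also have "M * s * ?I + M * Bd / s * pexp N p (\<lambda>z. (var (C z))\<^sup>2)
      \<le> M * s * ?I + M * Bd / s * ((1 / b) ^ (2 * D) * ?I)\<^sup>2"
    using M s Bd_ge_1 by (intro add_left_mono mult_left_mono var2) auto
  also have "(M * s) * ?I + (M * Bd / s) * ((1 / b) ^ (2 * D) * ?I)\<^sup>2 = M * (s * ?I + Bd * ((1 / b) ^ (2 * D) * ?I)\<^sup>2 / s)"
    by (simp add: distrib_left)
  finally show ?thesis .
qed

text \<open>The exchange is restricted to \<open>T0\<close> because influential coordinates have to
  keep their law; the errors of the single replacements add up along the hybrids.\<close>

lemma invariance:
  assumes fin: "finite N" and "T0 \<subseteq> N"
    and on: "\<And>i. i \<in> N \<Longrightarrow> orthonormal (p i)" "\<And>i. i \<in> N \<Longrightarrow> orthonormal (q i)"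
    and b: "0 < b" "4 * b\<^sup>2 \<le> 1" "3 * b ^ 4 * Bd \<le> 1"
    and D: "\<And>\<sigma>. \<sigma> \<in> N \<rightarrow>\<^sub>E UNIV \<Longrightarrow> c \<sigma> \<noteq> 0 \<Longrightarrow> degree N \<sigma> \<le> D"
    and s: "0 < s" and M: "0 \<le> M"
    and T: "\<And>t y. \<bar>\<Psi> (t + y) - \<Psi> t - \<Psi>' t * y - \<Psi>'' t * y\<^sup>2\<bar> \<le> M * \<bar>y\<bar> ^ 3"
  shows "\<bar>pexp N p (\<lambda>z. \<Psi> (chaos N X c z)) - pexp N (\<lambda>i. if i \<in> T0 then q i else p i) (\<lambda>z. \<Psi> (chaos N X c z))\<bar>
    \<le> (\<Sum>j\<in>T0. M * (s * influence N c j + Bd * ((1 / b) ^ (2 * D) * influence N c j)\<^sup>2 / s))"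
proof -
  have "finite T0" using assms by (metis finite_subset)
  then show ?thesis using \<open>T0 \<subseteq> N\<close>
  proof (induction T0)
    case empty
    then show ?case by simp
  next
    case (insert j T0)
    let ?p = "\<lambda>i. if i \<in> T0 then q i else p i"
    have jN: "j \<in> N" "insert j (N - {j}) = N" using insert.prems by auto
    have "\<bar>pexp (insert j (N - {j})) ?p (\<lambda>z. \<Psi> (chaos (insert j (N - {j})) X c z))
        - pexp (insert j (N - {j})) (?p(j := q j)) (\<lambda>z. \<Psi> (chaos (insert j (N - {j})) X c z))\<bar>
      \<le> M * (s * influence (insert j (N - {j})) c j + Bd * ((1 / b) ^ (2 * D) * influence (insert j (N - {j})) c j)\<^sup>2 / s)"
      using fin on b D s M T jN by (intro replace_one) auto
    moreover have "?p(j := q j) = (\<lambda>i. if i \<in> insert j T0 then q i else p i)" by (auto simp: fun_eq_iff)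
    ultimately show ?case using insert unfolding jN(2) by (simp add: sum.insert)
  qed
qed

text \<open>Averaging over \<open>S\<close> keeps exactly the terms that are constant there. The
  result does not mention \<open>p\<close>, so any two orthonormal laws on \<open>S\<close> give the
  same conditional means.\<close>

lemma pexp_chaos_override:
  assumes fin: "finite J" "finite S" "J \<inter> S = {}" and on: "\<And>i. i \<in> S \<Longrightarrow> orthonormal (p i)"
  shows "pexp S p (\<lambda>y. chaos (J \<union> S) X c (override_on y x J))
     = (\<Sum>\<sigma>\<in>J \<union> S \<rightarrow>\<^sub>E UNIV. c \<sigma> * (\<Prod>i\<in>J. X (\<sigma> i) (x i)) * (\<Prod>i\<in>S. if \<sigma> i = e0 then 1 else 0))"
proof -
  have "(\<Prod>i\<in>J \<union> S. X (\<sigma> i) (override_on y x J i)) = (\<Prod>i\<in>J. X (\<sigma> i) (x i)) * (\<Prod>i\<in>S. X (\<sigma> i) (y i))" for \<sigma> y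
    unfolding prod.union_disjoint[OF fin]
    using fin by (intro arg_cong2[where f = "(*)"] prod.cong) (auto simp: override_on_def)
  then have "pexp S p (\<lambda>y. chaos (J \<union> S) X c (override_on y x J))
     = (\<Sum>\<sigma>\<in>J \<union> S \<rightarrow>\<^sub>E UNIV. pexp S p (\<lambda>y. c \<sigma> * (\<Prod>i\<in>J. X (\<sigma> i) (x i)) * (\<Prod>i\<in>S. X (\<sigma> i) (y i))))"
    by (simp only: chaos_eq_sum pexp_sum mult.assoc)
  also have "\<dots> = (\<Sum>\<sigma>\<in>J \<union> S \<rightarrow>\<^sub>E UNIV. c \<sigma> * (\<Prod>i\<in>J. X (\<sigma> i) (x i)) * (\<Prod>i\<in>S. if \<sigma> i = e0 then 1 else 0))"
    unfolding pexp_cmult using pexp_prod[OF fin(2), of p "\<lambda>i. X (\<sigma> i)" for \<sigma>] orthonormal_mean[OF on]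
    by (intro sum.cong refl) (simp cong: prod.cong)
  finally show ?thesis .
qed

end

section \<open>Smoothing and clipping\<close>

definition cub :: "real \<Rightarrow> real" where "cub t = (max 0 t) ^ 3"

lemma cub_taylor: "\<bar>cub (t + y) - cub t - 3 * (max 0 t)\<^sup>2 * y - 3 * max 0 t * y\<^sup>2\<bar> \<le> \<bar>y\<bar> ^ 3"
proof (cases "0 \<le> t")
  case t: True
  show ?thesis
  proof (cases "0 \<le> t + y")
    case True
    then have "cub (t + y) - cub t - 3 * (max 0 t)\<^sup>2 * y - 3 * max 0 t * y\<^sup>2 = y ^ 3"
      using t by (simp add: cub_def max_def power3_eq_cube power2_eq_square algebra_simps)
    then show ?thesis by (simp add: power_abs)
  next
    case False
    define u where "u = - (t + y)"
    have y: "y = - (t + u)" and u: "0 < u" using False by (auto simp: u_def)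
    have "cub (t + y) - cub t - 3 * (max 0 t)\<^sup>2 * y - 3 * max 0 t * y\<^sup>2 = u ^ 3 - (t + u) ^ 3"
      using t False unfolding y by (simp add: cub_def max_def power3_eq_cube power2_eq_square algebra_simps)
    moreover have "\<bar>y\<bar> ^ 3 = (t + u) ^ 3" using t u by (simp add: y add.commute)
    moreover have "u ^ 3 \<le> (t + u) ^ 3" "0 \<le> u ^ 3" using t u by (auto intro: power_mono)
    ultimately show ?thesis by linarith
  qed
next
  case t: False
  show ?thesis
  proof (cases "0 \<le> t + y")
    case True
    have "(t + y) ^ 3 \<le> \<bar>y\<bar> ^ 3" "0 \<le> (t + y) ^ 3" using t True by (auto intro: power_mono)
    then show ?thesis using t True by (simp add: cub_def max_def)
  qed (use t in \<open>simp add: cub_def max_def\<close>)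
qed

text \<open>
  A \<open>C\<^sup>2\<close> surrogate of the squared distance to \<open>[0, 1]\<close>: cubic within \<open>\<kappa>\<close> of the interval, quadratic
  beyond, with a Lipschitz second derivative.
\<close>

definition smooth_dist :: "real \<Rightarrow> real \<Rightarrow> real" where
  "smooth_dist \<kappa> t = cub (t - 1) - cub (t - 1 - \<kappa>) + cub (- t) - cub (- t - \<kappa>)"

definition clip :: "real \<Rightarrow> real" where "clip t = max 0 (min 1 t)"

lemma clip_bounds [simp]: "0 \<le> clip t" "clip t \<le> 1" by (auto simp: clip_def)

lemma smooth_dist_taylor:
  obtains \<Psi>' \<Psi>'' where "\<And>t y. \<bar>smooth_dist \<kappa> (t + y) - smooth_dist \<kappa> t - \<Psi>' t * y - \<Psi>'' t * y\<^sup>2\<bar> \<le> 4 * \<bar>y\<bar> ^ 3"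
proof -
  let ?m = "max (0::real)"
  define R where "R t y = cub (t + y) - cub t - 3 * (?m t)\<^sup>2 * y - 3 * ?m t * y\<^sup>2" for t y
  define \<Psi>' where "\<Psi>' t = 3 * (?m (t - 1))\<^sup>2 - 3 * (?m (t - 1 - \<kappa>))\<^sup>2 - 3 * (?m (- t))\<^sup>2 + 3 * (?m (- t - \<kappa>))\<^sup>2" for t
  define \<Psi>'' where "\<Psi>'' t = 3 * ?m (t - 1) - 3 * ?m (t - 1 - \<kappa>) + 3 * ?m (- t) - 3 * ?m (- t - \<kappa>)" for t
  have "\<bar>smooth_dist \<kappa> (t + y) - smooth_dist \<kappa> t - \<Psi>' t * y - \<Psi>'' t * y\<^sup>2\<bar> \<le> 4 * \<bar>y\<bar> ^ 3" for t y
  proof -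
    have "t + y - 1 = (t - 1) + y" "t + y - 1 - \<kappa> = (t - 1 - \<kappa>) + y" "- (t + y) = - t + (- y)"
      "- (t + y) - \<kappa> = (- t - \<kappa>) + (- y)" by simp_all
    then have "smooth_dist \<kappa> (t + y) - smooth_dist \<kappa> t - \<Psi>' t * y - \<Psi>'' t * y\<^sup>2
      = R (t - 1) y - R (t - 1 - \<kappa>) y + R (- t) (- y) - R (- t - \<kappa>) (- y)"
      unfolding smooth_dist_def R_def \<Psi>'_def \<Psi>''_def
      by (simp only: left_diff_distrib distrib_right power2_minus)
    moreover have "\<bar>R s y\<bar> \<le> \<bar>y\<bar> ^ 3" "\<bar>R s (- y)\<bar> \<le> \<bar>y\<bar> ^ 3" for s
      using cub_taylor[of s y] cub_taylor[of s "- y"] unfolding R_def by simp_all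
    moreover have "\<bar>a - b + c - d\<bar> \<le> 4 * h" if "\<bar>a\<bar> \<le> h" "\<bar>b\<bar> \<le> h" "\<bar>c\<bar> \<le> h" "\<bar>d\<bar> \<le> h" for a b c d h :: real
      using that by linarith
    ultimately show ?thesis by (simp only:)
  qed
  then show thesis by (rule that)
qed

lemma cub_diff_le:
  assumes "0 < \<kappa>" "0 \<le> s" shows "cub s - cub (s - \<kappa>) \<le> 3 * \<kappa> * s\<^sup>2"
proof (cases "s \<le> \<kappa>")
  case True
  then have "s * s\<^sup>2 \<le> 3 * \<kappa> * s\<^sup>2" using assms by (intro mult_right_mono) auto
  then show ?thesis using True assms by (auto simp: cub_def max_def power3_eq_cube power2_eq_square mult.assoc)
next
  case False
  have "0 \<le> \<kappa> * \<kappa> * (3 * s - \<kappa>)" using False assms by (intro mult_nonneg_nonneg) auto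
  then show ?thesis using False assms
    by (simp add: cub_def max_def power3_eq_cube power2_eq_square algebra_simps)
qed

lemma cub_diff_ge:
  assumes "0 < \<kappa>" "0 \<le> s" shows "s\<^sup>2 \<le> \<kappa>\<^sup>2 + (cub s - cub (s - \<kappa>)) / \<kappa>"
proof (cases "s \<le> \<kappa>")
  case True
  then have "s\<^sup>2 \<le> \<kappa>\<^sup>2" using assms by (intro power_mono) auto
  then show ?thesis using True assms by (simp add: cub_def max_def add_increasing2)
next
  case False
  have "0 \<le> \<kappa> * ((2 * s - \<kappa>) * (s - \<kappa>))" using False assms by (intro mult_nonneg_nonneg) auto
  then have "\<kappa> * s\<^sup>2 \<le> cub s - cub (s - \<kappa>)" using False assms
    by (simp add: cub_def max_def power3_eq_cube power2_eq_square algebra_simps)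
  then have "s\<^sup>2 \<le> (cub s - cub (s - \<kappa>)) / \<kappa>" using assms by (simp add: pos_le_divide_eq mult.commute)
  then show ?thesis by (simp add: add_increasing)
qed

text \<open>The point \<open>y\<close> is arbitrary in [0, 1], not the nearest one: the bound is
  applied to a [0, 1]-valued function that the polynomial approximates in L2.\<close>

lemma smooth_dist_le:
  assumes "0 < \<kappa>" "0 \<le> y" "y \<le> 1"
  shows "smooth_dist \<kappa> t \<le> 3 * \<kappa> * (t - y)\<^sup>2"
proof -
  have z: "cub s = 0" if "s \<le> 0" for s using that by (simp add: cub_def max_def)
  consider "t < 0" | "0 \<le> t" "t \<le> 1" | "1 < t" by linarith
  then show ?thesis
  proof cases
    case 1
    have "smooth_dist \<kappa> t \<le> 3 * \<kappa> * (- t)\<^sup>2"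
      using cub_diff_le[OF assms(1), of "- t"] 1 assms z[of "t - 1"] z[of "t - 1 - \<kappa>"] by (simp add: smooth_dist_def)
    also have "(- t)\<^sup>2 \<le> (y - t)\<^sup>2" using 1 assms by (intro power_mono) auto
    finally show ?thesis using assms by (simp add: power2_commute)
  next
    case 2
    then show ?thesis using assms z[of "t - 1"] z[of "t - 1 - \<kappa>"] z[of "- t"] z[of "- t - \<kappa>"]
      by (simp add: smooth_dist_def)
  next
    case 3
    have "smooth_dist \<kappa> t \<le> 3 * \<kappa> * (t - 1)\<^sup>2"
      using cub_diff_le[OF assms(1), of "t - 1"] 3 assms z[of "- t"] z[of "- t - \<kappa>"] by (simp add: smooth_dist_def)
    also have "(t - 1)\<^sup>2 \<le> (t - y)\<^sup>2" using 3 assms by (intro power_mono) auto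
    finally show ?thesis using assms by simp
  qed
qed

text \<open>The converse comparison. The surrogate is flat close to the interval, and the summand
  \<kappa>^2 pays for that zone.\<close>

lemma clip_error_le:
  assumes "0 < \<kappa>" shows "(t - clip t)\<^sup>2 \<le> \<kappa>\<^sup>2 + smooth_dist \<kappa> t / \<kappa>"
proof -
  have z: "cub s = 0" if "s \<le> 0" for s using that by (simp add: cub_def max_def)
  consider "t < 0" | "0 \<le> t" "t \<le> 1" | "1 < t" by linarith
  then show ?thesis
  proof cases
    case 1
    then show ?thesis using cub_diff_ge[OF assms, of "- t"] assms z[of "t - 1"] z[of "t - 1 - \<kappa>"]
      by (simp add: smooth_dist_def clip_def)
  next
    case 2
    then show ?thesis using assms z[of "t - 1"] z[of "t - 1 - \<kappa>"] z[of "- t"] z[of "- t - \<kappa>"]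
      by (simp add: smooth_dist_def clip_def)
  next
    case 3
    then show ?thesis using cub_diff_ge[OF assms, of "t - 1"] assms z[of "- t"] z[of "- t - \<kappa>"]
      by (simp add: smooth_dist_def clip_def)
  qed
qed

text \<open>L^s is at most each of the s terms of a geometric series with sum at most 1 / (1 - L).
  This bounds, uniformly in the degree s, the loss from noise after weighting by
  eigenvalues.\<close>

lemma mult_power_le_one:
  fixes L :: real
  assumes "0 \<le> L" "L \<le> 1"
  shows "real s * L ^ s * (1 - L) \<le> 1"
proof -
  have "real s * L ^ s * (1 - L) = (1 - L) * (\<Sum>i<s. L ^ s)" by simp
  also have "\<dots> \<le> (1 - L) * (\<Sum>i<s. L ^ i)"
    using assms by (intro mult_left_mono sum_mono power_decreasing) auto
  also have "\<dots> = 1 - L ^ s" by (rule one_diff_power_eq [symmetric])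
  finally show ?thesis using assms by (smt (verit) zero_le_power)
qed

text \<open>Two laws with couplings on one sample space, \<open>V\<close> for the chain and
  \<open>B\<close> for the bits, sharing all mixed second moments. Functions are expanded under
  \<open>V\<close>, where \<open>X\<close> is a basis; reverse hypercontractivity is available under
  \<open>B\<close>.\<close>

locale coupled_ensemble = ensemble X e0 Bd
  for X :: "'k::finite \<Rightarrow> 'w::finite \<Rightarrow> real" and e0 Bd +
  fixes pV pB :: "'w \<Rightarrow> real" and \<pi>V \<pi>B :: "'w \<Rightarrow> 'w \<Rightarrow> real" and lam :: "'k \<Rightarrow> real" and L :: real and r :: nat
  assumes onV: "orthonormal pV" and onB: "orthonormal pB"
    and \<pi>V_nonneg: "0 \<le> \<pi>V u v" and \<pi>B_nonneg: "0 \<le> \<pi>B u v"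
    and \<pi>V_fst: "(\<Sum>v\<in>UNIV. \<pi>V u v) = pV u" and \<pi>V_snd: "(\<Sum>u\<in>UNIV. \<pi>V u v) = pV v"
    and \<pi>B_fst: "(\<Sum>v\<in>UNIV. \<pi>B u v) = pB u" and \<pi>B_snd: "(\<Sum>u\<in>UNIV. \<pi>B u v) = pB v"
    and \<pi>V_mom: "(\<Sum>u\<in>UNIV. \<Sum>v\<in>UNIV. \<pi>V u v * (X k u * X l v)) = (if k = l then lam k else 0)"
    and \<pi>B_mom: "(\<Sum>u\<in>UNIV. \<Sum>v\<in>UNIV. \<pi>B u v * (X k u * X l v)) = (if k = l then lam k else 0)"
    and rh: "reverse_hyper \<pi>B pB r" and r_pos: "1 \<le> r"
    and L: "0 \<le> L" "L < 1" "k \<noteq> e0 \<Longrightarrow> \<bar>lam k\<bar> \<le> L"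
    and complete: "pV u \<noteq> 0 \<Longrightarrow> (\<Sum>k\<in>UNIV. X k u * X k v * pV v) = (if u = v then 1 else 0)"
begin

lemma lam_e0: "lam e0 = 1"
  using \<pi>V_mom[of e0 e0] by (simp add: \<pi>V_fst orthonormal_sum[OF onV])

lemma pV_nonneg: "0 \<le> pV w" and pB_nonneg: "0 \<le> pB w"
  using onV onB by (auto intro: orthonormal_nonneg)

lemma pV_sum: "(\<Sum>w\<in>UNIV. pV w) = 1" and pB_sum: "(\<Sum>w\<in>UNIV. pB w) = 1"
  using onV onB by (auto intro: orthonormal_sum)

lemma \<pi>V_supp: "\<pi>V u v \<noteq> 0 \<Longrightarrow> pV u \<noteq> 0 \<and> pV v \<noteq> 0"
proof -
  assume "\<pi>V u v \<noteq> 0"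
  then have "0 < \<pi>V u v" using \<pi>V_nonneg[of u v] by simp
  moreover have "\<pi>V u v \<le> (\<Sum>v\<in>UNIV. \<pi>V u v)" "\<pi>V u v \<le> (\<Sum>u\<in>UNIV. \<pi>V u v)"
    using \<pi>V_nonneg by (auto intro!: member_le_sum)
  ultimately show ?thesis by (auto simp: \<pi>V_fst \<pi>V_snd)
qed

section \<open>Expansion in eigenfunctions and the noise operator\<close>

definition coef :: "'i set \<Rightarrow> (('i \<Rightarrow> 'w) \<Rightarrow> real) \<Rightarrow> ('i \<Rightarrow> 'k) \<Rightarrow> real" where
  "coef N F \<sigma> = pexp N (\<lambda>_. pV) (\<lambda>y. F y * (\<Prod>i\<in>N. X (\<sigma> i) (y i)))"

text \<open>By completeness in each coordinate, the kernel obtained by summing over all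
  multi-indices is a point mass at \<open>x\<close>.\<close>

lemma chaos_coef:
  assumes fin: "finite N" and x: "x \<in> N \<rightarrow>\<^sub>E UNIV" "\<And>i. i \<in> N \<Longrightarrow> pV (x i) \<noteq> 0"
  shows "chaos N X (coef N F) x = F x"
proof -
  have "chaos N X (coef N F) x
     = pexp N (\<lambda>_. pV) (\<lambda>y. F y * pexp N (\<lambda>i k. X k (x i)) (\<lambda>\<sigma>. \<Prod>i\<in>N. X (\<sigma> i) (y i)))"
    unfolding chaos_def coef_def by (subst pexp_swap) (simp add: pexp_cmult)
  also have "\<dots> = (\<Sum>y\<in>N \<rightarrow>\<^sub>E UNIV. F y * (\<Prod>i\<in>N. if x i = y i then 1 else 0))"
    unfolding pexp_def[of N "\<lambda>_. pV"]
  proof (intro sum.cong refl)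
    fix y :: "'a \<Rightarrow> 'w"
    have "pexp N (\<lambda>i k. X k (x i)) (\<lambda>\<sigma>. \<Prod>i\<in>N. X (\<sigma> i) (y i)) = (\<Prod>i\<in>N. \<Sum>k\<in>UNIV. X k (x i) * X k (y i))"
      using pexp_prod[OF fin, of "\<lambda>i k. X k (x i)" "\<lambda>i k. X k (y i)"] .
    moreover have "(\<Prod>i\<in>N. pV (y i)) * (\<Prod>i\<in>N. \<Sum>k\<in>UNIV. X k (x i) * X k (y i)) = (\<Prod>i\<in>N. if x i = y i then 1 else 0)"
      unfolding prod.distrib[symmetric] using complete[OF x(2)]
      by (intro prod.cong refl) (simp only: mult.commute[of "pV _"] sum_distrib_right)
    ultimately show "(\<Prod>i\<in>N. pV (y i)) * (F y * pexp N (\<lambda>i k. X k (x i)) (\<lambda>\<sigma>. \<Prod>i\<in>N. X (\<sigma> i) (y i)))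
        = F y * (\<Prod>i\<in>N. if x i = y i then 1 else 0)" by simp
  qed
  also have "\<dots> = (\<Sum>y\<in>N \<rightarrow>\<^sub>E UNIV. if x = y then F x else 0)"
    using prod_eq_on_PiE[OF fin x(1), of _ "\<lambda>_. 1"] by (intro sum.cong refl) auto
  also have "\<dots> = F x" using x fin by (simp add: finite_PiE)
  finally show ?thesis .
qed

text \<open>Keep the state with probability \<theta>, otherwise draw it afresh from
  \<open>pV\<close>. Realising the multiplier \<theta>^degree as an average keeps values in [0, 1]
  and does not increase L1 distances.\<close>

definition noise :: "real \<Rightarrow> 'w \<Rightarrow> 'w \<Rightarrow> real" where
  "noise \<theta> u v = \<theta> * (if u = v then 1 else 0) + (1 - \<theta>) * pV v"

lemma noise_nonneg: "0 \<le> \<theta> \<Longrightarrow> \<theta> \<le> 1 \<Longrightarrow> 0 \<le> noise \<theta> u v"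
  using pV_nonneg[of v] by (simp add: noise_def)

lemma noise_sum: "(\<Sum>v\<in>UNIV. noise \<theta> u v) = 1"
  by (simp add: noise_def sum.distrib pV_sum flip: sum_distrib_left)

lemma noise_stationary: "(\<Sum>u\<in>UNIV. pV u * noise \<theta> u v) = pV v"
proof -
  have "(\<Sum>u\<in>UNIV. pV u * noise \<theta> u v) = \<theta> * (\<Sum>u\<in>UNIV. if u = v then pV u else 0) + (1 - \<theta>) * pV v * (\<Sum>u\<in>UNIV. pV u)"
    unfolding sum_distrib_left sum.distrib[symmetric] by (intro sum.cong refl) (simp add: noise_def algebra_simps)
  then show ?thesis by (simp add: pV_sum algebra_simps)
qed

lemma noise_X: "(\<Sum>v\<in>UNIV. noise \<theta> u v * X k v) = (if k = e0 then 1 else \<theta>) * X k u"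
proof -
  have "(\<Sum>v\<in>UNIV. noise \<theta> u v * X k v) = \<theta> * (\<Sum>v\<in>UNIV. if u = v then X k v else 0) + (1 - \<theta>) * (\<Sum>v\<in>UNIV. pV v * X k v)"
    unfolding sum_distrib_left sum.distrib[symmetric] by (intro sum.cong refl) (simp add: noise_def algebra_simps)
  then show ?thesis by (simp add: orthonormal_mean[OF onV])
qed

definition noisy :: "real \<Rightarrow> 'i set \<Rightarrow> (('i \<Rightarrow> 'w) \<Rightarrow> real) \<Rightarrow> ('i \<Rightarrow> 'w) \<Rightarrow> real" where
  "noisy \<theta> N F x = pexp N (\<lambda>i. noise \<theta> (x i)) F"

lemma pexp_noisy:
  assumes "finite N" shows "pexp N (\<lambda>_. pV) (noisy \<theta> N F) = pexp N (\<lambda>_. pV) F"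
  unfolding noisy_def pexp2_kernel[OF assms, of "\<lambda>_. pV" "\<lambda>_. noise \<theta>" "\<lambda>x. F", symmetric]
  using assms noise_stationary by (intro pexp2_snd) auto

lemma noisy_abs:
  assumes "finite N" "0 \<le> \<theta>" "\<theta> \<le> 1"
  shows "pexp N (\<lambda>_. pV) (\<lambda>x. \<bar>noisy \<theta> N F x - \<alpha>\<bar>) \<le> pexp N (\<lambda>_. pV) (\<lambda>x. \<bar>F x - \<alpha>\<bar>)"
proof -
  have "\<bar>noisy \<theta> N F x - \<alpha>\<bar> \<le> noisy \<theta> N (\<lambda>x. \<bar>F x - \<alpha>\<bar>) x" for x
  proof -
    have "noisy \<theta> N F x - \<alpha> = pexp N (\<lambda>i. noise \<theta> (x i)) (\<lambda>y. F y - \<alpha>)"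
      using assms noise_sum by (simp add: noisy_def pexp_diff pexp_const)
    then show ?thesis unfolding noisy_def using assms by (simp add: pexp_abs_le noise_nonneg)
  qed
  then have "pexp N (\<lambda>_. pV) (\<lambda>x. \<bar>noisy \<theta> N F x - \<alpha>\<bar>) \<le> pexp N (\<lambda>_. pV) (noisy \<theta> N (\<lambda>x. \<bar>F x - \<alpha>\<bar>))"
    using assms pV_nonneg by (intro pexp_mono) auto
  then show ?thesis by (simp only: pexp_noisy[OF assms(1)])
qed

lemma noisy_bounds:
  assumes "finite N" "0 \<le> \<theta>" "\<theta> \<le> 1" "\<And>x. 0 \<le> F x" "\<And>x. F x \<le> 1"
  shows "0 \<le> noisy \<theta> N F x" "noisy \<theta> N F x \<le> 1"
proof -
  show "0 \<le> noisy \<theta> N F x" unfolding noisy_def using assms by (intro pexp_nonneg) (auto simp: noise_nonneg)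
  have "noisy \<theta> N F x \<le> pexp N (\<lambda>i. noise \<theta> (x i)) (\<lambda>_. 1)"
    unfolding noisy_def using assms by (intro pexp_mono) (auto simp: noise_nonneg)
  then show "noisy \<theta> N F x \<le> 1" using assms noise_sum by (simp add: pexp_const)
qed

lemma noisy_chaos:
  assumes fin: "finite N" and x: "x \<in> N \<rightarrow>\<^sub>E UNIV" "\<And>i. i \<in> N \<Longrightarrow> pV (x i) \<noteq> 0"
  shows "noisy \<theta> N F x = chaos N X (\<lambda>\<sigma>. \<theta> ^ degree N \<sigma> * coef N F \<sigma>) x"
proof -
  have "noisy \<theta> N F x = pexp N (\<lambda>i. noise \<theta> (x i)) (chaos N X (coef N F))"
    unfolding noisy_def
  proof (intro pexp_cong fin refl)
    fix y assume y: "y \<in> N \<rightarrow>\<^sub>E UNIV" "\<And>i. i \<in> N \<Longrightarrow> noise \<theta> (x i) (y i) \<noteq> 0"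
    have "pV (y i) \<noteq> 0" if "i \<in> N" for i
      using y(2)[OF that] x(2)[OF that] by (auto simp: noise_def split: if_splits)
    then show "F y = chaos N X (coef N F) y" using y(1) by (intro chaos_coef [symmetric] fin)
  qed
  also have "\<dots> = pexp N (\<lambda>i. noise \<theta> (x i)) (\<lambda>y. \<Sum>\<sigma>\<in>N \<rightarrow>\<^sub>E UNIV. coef N F \<sigma> * (\<Prod>i\<in>N. X (\<sigma> i) (y i)))"
    by (intro pexp_cong fin refl) (simp only: chaos_eq_sum)
  also have "\<dots> = (\<Sum>\<sigma>\<in>N \<rightarrow>\<^sub>E UNIV. coef N F \<sigma> * (\<Prod>i\<in>N. (if \<sigma> i = e0 then 1 else \<theta>) * X (\<sigma> i) (x i)))"
    using pexp_prod[OF fin, of "\<lambda>i. noise \<theta> (x i)" "\<lambda>i. X (\<sigma> i)" for \<sigma>]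
    by (simp only: pexp_sum pexp_cmult noise_X)
  also have "\<dots> = (\<Sum>\<sigma>\<in>N \<rightarrow>\<^sub>E UNIV. (\<theta> ^ degree N \<sigma> * coef N F \<sigma>) * (\<Prod>i\<in>N. X (\<sigma> i) (x i)))"
    unfolding prod.distrib prod_degree[OF fin] by (simp only: mult_ac)
  finally show ?thesis by (simp only: chaos_eq_sum)
qed

lemma sqnorm_coef:
  assumes fin: "finite N"
  shows "sqnorm N (coef N F) = pexp N (\<lambda>_. pV) (\<lambda>x. (F x)\<^sup>2)"
  unfolding pexp_chaos_sq[OF fin onV, symmetric]
  by (intro pexp_cong fin refl) (simp add: chaos_coef fin)

lemma pexp2_coef:
  assumes fin: "finite N"
  shows "pexp2 N (\<lambda>_. \<pi>V) (\<lambda>x y. F x * G y) = pexp N (\<lambda>_. lam) (\<lambda>\<sigma>. coef N F \<sigma> * coef N G \<sigma>)"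
proof -
  have "pexp2 N (\<lambda>_. \<pi>V) (\<lambda>x y. F x * G y) = pexp2 N (\<lambda>_. \<pi>V) (\<lambda>x y. chaos N X (coef N F) x * chaos N X (coef N G) y)"
  proof (intro pexp2_cong fin refl)
    fix x y assume xy: "x \<in> N \<rightarrow>\<^sub>E UNIV" "y \<in> N \<rightarrow>\<^sub>E UNIV" "\<And>i. i \<in> N \<Longrightarrow> \<pi>V (x i) (y i) \<noteq> 0"
    have supp: "pV (x i) \<noteq> 0" "pV (y i) \<noteq> 0" if "i \<in> N" for i using \<pi>V_supp[OF xy(3)[OF that]] by auto
    show "F x * G y = chaos N X (coef N F) x * chaos N X (coef N G) y"
      by (simp only: chaos_coef[OF fin xy(1) supp(1)] chaos_coef[OF fin xy(2) supp(2)])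
  qed
  then show ?thesis using pexp2_chaos[OF fin, of "\<lambda>_. \<pi>V" X lam "coef N F" "coef N G"] \<pi>V_mom by simp
qed

text \<open>Noise alone leaves terms of every degree, and truncation alone gives no bound on the
  tail; after noise the tail beyond \<open>D\<close> has norm at most \<theta>^D.\<close>

definition smoothed :: "real \<Rightarrow> nat \<Rightarrow> 'i set \<Rightarrow> (('i \<Rightarrow> 'w) \<Rightarrow> real) \<Rightarrow> ('i \<Rightarrow> 'k) \<Rightarrow> real" where
  "smoothed \<theta> D N F \<sigma> = (if degree N \<sigma> \<le> D then \<theta> ^ degree N \<sigma> * coef N F \<sigma> else 0)"

lemma sqnorm_mono:
  assumes "finite N" "\<And>\<sigma>. (c \<sigma>)\<^sup>2 \<le> a * (d \<sigma>)\<^sup>2" shows "sqnorm N c \<le> a * sqnorm N d"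
  unfolding sqnorm_def pexp_cmult[symmetric] using assms by (intro pexp_mono) auto

lemma sqnorm_coef_le_1:
  assumes "finite N" "\<And>x. 0 \<le> F x" "\<And>x. F x \<le> 1" shows "sqnorm N (coef N F) \<le> 1"
proof -
  have "sqnorm N (coef N F) \<le> pexp N (\<lambda>_. pV) (\<lambda>_. 1)"
    unfolding sqnorm_coef[OF assms(1)] using assms pV_nonneg by (intro pexp_mono) (auto simp: power_le_one)
  then show ?thesis using assms pV_sum by (simp add: pexp_const)
qed

lemma sqnorm_smoothed_le_1:
  assumes "finite N" "0 \<le> \<theta>" "\<theta> \<le> 1" "\<And>x. 0 \<le> F x" "\<And>x. F x \<le> 1"
  shows "sqnorm N (smoothed \<theta> D N F) \<le> 1"
proof -
  have "sqnorm N (smoothed \<theta> D N F) \<le> 1 * sqnorm N (coef N F)"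
  proof (intro sqnorm_mono assms(1))
    fix \<sigma> :: "'a \<Rightarrow> 'k"
    have "(\<theta> ^ degree N \<sigma>)\<^sup>2 \<le> 1" using assms by (intro power_le_one) auto
    then show "(smoothed \<theta> D N F \<sigma>)\<^sup>2 \<le> 1 * (coef N F \<sigma>)\<^sup>2"
      using mult_right_mono[of "(\<theta> ^ degree N \<sigma>)\<^sup>2" 1 "(coef N F \<sigma>)\<^sup>2"]
      by (simp add: smoothed_def power_mult_distrib)
  qed
  then show ?thesis using sqnorm_coef_le_1[of N F, OF assms(1,4,5)] by linarith
qed

lemma smoothed_tail:
  assumes fin: "finite N" and "0 \<le> \<theta>" "\<theta> \<le> 1" "\<And>x. 0 \<le> F x" "\<And>x. F x \<le> 1"
  shows "pexp N (\<lambda>_. pV) (\<lambda>x. (chaos N X (smoothed \<theta> D N F) x - noisy \<theta> N F x)\<^sup>2) \<le> (\<theta> ^ D)\<^sup>2"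
proof -
  define d where "d \<sigma> = (if degree N \<sigma> \<le> D then 0 else - (\<theta> ^ degree N \<sigma> * coef N F \<sigma>))" for \<sigma>
  have "pexp N (\<lambda>_. pV) (\<lambda>x. (chaos N X (smoothed \<theta> D N F) x - noisy \<theta> N F x)\<^sup>2)
      = pexp N (\<lambda>_. pV) (\<lambda>x. (chaos N X d x)\<^sup>2)"
  proof (intro pexp_cong fin refl)
    fix x assume x: "x \<in> N \<rightarrow>\<^sub>E UNIV" "\<And>i. i \<in> N \<Longrightarrow> pV (x i) \<noteq> 0"
    have "chaos N X (smoothed \<theta> D N F) x - noisy \<theta> N F x = chaos N X d x"
      unfolding noisy_chaos[OF fin x, simplified] chaos_def pexp_diff[symmetric]
      by (intro pexp_cong fin refl) (simp add: smoothed_def d_def)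
    then show "(chaos N X (smoothed \<theta> D N F) x - noisy \<theta> N F x)\<^sup>2 = (chaos N X d x)\<^sup>2" by simp
  qed
  also have "\<dots> = sqnorm N d" by (rule pexp_chaos_sq[OF fin onV])
  also have "\<dots> \<le> (\<theta> ^ D)\<^sup>2 * sqnorm N (coef N F)"
  proof (intro sqnorm_mono fin)
    fix \<sigma> :: "'a \<Rightarrow> 'k"
    show "(d \<sigma>)\<^sup>2 \<le> (\<theta> ^ D)\<^sup>2 * (coef N F \<sigma>)\<^sup>2"
    proof (cases "degree N \<sigma> \<le> D")
      case False
      then have "(\<theta> ^ degree N \<sigma>)\<^sup>2 \<le> (\<theta> ^ D)\<^sup>2" using assms by (intro power_mono power_decreasing) auto
      then show ?thesis using False by (simp add: d_def power_mult_distrib mult_right_mono)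
    qed (simp add: d_def)
  qed
  also have "\<dots> \<le> (\<theta> ^ D)\<^sup>2 * 1" using assms by (intro mult_left_mono sqnorm_coef_le_1) auto
  finally show ?thesis by simp
qed

text \<open>A term of degree s enters with a factor of size at most L^s. If s <= D, smoothing
  removes at most the fraction 2 s (1 - \<theta>) of it, and s L^s is at most 1 / (1 - L); if s > D,
  L^s itself is at most \<theta>^D. The gap thus makes the error independent of the number of
  coordinates.\<close>

lemma smoothing_error:
  assumes fin: "finite N" and \<theta>: "0 < \<theta>" "\<theta> \<le> 1" "L \<le> \<theta>" "2 * (1 - \<theta>) \<le> \<eta> * (1 - L)" "\<theta> ^ D \<le> \<eta>"
    and F: "\<And>x. 0 \<le> F x" "\<And>x. F x \<le> 1" and G: "\<And>x. 0 \<le> G x" "\<And>x. G x \<le> 1"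
  shows "\<bar>pexp2 N (\<lambda>_. \<pi>V) (\<lambda>x y. F x * G y) - pexp N (\<lambda>_. lam) (\<lambda>\<sigma>. smoothed \<theta> D N F \<sigma> * smoothed \<theta> D N G \<sigma>)\<bar> \<le> \<eta>"
proof -
  have \<eta>: "0 \<le> \<eta>" using order_trans[OF zero_le_power \<theta>(5)] \<theta>(1) by simp
  define m where "m s = (if s \<le> D then 1 - (\<theta> ^ s)\<^sup>2 else 1)" for s
  have m: "L ^ s * m s \<le> \<eta>" "0 \<le> m s" for s
  proof -
    show "0 \<le> m s" using \<theta> by (auto simp: m_def power_le_one)
    show "L ^ s * m s \<le> \<eta>"
    proof (cases "s \<le> D")
      case True
      have "1 + real (2 * s) * (\<theta> - 1) \<le> (1 + (\<theta> - 1)) ^ (2 * s)"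
        using \<theta> by (intro Bernoulli_inequality) auto
      then have "m s \<le> 2 * real s * (1 - \<theta>)"
        using True by (simp add: m_def algebra_simps flip: power_mult)
      then have "L ^ s * m s \<le> L ^ s * (2 * real s * (1 - \<theta>))" using L by (intro mult_left_mono) auto
      also have "\<dots> = real s * L ^ s * (2 * (1 - \<theta>))" by simp
      also have "\<dots> \<le> real s * L ^ s * (\<eta> * (1 - L))" using \<theta> L by (intro mult_left_mono) auto
      also have "\<dots> = \<eta> * (real s * L ^ s * (1 - L))" by simp
      also have "\<dots> \<le> \<eta> * 1"
        using mult_power_le_one[of L s] L \<eta> by (intro mult_left_mono) auto
      finally show ?thesis by simp
    next
      case False
      have "L ^ s \<le> \<theta> ^ s" using L \<theta> by (intro power_mono) auto
      also have "\<dots> \<le> \<theta> ^ D" using False \<theta> by (intro power_decreasing) auto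
      finally show ?thesis using False \<theta> by (simp add: m_def)
    qed
  qed
  let ?f = "coef N F" and ?g = "coef N G"
  have sf: "?f \<sigma> * ?g \<sigma> - smoothed \<theta> D N F \<sigma> * smoothed \<theta> D N G \<sigma> = m (degree N \<sigma>) * (?f \<sigma> * ?g \<sigma>)" for \<sigma>
    by (simp add: smoothed_def m_def power2_eq_square algebra_simps)
  have "\<bar>pexp2 N (\<lambda>_. \<pi>V) (\<lambda>x y. F x * G y) - pexp N (\<lambda>_. lam) (\<lambda>\<sigma>. smoothed \<theta> D N F \<sigma> * smoothed \<theta> D N G \<sigma>)\<bar>
     = \<bar>pexp N (\<lambda>_. lam) (\<lambda>\<sigma>. m (degree N \<sigma>) * (?f \<sigma> * ?g \<sigma>))\<bar>"
    unfolding pexp2_coef[OF fin] pexp_diff[symmetric] sf ..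
  also have "\<dots> \<le> (\<Sum>\<sigma>\<in>N \<rightarrow>\<^sub>E UNIV. \<bar>(\<Prod>i\<in>N. lam (\<sigma> i)) * (m (degree N \<sigma>) * (?f \<sigma> * ?g \<sigma>))\<bar>)"
    unfolding pexp_def by (rule sum_abs)
  also have "\<dots> \<le> (\<Sum>\<sigma>\<in>N \<rightarrow>\<^sub>E UNIV. \<eta> * ((?f \<sigma>)\<^sup>2 + (?g \<sigma>)\<^sup>2) / 2)"
  proof (intro sum_mono)
    fix \<sigma> :: "'a \<Rightarrow> 'k"
    have "\<bar>\<Prod>i\<in>N. lam (\<sigma> i)\<bar> \<le> (\<Prod>i\<in>N. if \<sigma> i = e0 then 1 else L)"
      unfolding abs_prod using L lam_e0 by (intro prod_mono) auto
    then have l: "\<bar>\<Prod>i\<in>N. lam (\<sigma> i)\<bar> \<le> L ^ degree N \<sigma>" by (simp only: prod_degree[OF fin])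
    have "\<bar>(\<Prod>i\<in>N. lam (\<sigma> i)) * (m (degree N \<sigma>) * (?f \<sigma> * ?g \<sigma>))\<bar> = \<bar>\<Prod>i\<in>N. lam (\<sigma> i)\<bar> * m (degree N \<sigma>) * \<bar>?f \<sigma> * ?g \<sigma>\<bar>"
      using m(2) by (simp add: abs_mult mult.assoc)
    also have "\<dots> \<le> L ^ degree N \<sigma> * m (degree N \<sigma>) * \<bar>?f \<sigma> * ?g \<sigma>\<bar>"
      using l m(2) by (intro mult_right_mono) auto
    also have "\<dots> \<le> \<eta> * \<bar>?f \<sigma> * ?g \<sigma>\<bar>" using m(1) by (intro mult_right_mono) auto
    also have "\<bar>?f \<sigma> * ?g \<sigma>\<bar> \<le> ((?f \<sigma>)\<^sup>2 + (?g \<sigma>)\<^sup>2) / 2"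
      using zero_le_power2[of "\<bar>?f \<sigma>\<bar> - \<bar>?g \<sigma>\<bar>"] by (simp add: power2_diff abs_mult)
    finally show "\<bar>(\<Prod>i\<in>N. lam (\<sigma> i)) * (m (degree N \<sigma>) * (?f \<sigma> * ?g \<sigma>))\<bar> \<le> \<eta> * ((?f \<sigma>)\<^sup>2 + (?g \<sigma>)\<^sup>2) / 2"
      using \<eta> by (simp add: mult_left_mono)
  qed
  also have "\<dots> = \<eta> * (sqnorm N ?f + sqnorm N ?g) / 2"
    by (simp add: sqnorm_def pexp_def sum.distrib flip: sum_distrib_left sum_divide_distrib)
  also have "\<dots> \<le> \<eta> * (1 + 1) / 2"
    using \<eta> fin F G
    by (intro divide_right_mono mult_left_mono add_mono sqnorm_coef_le_1) auto
  finally show ?thesis by simp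
qed

end

section \<open>Hybrid laws: the chain on \<open>K\<close>, bits elsewhere\<close>

context coupled_ensemble
begin

definition mixed :: "'i set \<Rightarrow> 'i \<Rightarrow> 'w \<Rightarrow> real" where
  "mixed K i = (if i \<in> K then pV else pB)"

definition mixed2 :: "'i set \<Rightarrow> 'i \<Rightarrow> 'w \<Rightarrow> 'w \<Rightarrow> real" where
  "mixed2 K i = (if i \<in> K then \<pi>V else \<pi>B)"

lemma mixed_nonneg: "0 \<le> mixed K i w" and mixed_sum: "(\<Sum>w\<in>UNIV. mixed K i w) = 1"
  and mixed_orthonormal: "orthonormal (mixed K i)"
  using pV_nonneg pB_nonneg pV_sum pB_sum onV onB by (auto simp: mixed_def)

lemma mixed2_nonneg: "0 \<le> mixed2 K i u v"
  and mixed2_fst: "(\<Sum>v\<in>UNIV. mixed2 K i u v) = mixed K i u"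
  and mixed2_snd: "(\<Sum>u\<in>UNIV. mixed2 K i u v) = mixed K i v"
  and mixed2_mom: "(\<Sum>u\<in>UNIV. \<Sum>v\<in>UNIV. mixed2 K i u v * (X k u * X l v)) = (if k = l then lam k else 0)"
  using \<pi>V_nonneg \<pi>B_nonneg
  by (simp_all add: mixed_def mixed2_def \<pi>V_fst \<pi>V_snd \<pi>B_fst \<pi>B_snd \<pi>V_mom \<pi>B_mom)

lemma pexp_mixed:
  assumes "finite N" "K \<subseteq> N"
  shows "pexp N (mixed K) f = pexp K (\<lambda>_. pV) (\<lambda>a. pexp (N - K) (\<lambda>_. pB) (\<lambda>y. f (override_on y a K)))"
  unfolding pexp_split_subset[OF assms]
  using assms finite_subset[OF assms(2,1)] by (intro pexp_cong refl) (auto simp: mixed_def intro!: pexp_cong)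

lemma pexp2_mixed:
  assumes "finite N" "K \<subseteq> N"
  shows "pexp2 N (mixed2 K) h = pexp2 K (\<lambda>_. \<pi>V)
     (\<lambda>a b. pexp2 (N - K) (\<lambda>_. \<pi>B) (\<lambda>x y. h (override_on x a K) (override_on y b K)))"
  unfolding pexp2_split_subset[OF assms]
  using assms finite_subset[OF assms(2,1)] by (intro pexp2_cong refl) (auto simp: mixed2_def intro!: pexp2_cong)

lemma smoothed_degree: "smoothed \<theta> D N F \<sigma> \<noteq> 0 \<Longrightarrow> degree N \<sigma> \<le> D"
  by (auto simp: smoothed_def split: if_splits)

text \<open>Under the chain's law the polynomial is close to the noisy \<open>F\<close>, which lies
  in [0, 1], so the smooth distance is small on average; exchanging the coordinates outside
  \<open>K\<close> changes this average little. The influences sum to at most \<open>D\<close>, so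
  the error does not grow with \<open>N\<close>.\<close>

lemma clip_error_mixed:
  assumes fin: "finite N" and K: "K \<subseteq> N" and \<theta>: "0 \<le> \<theta>" "\<theta> \<le> 1"
    and F: "\<And>x. 0 \<le> F x" "\<And>x. F x \<le> 1"
    and b: "0 < b" "4 * b\<^sup>2 \<le> 1" "3 * b ^ 4 * Bd \<le> 1"
    and s: "0 < s" and \<eta>: "0 < \<eta>"
    and inf: "\<And>j. j \<in> N - K \<Longrightarrow> influence N (smoothed \<theta> D N F) j \<le> s\<^sup>2"
    and sb: "4 * s * (1 + Bd * ((1 / b) ^ (2 * D))\<^sup>2) * real D \<le> \<eta> ^ 3 / 8" and \<theta>D: "\<theta> ^ D \<le> \<eta> / 4"
  shows "pexp N (mixed K) (\<lambda>z. (chaos N X (smoothed \<theta> D N F) z - clip (chaos N X (smoothed \<theta> D N F) z))\<^sup>2) \<le> \<eta>\<^sup>2"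
proof -
  let ?P = "chaos N X (smoothed \<theta> D N F)" and ?I = "influence N (smoothed \<theta> D N F)"
  let ?\<Psi> = "smooth_dist (\<eta> / 2)" and ?C = "(1 / b) ^ (2 * D)"
  have \<kappa>: "0 < \<eta> / 2" using \<eta> by simp
  obtain \<Psi>' \<Psi>'' where T: "\<And>t y. \<bar>?\<Psi> (t + y) - ?\<Psi> t - \<Psi>' t * y - \<Psi>'' t * y\<^sup>2\<bar> \<le> 4 * \<bar>y\<bar> ^ 3"
    using smooth_dist_taylor[of "\<eta> / 2"] by blast
  have mix: "pexp N (\<lambda>i. if i \<in> N - K then pB else pV) f = pexp N (mixed K) f" for f
    using fin by (intro pexp_cong) (auto simp: mixed_def)
  have "\<bar>pexp N (\<lambda>_. pV) (\<lambda>z. ?\<Psi> (?P z)) - pexp N (\<lambda>i. if i \<in> N - K then pB else pV) (\<lambda>z. ?\<Psi> (?P z))\<bar>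
     \<le> (\<Sum>j\<in>N - K. 4 * (s * ?I j + Bd * (?C * ?I j)\<^sup>2 / s))"
    using T by (intro invariance[where \<Psi>' = \<Psi>' and \<Psi>'' = \<Psi>''] fin onV onB b s smoothed_degree) auto
  also have "\<dots> \<le> (\<Sum>j\<in>N - K. 4 * s * (1 + Bd * ?C\<^sup>2) * ?I j)"
  proof (intro sum_mono)
    fix j assume j: "j \<in> N - K"
    \<comment> \<open>Influence at most s^2 brings the error term quadratic in the influence down to
      the order of the linear one.\<close>
    have "?I j * ?I j \<le> s\<^sup>2 * ?I j" using inf[OF j] influence_nonneg[OF fin] by (intro mult_right_mono)
    then have "?I j * ?I j / s \<le> s * ?I j" using s by (simp add: divide_le_eq power2_eq_square mult_ac)
    then have le: "Bd * ?C\<^sup>2 * (?I j * ?I j / s) \<le> Bd * ?C\<^sup>2 * (s * ?I j)"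
      using Bd_ge_1 by (intro mult_left_mono) auto
    show "4 * (s * ?I j + Bd * (?C * ?I j)\<^sup>2 / s) \<le> 4 * s * (1 + Bd * ?C\<^sup>2) * ?I j"
    proof -
      have "4 * (s * ?I j + Bd * (?C * ?I j)\<^sup>2 / s) = 4 * (s * ?I j) + 4 * (Bd * ?C\<^sup>2 * (?I j * ?I j / s))"
        by (simp add: power_mult_distrib power2_eq_square mult_ac)
      moreover have "4 * s * (1 + Bd * ?C\<^sup>2) * ?I j = 4 * (s * ?I j) + 4 * (Bd * ?C\<^sup>2 * (s * ?I j))"
        by (simp add: algebra_simps)
      ultimately show ?thesis using le by linarith
    qed
  qed
  also have "\<dots> = 4 * s * (1 + Bd * ?C\<^sup>2) * (\<Sum>j\<in>N - K. ?I j)" by (rule sum_distrib_left [symmetric])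
  also have "\<dots> \<le> 4 * s * (1 + Bd * ?C\<^sup>2) * real D"
  proof (intro mult_left_mono)
    have "(\<Sum>j\<in>N - K. ?I j) \<le> (\<Sum>j\<in>N. ?I j)"
      using fin influence_nonneg[OF fin] by (intro sum_mono2) auto
    also have "\<dots> \<le> real D * sqnorm N (smoothed \<theta> D N F)"
      by (intro sum_influence_le fin smoothed_degree)
    also have "\<dots> \<le> real D * 1" using fin \<theta> F by (intro mult_left_mono sqnorm_smoothed_le_1) auto
    finally show "(\<Sum>j\<in>N - K. ?I j) \<le> real D" by simp
    show "0 \<le> 4 * s * (1 + Bd * ?C\<^sup>2)" using s Bd_ge_1 by simp
  qed
  also note sb
  finally have "pexp N (mixed K) (\<lambda>z. ?\<Psi> (?P z)) \<le> pexp N (\<lambda>_. pV) (\<lambda>z. ?\<Psi> (?P z)) + \<eta> ^ 3 / 8"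
    unfolding mix by linarith
  also have "pexp N (\<lambda>_. pV) (\<lambda>z. ?\<Psi> (?P z)) \<le> pexp N (\<lambda>_. pV) (\<lambda>z. 3 * (\<eta> / 2) * (?P z - noisy \<theta> N F z)\<^sup>2)"
    using fin \<theta> F noisy_bounds[of N \<theta> F] pV_nonneg \<kappa> by (intro pexp_mono smooth_dist_le) auto
  also have "\<dots> \<le> 3 * (\<eta> / 2) * (\<theta> ^ D)\<^sup>2"
    unfolding pexp_cmult using \<eta> fin \<theta> F by (intro mult_left_mono smoothed_tail) auto
  also have "(\<theta> ^ D)\<^sup>2 \<le> (\<eta> / 4)\<^sup>2" using \<theta>D \<theta> by (intro power_mono) auto
  finally have M: "pexp N (mixed K) (\<lambda>z. ?\<Psi> (?P z)) \<le> 3 * (\<eta> / 2) * (\<eta> / 4)\<^sup>2 + \<eta> ^ 3 / 8"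
    using \<eta> by (simp add: mult_left_mono)
  have "pexp N (mixed K) (\<lambda>z. (?P z - clip (?P z))\<^sup>2) \<le> pexp N (mixed K) (\<lambda>z. (\<eta> / 2)\<^sup>2 + (1 / (\<eta> / 2)) * ?\<Psi> (?P z))"
    using fin mixed_nonneg clip_error_le[OF \<kappa>] by (intro pexp_mono) (auto simp: mult.commute)
  also have "\<dots> = (\<eta> / 2)\<^sup>2 + (1 / (\<eta> / 2)) * pexp N (mixed K) (\<lambda>z. ?\<Psi> (?P z))"
    unfolding pexp_add pexp_cmult pexp_const[OF fin mixed_sum] ..
  also have "\<dots> \<le> (\<eta> / 2)\<^sup>2 + (1 / (\<eta> / 2)) * (3 * (\<eta> / 2) * (\<eta> / 4)\<^sup>2 + \<eta> ^ 3 / 8)"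
    using \<eta> M by (intro add_left_mono mult_left_mono) auto
  also have "\<dots> = 11 / 16 * \<eta>\<^sup>2" using \<eta> by (simp add: field_simps power2_eq_square power3_eq_cube)
  also have "\<dots> \<le> \<eta>\<^sup>2" by simp
  finally show ?thesis .
qed

text \<open>Noise on coordinates that are averaged over has no effect, by stationarity; only the
  noise on \<open>K\<close> remains.\<close>

lemma noisy_override:
  assumes fin: "finite N" and K: "K \<subseteq> N"
  shows "pexp (N - K) (\<lambda>_. pV) (\<lambda>y. noisy \<theta> N F (override_on y a K))
    = noisy \<theta> K (\<lambda>a'. pexp (N - K) (\<lambda>_. pV) (\<lambda>y. F (override_on y a' K))) a"
proof -
  have fK: "finite K" using K fin by (rule finite_subset)
  have "noisy \<theta> N F (override_on y a K)
      = pexp K (\<lambda>i. noise \<theta> (a i)) (\<lambda>a'. noisy \<theta> (N - K) (\<lambda>y'. F (override_on y' a' K)) y)" for y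
    unfolding noisy_def pexp_split_subset[OF fin K]
    using fK fin by (intro pexp_cong refl) (auto intro!: pexp_cong)
  then have "pexp (N - K) (\<lambda>_. pV) (\<lambda>y. noisy \<theta> N F (override_on y a K))
     = pexp K (\<lambda>i. noise \<theta> (a i)) (\<lambda>a'. pexp (N - K) (\<lambda>_. pV) (noisy \<theta> (N - K) (\<lambda>y'. F (override_on y' a' K))))"
    by (simp only: pexp_swap[of K])
  then show ?thesis using fin by (simp only: pexp_noisy finite_Diff noisy_def[of \<theta> K])
qed

text \<open>Clipping costs \<eta> in L1 and truncation \<theta>^D. In between, the conditional means
  of the unclipped polynomial agree for bits and for states, and noise on \<open>K\<close> does not
  increase the L1 deviation.\<close>

lemma mean_deviation:
  assumes fin: "finite N" and K: "K \<subseteq> N" and \<theta>: "0 \<le> \<theta>" "\<theta> \<le> 1"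
    and F: "\<And>x. 0 \<le> F x" "\<And>x. F x \<le> 1" and \<eta>: "0 \<le> \<eta>"
    and P: "P = chaos N X (smoothed \<theta> D N F)"
    and e: "pexp N (mixed K) (\<lambda>z. (P z - clip (P z))\<^sup>2) \<le> \<eta>\<^sup>2"
  shows "pexp K (\<lambda>_. pV) (\<lambda>a. \<bar>pexp (N - K) (\<lambda>_. pB) (\<lambda>y. clip (P (override_on y a K))) - \<alpha>\<bar>)
    \<le> \<eta> + \<theta> ^ D + pexp K (\<lambda>_. pV) (\<lambda>a. \<bar>pexp (N - K) (\<lambda>_. pV) (\<lambda>y. F (override_on y a K)) - \<alpha>\<bar>)"
proof -
  have fK: "finite K" using K fin by (rule finite_subset)
  have NK: "K \<union> (N - K) = N" using K by auto
  let ?o = "\<lambda>y a. override_on y a K"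
  let ?H = "\<lambda>a. pexp (N - K) (\<lambda>_. pV) (\<lambda>y. F (?o y a))"
  have mean: "pexp (N - K) (\<lambda>_. pB) (\<lambda>y. P (?o y a)) = pexp (N - K) (\<lambda>_. pV) (\<lambda>y. P (?o y a))" for a
    using pexp_chaos_override[where J = K and S = "N - K" and p = "\<lambda>_. pB" and c = "smoothed \<theta> D N F" and x = a]
      pexp_chaos_override[where J = K and S = "N - K" and p = "\<lambda>_. pV" and c = "smoothed \<theta> D N F" and x = a]
      fin fK onB onV
    unfolding P NK by simp
  have pt: "\<bar>pexp (N - K) (\<lambda>_. pB) (\<lambda>y. clip (P (?o y a))) - \<alpha>\<bar>
      \<le> pexp (N - K) (\<lambda>_. pB) (\<lambda>y. \<bar>P (?o y a) - clip (P (?o y a))\<bar>)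
        + pexp (N - K) (\<lambda>_. pV) (\<lambda>y. \<bar>P (?o y a) - noisy \<theta> N F (?o y a)\<bar>) + \<bar>noisy \<theta> K ?H a - \<alpha>\<bar>" for a
  proof -
    have "\<bar>pexp (N - K) (\<lambda>_. pB) (\<lambda>y. P (?o y a) - clip (P (?o y a)))\<bar>
        \<le> pexp (N - K) (\<lambda>_. pB) (\<lambda>y. \<bar>P (?o y a) - clip (P (?o y a))\<bar>)"
      using fin pB_nonneg by (intro pexp_abs_le) auto
    moreover have "\<bar>pexp (N - K) (\<lambda>_. pV) (\<lambda>y. P (?o y a) - noisy \<theta> N F (?o y a))\<bar>
        \<le> pexp (N - K) (\<lambda>_. pV) (\<lambda>y. \<bar>P (?o y a) - noisy \<theta> N F (?o y a)\<bar>)"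
      using fin pV_nonneg by (intro pexp_abs_le) auto
    ultimately show ?thesis
      unfolding pexp_diff mean noisy_override[OF fin K] by linarith
  qed
  have "pexp K (\<lambda>_. pV) (\<lambda>a. \<bar>pexp (N - K) (\<lambda>_. pB) (\<lambda>y. clip (P (?o y a))) - \<alpha>\<bar>)
     \<le> pexp N (mixed K) (\<lambda>z. \<bar>P z - clip (P z)\<bar>) + pexp N (\<lambda>_. pV) (\<lambda>z. \<bar>P z - noisy \<theta> N F z\<bar>)
       + pexp K (\<lambda>_. pV) (\<lambda>a. \<bar>noisy \<theta> K ?H a - \<alpha>\<bar>)"
    unfolding pexp_mixed[OF fin K] pexp_split_subset[OF fin K, of "\<lambda>_. pV"] pexp_add[symmetric]
    using fK pV_nonneg pt by (intro pexp_mono) auto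
  also have "pexp N (mixed K) (\<lambda>z. \<bar>P z - clip (P z)\<bar>) \<le> \<eta>"
    using e fin mixed_nonneg mixed_sum \<eta> by (intro pexp_le) auto
  also have "pexp N (\<lambda>_. pV) (\<lambda>z. \<bar>P z - noisy \<theta> N F z\<bar>) \<le> \<theta> ^ D"
    using fin \<theta> F pV_nonneg pV_sum unfolding P by (intro pexp_le smoothed_tail) auto
  also have "pexp K (\<lambda>_. pV) (\<lambda>a. \<bar>noisy \<theta> K ?H a - \<alpha>\<bar>) \<le> pexp K (\<lambda>_. pV) (\<lambda>a. \<bar>?H a - \<alpha>\<bar>)"
    by (intro noisy_abs fK \<theta>)
  finally show ?thesis by simp
qed

text \<open>The minorant is a constant minus separate deviations of \<open>f\<close> and of
  \<open>g\<close>. Averaged over a coupling it involves only the marginals, so it survives zeros of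
  the coupling on \<open>K\<close>.\<close>

lemma mult_power_lower:
  fixes f g \<alpha> \<beta> \<epsilon> :: real
  assumes "0 \<le> f" "0 \<le> g" "0 < \<epsilon>" "\<epsilon> \<le> \<alpha>" "\<epsilon> \<le> \<beta>"
  shows "(\<epsilon>\<^sup>2 / 4) ^ r * (1 - 2 / \<alpha> * \<bar>f - \<alpha>\<bar> - 2 / \<beta> * \<bar>g - \<beta>\<bar>) \<le> f ^ r * g ^ r"
proof (cases "\<alpha> / 2 \<le> f \<and> \<beta> / 2 \<le> g")
  case True
  have "\<epsilon>\<^sup>2 / 4 = (\<epsilon> / 2) * (\<epsilon> / 2)" by (simp add: power2_eq_square)
  also have "\<dots> \<le> f * g" using True assms by (intro mult_mono) auto
  finally have "(\<epsilon>\<^sup>2 / 4) ^ r \<le> (f * g) ^ r" by (intro power_mono) auto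
  moreover have "(\<epsilon>\<^sup>2 / 4) ^ r * (1 - 2 / \<alpha> * \<bar>f - \<alpha>\<bar> - 2 / \<beta> * \<bar>g - \<beta>\<bar>) \<le> (\<epsilon>\<^sup>2 / 4) ^ r * 1"
    using assms by (intro mult_left_mono) (auto simp: diff_le_eq add_nonneg_nonneg)
  ultimately show ?thesis by (simp add: power_mult_distrib)
next
  case False
  have "1 \<le> 2 / \<alpha> * \<bar>f - \<alpha>\<bar> \<or> 1 \<le> 2 / \<beta> * \<bar>g - \<beta>\<bar>"
    using False assms by (auto simp: field_simps abs_if)
  moreover have "0 \<le> 2 / \<alpha> * \<bar>f - \<alpha>\<bar>" "0 \<le> 2 / \<beta> * \<bar>g - \<beta>\<bar>" using assms by auto
  ultimately have "1 - 2 / \<alpha> * \<bar>f - \<alpha>\<bar> - 2 / \<beta> * \<bar>g - \<beta>\<bar> \<le> 0" by linarith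
  then have "(\<epsilon>\<^sup>2 / 4) ^ r * (1 - 2 / \<alpha> * \<bar>f - \<alpha>\<bar> - 2 / \<beta> * \<bar>g - \<beta>\<bar>) \<le> 0"
    by (intro mult_nonneg_nonpos) auto
  also have "0 \<le> f ^ r * g ^ r" using assms by auto
  finally show ?thesis .
qed

text \<open>The coordinates in \<open>K\<close> stay with the chain, where the densities
  \<open>f\<close> and \<open>g\<close> are nearly constant on average; given their values, reverse
  hypercontractivity handles the bits. Of the loss 3 \<eta>, clipping causes 2 \<eta> and smoothing
  one \<eta>.\<close>

lemma dichotomy:
  assumes fin: "finite N"
    and F: "\<And>x. 0 \<le> F x" "\<And>x. F x \<le> 1" and G: "\<And>x. 0 \<le> G x" "\<And>x. G x \<le> 1"
    and \<epsilon>: "0 < \<epsilon>" "\<epsilon> \<le> pexp N (\<lambda>_. pV) F" "\<epsilon> \<le> pexp N (\<lambda>_. pV) G"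
    and \<theta>: "0 < \<theta>" "\<theta> \<le> 1" "L \<le> \<theta>" "2 * (1 - \<theta>) \<le> \<eta> * (1 - L)" and \<theta>D: "\<theta> ^ D \<le> \<eta> / 4"
    and b: "0 < b" "4 * b\<^sup>2 \<le> 1" "3 * b ^ 4 * Bd \<le> 1"
    and s: "0 < s" and \<eta>: "0 < \<eta>" "32 * \<eta> \<le> \<epsilon>"
    and sb: "4 * s * (1 + Bd * ((1 / b) ^ (2 * D))\<^sup>2) * real D \<le> \<eta> ^ 3 / 8"
    and dev: "\<And>K. K \<subseteq> N \<Longrightarrow> real (card K) * s\<^sup>2 \<le> 2 * real D \<Longrightarrow>
       deviation pV N K F < pexp N (\<lambda>_. pV) F / 16 \<and> deviation pV N K G < pexp N (\<lambda>_. pV) G / 16"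
  shows "(\<epsilon>\<^sup>2 / 4) ^ r / 2 - 3 * \<eta> \<le> pexp2 N (\<lambda>_. \<pi>V) (\<lambda>x y. F x * G y)"
proof -
  define c where "c = smoothed \<theta> D N F"
  define d where "d = smoothed \<theta> D N G"
  define P where "P = chaos N X c"
  define Q where "Q = chaos N X d"
  define \<alpha> where "\<alpha> = pexp N (\<lambda>_. pV) F"
  define \<beta> where "\<beta> = pexp N (\<lambda>_. pV) G"
  \<comment> \<open>Coordinates influential for either function. The influences of both together sum
    to at most 2 D, which bounds \<open>card K\<close> by 2 D / s^2.\<close>
  define K where "K = {j \<in> N. s\<^sup>2 < influence N c j + influence N d j}"
  have K: "K \<subseteq> N" by (auto simp: K_def)
  then have fK: "finite K" using fin by (rule finite_subset)
  have cd1: "sqnorm N c \<le> 1" "sqnorm N d \<le> 1"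
    unfolding c_def d_def using fin \<theta> F G by (intro sqnorm_smoothed_le_1; simp)+
  have "real (card K) * s\<^sup>2 = (\<Sum>j\<in>K. s\<^sup>2)" by simp
  also have "\<dots> \<le> (\<Sum>j\<in>K. influence N c j + influence N d j)" by (intro sum_mono) (auto simp: K_def)
  also have "\<dots> \<le> (\<Sum>j\<in>N. influence N c j + influence N d j)"
    using fin K influence_nonneg[OF fin] by (intro sum_mono2) auto
  also have "\<dots> = (\<Sum>j\<in>N. influence N c j) + (\<Sum>j\<in>N. influence N d j)" by (rule sum.distrib)
  also have "\<dots> \<le> real D * sqnorm N c + real D * sqnorm N d"
    unfolding c_def d_def by (intro add_mono sum_influence_le fin smoothed_degree)
  also have "\<dots> \<le> real D * 1 + real D * 1" using cd1 by (intro add_mono mult_left_mono) auto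
  finally have cardK: "real (card K) * s\<^sup>2 \<le> 2 * real D" by simp
  have infl: "influence N c j \<le> s\<^sup>2" "influence N d j \<le> s\<^sup>2" if "j \<in> N - K" for j
    using that influence_nonneg[OF fin, of c j] influence_nonneg[OF fin, of d j] by (auto simp: K_def)
  have eP: "pexp N (mixed K) (\<lambda>z. (P z - clip (P z))\<^sup>2) \<le> \<eta>\<^sup>2"
    unfolding P_def c_def using infl(1) \<theta> F
    by (intro clip_error_mixed[OF fin K _ _ _ _ b s \<eta>(1) _ sb \<theta>D]) (auto simp: c_def)
  have eQ: "pexp N (mixed K) (\<lambda>z. (Q z - clip (Q z))\<^sup>2) \<le> \<eta>\<^sup>2"
    unfolding Q_def d_def using infl(2) \<theta> G
    by (intro clip_error_mixed[OF fin K _ _ _ _ b s \<eta>(1) _ sb \<theta>D]) (auto simp: d_def)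
  define f where "f a = pexp (N - K) (\<lambda>_. pB) (\<lambda>y. clip (P (override_on y a K)))" for a
  define g where "g a = pexp (N - K) (\<lambda>_. pB) (\<lambda>y. clip (Q (override_on y a K)))" for a
  have fg: "0 \<le> f a" "0 \<le> g a" for a
    unfolding f_def g_def using fin pB_nonneg by (intro pexp_nonneg; auto)+
  \<comment> \<open>A deviation below \<alpha> / 16, plus errors \<eta> + \<eta> / 4 of at most
    \<alpha> / 16. After the factor 2 / \<alpha> each function uses up a quarter of the constant in
    \<open>mult_power_lower\<close>.\<close>
  have df: "pexp K (\<lambda>_. pV) (\<lambda>a. \<bar>f a - \<alpha>\<bar>) \<le> \<alpha> / 8"
  proof -
    have "pexp K (\<lambda>_. pV) (\<lambda>a. \<bar>f a - \<alpha>\<bar>) \<le> \<eta> + \<theta> ^ D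
        + pexp K (\<lambda>_. pV) (\<lambda>a. \<bar>pexp (N - K) (\<lambda>_. pV) (\<lambda>y. F (override_on y a K)) - \<alpha>\<bar>)"
      unfolding f_def using \<theta> F \<eta> eP by (intro mean_deviation fin K) (auto simp: P_def c_def)
    then show ?thesis using dev[OF K cardK] \<theta>D \<eta> \<epsilon> unfolding \<alpha>_def deviation_def by linarith
  qed
  have dg: "pexp K (\<lambda>_. pV) (\<lambda>a. \<bar>g a - \<beta>\<bar>) \<le> \<beta> / 8"
  proof -
    have "pexp K (\<lambda>_. pV) (\<lambda>a. \<bar>g a - \<beta>\<bar>) \<le> \<eta> + \<theta> ^ D
        + pexp K (\<lambda>_. pV) (\<lambda>a. \<bar>pexp (N - K) (\<lambda>_. pV) (\<lambda>y. G (override_on y a K)) - \<beta>\<bar>)"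
      unfolding g_def using \<theta> G \<eta> eQ by (intro mean_deviation fin K) (auto simp: Q_def d_def)
    then show ?thesis using dev[OF K cardK] \<theta>D \<eta> \<epsilon> unfolding \<beta>_def deviation_def by linarith
  qed
  have \<alpha>\<beta>: "0 < \<alpha>" "0 < \<beta>" "\<epsilon> \<le> \<alpha>" "\<epsilon> \<le> \<beta>" using \<epsilon> by (auto simp: \<alpha>_def \<beta>_def)
  have "(\<epsilon>\<^sup>2 / 4) ^ r / 2 \<le> (\<epsilon>\<^sup>2 / 4) ^ r * (1 - 2 / \<alpha> * pexp K (\<lambda>_. pV) (\<lambda>a. \<bar>f a - \<alpha>\<bar>) - 2 / \<beta> * pexp K (\<lambda>_. pV) (\<lambda>a. \<bar>g a - \<beta>\<bar>))"
  proof -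
    have "2 / \<alpha> * pexp K (\<lambda>_. pV) (\<lambda>a. \<bar>f a - \<alpha>\<bar>) \<le> 2 / \<alpha> * (\<alpha> / 8)"
      "2 / \<beta> * pexp K (\<lambda>_. pV) (\<lambda>a. \<bar>g a - \<beta>\<bar>) \<le> 2 / \<beta> * (\<beta> / 8)"
      using df dg \<alpha>\<beta> by (intro mult_left_mono; simp)+
    moreover have "2 / \<alpha> * (\<alpha> / 8) = 1 / 4" "2 / \<beta> * (\<beta> / 8) = 1 / 4" using \<alpha>\<beta> by simp_all
    ultimately have "1 / 2 \<le> 1 - 2 / \<alpha> * pexp K (\<lambda>_. pV) (\<lambda>a. \<bar>f a - \<alpha>\<bar>) - 2 / \<beta> * pexp K (\<lambda>_. pV) (\<lambda>a. \<bar>g a - \<beta>\<bar>)"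
      by linarith
    from mult_left_mono[OF this, of "(\<epsilon>\<^sup>2 / 4) ^ r"] show ?thesis by simp
  qed
  also have "\<dots> = pexp2 K (\<lambda>_. \<pi>V) (\<lambda>a b. (\<epsilon>\<^sup>2 / 4) ^ r * (1 - 2 / \<alpha> * \<bar>f a - \<alpha>\<bar> - 2 / \<beta> * \<bar>g b - \<beta>\<bar>))"
    unfolding pexp2_cmult pexp2_diff
    using pexp2_fst[OF fK, of "\<lambda>_. \<pi>V" "\<lambda>_. pV"] pexp2_snd[OF fK, of "\<lambda>_. \<pi>V" "\<lambda>_. pV"] fK
    by (simp add: \<pi>V_fst \<pi>V_snd pexp_const pV_sum pexp_cmult)
  also have "\<dots> \<le> pexp2 K (\<lambda>_. \<pi>V) (\<lambda>a b. f a ^ r * g b ^ r)"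
    using fK \<pi>V_nonneg fg \<epsilon>(1) \<alpha>\<beta> by (intro pexp2_mono mult_power_lower) auto
  also have "\<dots> \<le> pexp2 K (\<lambda>_. \<pi>V) (\<lambda>a b. pexp2 (N - K) (\<lambda>_. \<pi>B)
      (\<lambda>x y. clip (P (override_on x a K)) ^ r * clip (Q (override_on y b K)) ^ r))"
    unfolding f_def g_def using fK fin \<pi>V_nonneg \<pi>B_nonneg pB_nonneg rh
    by (intro pexp2_mono reverse_hyper_prod) auto
  also have "\<dots> \<le> pexp2 K (\<lambda>_. \<pi>V) (\<lambda>a b. pexp2 (N - K) (\<lambda>_. \<pi>B)
      (\<lambda>x y. clip (P (override_on x a K)) * clip (Q (override_on y b K))))"
  proof -
    have "clip t ^ r \<le> clip t" for t using power_decreasing[OF r_pos, of "clip t"] by simp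
    then show ?thesis using fK fin \<pi>V_nonneg \<pi>B_nonneg by (intro pexp2_mono mult_mono) auto
  qed
  also have "\<dots> = pexp2 N (mixed2 K) (\<lambda>x y. clip (P x) * clip (Q y))"
    by (rule pexp2_mixed[OF fin K, symmetric])
  finally have main: "(\<epsilon>\<^sup>2 / 4) ^ r / 2 \<le> pexp2 N (mixed2 K) (\<lambda>x y. clip (P x) * clip (Q y))" .
  have P1: "pexp N (mixed K) (\<lambda>z. (Q z)\<^sup>2) \<le> 1"
    unfolding Q_def pexp_chaos_sq[OF fin mixed_orthonormal] by (rule cd1)
  have pt: "clip (P x) * clip (Q y) - P x * Q y
      \<le> ((1 / \<eta>) * (P x - clip (P x))\<^sup>2 + \<eta> * (Q y)\<^sup>2) / 2 + ((1 / \<eta>) * (Q y - clip (Q y))\<^sup>2 + \<eta> * 1) / 2" for x y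
  proof -
    \<comment> \<open>Weighted so that a squared clipping error \<eta>^2 and a squared norm 1 both
      contribute order \<eta>.\<close>
    have amgm: "- (u * v) \<le> ((1 / \<eta>) * u\<^sup>2 + \<eta> * v\<^sup>2) / 2" for u v
    proof -
      have "0 \<le> (1 / \<eta>) * (u + \<eta> * v)\<^sup>2" using \<eta> by simp
      also have "\<dots> = (1 / \<eta>) * u\<^sup>2 + \<eta> * v\<^sup>2 + 2 * (u * v)"
        using \<eta> by (simp add: power2_eq_square field_simps)
      finally show ?thesis by simp
    qed
    have "clip (P x) * clip (Q y) - P x * Q y = - ((P x - clip (P x)) * Q y) + - ((Q y - clip (Q y)) * clip (P x))"
      by (simp add: algebra_simps)
    also have "\<dots> \<le> ((1 / \<eta>) * (P x - clip (P x))\<^sup>2 + \<eta> * (Q y)\<^sup>2) / 2 + ((1 / \<eta>) * (Q y - clip (Q y))\<^sup>2 + \<eta> * (clip (P x))\<^sup>2) / 2"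
      by (intro add_mono amgm)
    also have "(clip (P x))\<^sup>2 \<le> 1" by (simp add: power_le_one)
    finally show ?thesis using \<eta> by (simp add: mult_left_mono divide_right_mono)
  qed
  have "pexp2 N (mixed2 K) (\<lambda>x y. clip (P x) * clip (Q y)) - pexp2 N (mixed2 K) (\<lambda>x y. P x * Q y)
     \<le> pexp2 N (mixed2 K) (\<lambda>x y. (1 / (2 * \<eta>)) * (P x - clip (P x))\<^sup>2 + (\<eta> / 2 * (Q y)\<^sup>2 + ((1 / (2 * \<eta>)) * (Q y - clip (Q y))\<^sup>2 + \<eta> / 2)))"
    unfolding pexp2_diff[symmetric]
  proof (intro pexp2_mono fin mixed2_nonneg)
    fix x y
    show "clip (P x) * clip (Q y) - P x * Q y \<le> (1 / (2 * \<eta>)) * (P x - clip (P x))\<^sup>2 + (\<eta> / 2 * (Q y)\<^sup>2 + ((1 / (2 * \<eta>)) * (Q y - clip (Q y))\<^sup>2 + \<eta> / 2))"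
      using pt[of x y] by (simp add: add_divide_distrib)
  qed
  also have "\<dots> = (1 / (2 * \<eta>)) * pexp N (mixed K) (\<lambda>z. (P z - clip (P z))\<^sup>2) + (\<eta> / 2 * pexp N (mixed K) (\<lambda>z. (Q z)\<^sup>2)
      + ((1 / (2 * \<eta>)) * pexp N (mixed K) (\<lambda>z. (Q z - clip (Q z))\<^sup>2) + \<eta> / 2))"
    unfolding pexp2_add pexp2_cmult
    using pexp2_fst[OF fin, of "mixed2 K" "mixed K"] pexp2_snd[OF fin, of "mixed2 K" "mixed K"] fin
    by (simp add: mixed2_fst mixed2_snd pexp_const mixed_sum)
  also have "\<dots> \<le> (1 / (2 * \<eta>)) * \<eta>\<^sup>2 + (\<eta> / 2 * 1 + ((1 / (2 * \<eta>)) * \<eta>\<^sup>2 + \<eta> / 2))"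
    using \<eta> eP eQ P1 by (intro add_mono mult_left_mono order_refl) auto
  also have "\<dots> = 2 * \<eta>" using \<eta> by (simp add: power2_eq_square)
  finally have "(\<epsilon>\<^sup>2 / 4) ^ r / 2 - 2 * \<eta> \<le> pexp2 N (mixed2 K) (\<lambda>x y. P x * Q y)" using main by linarith
  \<comment> \<open>Unclipped, the hybrid coupling gives the same value as the chain, since both are
    determined by \<open>lam\<close>.\<close>
  also have "\<dots> = pexp N (\<lambda>_. lam) (\<lambda>\<sigma>. c \<sigma> * d \<sigma>)"
    unfolding P_def Q_def by (intro pexp2_chaos fin mixed2_mom)
  finally show ?thesis
    using smoothing_error[OF fin \<theta>, of D F G] \<theta>D \<eta> F G unfolding c_def d_def by simp
qed

end

section \<open>Replacing states by correlated bits\<close>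

lemma sum_sum_type:
  fixes f :: "'a::finite + 'b::finite \<Rightarrow> real"
  shows "(\<Sum>w\<in>UNIV. f w) = (\<Sum>x\<in>UNIV. f (Inl x)) + (\<Sum>y\<in>UNIV. f (Inr y))"
  using sum.Plus[of UNIV UNIV f] by simp

lemma sum_UNIV_prod:
  fixes g :: "'k::finite \<Rightarrow> 'b::finite \<Rightarrow> real"
  shows "(\<Sum>u\<in>UNIV. \<Prod>i\<in>UNIV. g i (u i)) = (\<Prod>i\<in>UNIV. \<Sum>b\<in>UNIV. g i b)"
  using pexp_prod[of "UNIV :: 'k set" "\<lambda>_ _. 1" g] by (simp add: pexp_def)

locale spectral_chain =
  fixes A :: "real ^ 'v ^ 'v::finite" and \<mu> :: "real ^ 'v"
    and \<phi> :: "'v \<Rightarrow> 'v \<Rightarrow> real" and lam :: "'v \<Rightarrow> real" and e0 :: 'v and L :: real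
  assumes \<mu>_pos: "0 < \<mu> $ x" and \<mu>_sum: "(\<Sum>x\<in>UNIV. \<mu> $ x) = 1"
    and A_nonneg: "0 \<le> A $ x $ y" and A_sum: "(\<Sum>y\<in>UNIV. A $ x $ y) = 1"
    and balance: "\<mu> $ x * A $ x $ y = \<mu> $ y * A $ y $ x"
    and \<phi>_e0: "\<phi> e0 x = 1"
    and \<phi>_orthonormal: "(\<Sum>x\<in>UNIV. \<mu> $ x * (\<phi> k x * \<phi> l x)) = (if k = l then 1 else 0)"
    and \<phi>_complete: "(\<Sum>k\<in>UNIV. \<phi> k x * \<phi> k y * \<mu> $ y) = (if x = y then 1 else 0)"
    and \<phi>_eigen: "(\<Sum>y\<in>UNIV. A $ x $ y * \<phi> k y) = lam k * \<phi> k x"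
    and gap: "0 \<le> L" "L < 1" "k \<noteq> e0 \<Longrightarrow> \<bar>lam k\<bar> \<le> L"
begin

lemma lam_e0_eq: "lam e0 = 1"
  using \<phi>_eigen[of x e0 for x] by (simp add: \<phi>_e0 A_sum)

text \<open>
  Each eigenfunction but the constant one is replaced by a fair bit; the bits belonging to the
  eigenvalue \<open>\<lambda>\<close> on both sides have correlation \<open>\<lambda>\<close>. So all mixed second moments agree, but now every
  pair of bit vectors has positive probability.
\<close>

definition X :: "'v \<Rightarrow> 'v + ('v \<Rightarrow> bool) \<Rightarrow> real" where
  "X k w = (case w of Inl x \<Rightarrow> \<phi> k x | Inr u \<Rightarrow> if k = e0 then 1 else bit_sign (u k))"

text \<open>The sum type holds both sample spaces: \<open>pV\<close> lives on the left summand and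
  \<open>pB\<close> on the right one. Hybrid laws that mix them over the coordinates are then laws
  on one function space.\<close>

definition pV :: "'v + ('v \<Rightarrow> bool) \<Rightarrow> real" where
  "pV w = (case w of Inl x \<Rightarrow> \<mu> $ x | Inr u \<Rightarrow> 0)"

definition pB :: "'v + ('v \<Rightarrow> bool) \<Rightarrow> real" where
  "pB w = (case w of Inl x \<Rightarrow> 0 | Inr u \<Rightarrow> \<Prod>k\<in>(UNIV :: 'v set). 1 / 2)"

text \<open>The eigenvalue 1 at \<open>e0\<close> would tie the two bits together and destroy full
  support. As \<open>X e0\<close> is constant, correlation 0 is consistent with the required
  moments.\<close>

definition bit_corr :: "'v \<Rightarrow> real" where
  "bit_corr k = (if k = e0 then 0 else lam k)"

definition bit_pair :: "'v \<Rightarrow> bool \<Rightarrow> bool \<Rightarrow> real" where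
  "bit_pair k b c = (1 + bit_corr k * bit_sign b * bit_sign c) / 4"

definition \<pi>V :: "'v + ('v \<Rightarrow> bool) \<Rightarrow> 'v + ('v \<Rightarrow> bool) \<Rightarrow> real" where
  "\<pi>V w w' = (case w of Inl x \<Rightarrow> (case w' of Inl y \<Rightarrow> \<mu> $ x * A $ x $ y | Inr v \<Rightarrow> 0) | Inr u \<Rightarrow> 0)"

definition \<pi>B :: "'v + ('v \<Rightarrow> bool) \<Rightarrow> 'v + ('v \<Rightarrow> bool) \<Rightarrow> real" where
  "\<pi>B w w' = (case w of Inl x \<Rightarrow> 0 | Inr u \<Rightarrow> (case w' of Inl y \<Rightarrow> 0 | Inr v \<Rightarrow> \<Prod>k\<in>UNIV. bit_pair k (u k) (v k)))"

definition Bd :: real where "Bd = (\<Sum>w\<in>UNIV. \<Sum>k\<in>UNIV. (X k w)\<^sup>2)"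

text \<open>The least exponent that \<open>reverse_hyper_bit\<close> allows when all correlations
  are bounded by \<open>L\<close>.\<close>

definition r :: nat where "r = nat \<lceil>64 / (1 - L)\<^sup>2\<rceil>"

lemma bit_corr_le: "\<bar>bit_corr k\<bar> \<le> L"
  using gap by (simp add: bit_corr_def)

lemma bit_pair_nonneg: "0 \<le> bit_pair k b c"
  using bit_corr_le[of k] gap by (cases b; cases c) (auto simp: bit_pair_def bit_sign_def)

lemma bit_pair_sums:
  "(\<Sum>c\<in>UNIV. bit_pair k b c) = 1 / 2" "(\<Sum>b\<in>UNIV. bit_pair k b c) = 1 / 2"
  by (simp_all add: UNIV_bool bit_pair_def bit_sign_def field_simps)

text \<open>Makes each \<open>X k\<close> a product over all bits, so that moments factor over the
  bits.\<close>

definition factor :: "'v \<Rightarrow> 'v \<Rightarrow> bool \<Rightarrow> real" where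
  "factor k i b = (if i = k \<and> k \<noteq> e0 then bit_sign b else 1)"

lemma X_Inr: "X k (Inr u) = (\<Prod>i\<in>UNIV. factor k i (u i))"
proof (cases "k = e0")
  case False
  have "(\<Prod>i\<in>UNIV. factor k i (u i)) = (\<Prod>i\<in>UNIV. if i = k then bit_sign (u i) else 1)"
    using False by (intro prod.cong) (auto simp: factor_def)
  then show ?thesis using False by (simp add: X_def)
qed (simp add: X_def factor_def)

lemma prod_pair_eq:
  fixes h :: "'v \<Rightarrow> real"
  assumes "\<And>i. i \<noteq> k \<Longrightarrow> i \<noteq> l \<Longrightarrow> h i = 1" "k = l \<Longrightarrow> h k = z" "k \<noteq> l \<Longrightarrow> k \<noteq> e0 \<Longrightarrow> h k = 0" "k \<noteq> l \<Longrightarrow> l \<noteq> e0 \<Longrightarrow> h l = 0"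
  shows "(\<Prod>i\<in>UNIV. h i) = (if k = l then z else 0)"
proof (cases "k = l")
  case True
  have "(\<Prod>i\<in>UNIV. h i) = (\<Prod>i\<in>UNIV. if i = k then z else 1)"
    using assms(1,2) True by (intro prod.cong) auto
  then show ?thesis using True by simp
next
  case False
  then have "h k = 0 \<or> h l = 0" using assms(3,4) by metis
  then have "\<exists>i\<in>UNIV. h i = 0" by blast
  then show ?thesis using False by (simp add: prod_zero)
qed

sublocale ensemble X e0 Bd
proof
  show "X e0 w = 1" for w by (cases w) (auto simp: X_def \<phi>_e0)
  show "(\<Sum>k\<in>UNIV. (X k w)\<^sup>2) \<le> Bd" for w
    unfolding Bd_def by (rule member_le_sum[of w UNIV "\<lambda>w. \<Sum>k\<in>UNIV. (X k w)\<^sup>2"]) (auto intro: sum_nonneg)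
qed

lemma pB_X: "(\<Sum>w\<in>UNIV. pB w * (X k w * X l w)) = (if k = l then 1 else 0)"
proof -
  have "(\<Sum>w\<in>UNIV. pB w * (X k w * X l w)) = (\<Sum>u\<in>UNIV. \<Prod>i\<in>UNIV. 1 / 2 * (factor k i (u i) * factor l i (u i)))"
    unfolding prod.distrib by (simp add: sum_sum_type pB_def X_Inr)
  also have "\<dots> = (\<Prod>i\<in>UNIV. \<Sum>b\<in>UNIV. 1 / 2 * (factor k i b * factor l i b))"
    by (rule sum_UNIV_prod)
  also have "\<dots> = (if k = l then 1 else 0)"
    by (rule prod_pair_eq) (auto simp: UNIV_bool factor_def bit_sign_def)
  finally show ?thesis .
qed

lemma \<pi>B_sum: "(\<Sum>w\<in>UNIV. \<Sum>w'\<in>UNIV. \<pi>B w w' * f w w')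
   = pexp2 UNIV bit_pair (\<lambda>u v. f (Inr u) (Inr v))"
proof -
  have "pexp2 UNIV bit_pair (\<lambda>u v. f (Inr u) (Inr v))
      = pexp2 UNIV (\<lambda>i u v. (\<lambda>_ _. 1) i u * bit_pair i u v) (\<lambda>u v. f (Inr u) (Inr v))" by simp
  also have "\<dots> = (\<Sum>u\<in>UNIV. \<Sum>v\<in>UNIV. (\<Prod>k\<in>UNIV. bit_pair k (u k) (v k)) * f (Inr u) (Inr v))"
    by (subst pexp2_kernel) (simp_all add: pexp_def)
  finally show ?thesis by (simp add: sum_sum_type \<pi>B_def)
qed

lemma pB_sum_eq: "(\<Sum>w\<in>UNIV. pB w * f w) = pexp UNIV (\<lambda>_ _. 1 / 2) (\<lambda>u. f (Inr u))"
  by (simp add: sum_sum_type pB_def pexp_def)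

lemma \<pi>B_X: "(\<Sum>w\<in>UNIV. \<Sum>w'\<in>UNIV. \<pi>B w w' * (X k w * X l w')) = (if k = l then lam k else 0)"
proof -
  have "(\<Sum>w\<in>UNIV. \<Sum>w'\<in>UNIV. \<pi>B w w' * (X k w * X l w'))
      = pexp2 UNIV bit_pair (\<lambda>u v. \<Prod>i\<in>UNIV. factor k i (u i) * factor l i (v i))"
    by (simp add: \<pi>B_sum X_Inr prod.distrib)
  also have "\<dots> = (\<Prod>i\<in>UNIV. \<Sum>b\<in>UNIV. \<Sum>c\<in>UNIV. bit_pair i b c * (factor k i b * factor l i c))"
    using pexp2_prod[of UNIV bit_pair "\<lambda>i b c. factor k i b * factor l i c"] by simp
  also have "\<dots> = (if k = l then lam k else 0)"
    by (rule prod_pair_eq) (auto simp: UNIV_bool factor_def bit_sign_def bit_pair_def bit_corr_def lam_e0_eq field_simps)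
  finally show ?thesis .
qed

lemma r_ge: "64 \<le> real r * (1 - L)\<^sup>2" and r_ge_1: "1 \<le> r"
proof -
  have "64 / (1 - L)\<^sup>2 \<le> real r" unfolding r_def by linarith
  then show "64 \<le> real r * (1 - L)\<^sup>2" using gap by (simp add: divide_le_eq)
  then show "1 \<le> r" by (cases r) auto
qed

lemma \<pi>B_reverse_hyper: "reverse_hyper \<pi>B pB r"
  unfolding reverse_hyper_def pB_sum_eq \<pi>B_sum
proof (intro allI impI)
  fix f g :: "'v + ('v \<Rightarrow> bool) \<Rightarrow> real" assume "\<forall>w. 0 \<le> f w" "\<forall>w. 0 \<le> g w"
  moreover have "reverse_hyper (bit_pair k) (\<lambda>_. 1 / 2) r" for k
    using reverse_hyper_bit[OF gap(1,2) bit_corr_le r_ge, of k] unfolding bit_pair_def .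
  ultimately show "pexp UNIV (\<lambda>_ _. 1 / 2) (\<lambda>u. f (Inr u)) ^ r * pexp UNIV (\<lambda>_ _. 1 / 2) (\<lambda>u. g (Inr u)) ^ r
      \<le> pexp2 UNIV bit_pair (\<lambda>u v. f (Inr u) ^ r * g (Inr v) ^ r)"
    by (intro reverse_hyper_prod) (auto simp: bit_pair_nonneg)
qed

sublocale coupled_ensemble X e0 Bd pV pB \<pi>V \<pi>B lam L r
proof
  show "orthonormal pV"
    using \<mu>_pos by (auto simp: orthonormal_def sum_sum_type pV_def X_def \<phi>_orthonormal less_imp_le split: sum.split)
  show "orthonormal pB"
    unfolding orthonormal_def pB_X by (auto simp: pB_def prod_nonneg split: sum.split)
  show "0 \<le> \<pi>V w w'" for w w'
    using \<mu>_pos A_nonneg by (auto simp: \<pi>V_def less_imp_le split: sum.split)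
  show "0 \<le> \<pi>B w w'" for w w'
    by (auto simp: \<pi>B_def prod_nonneg bit_pair_nonneg split: sum.split)
  show "(\<Sum>w'\<in>UNIV. \<pi>V w w') = pV w" for w
    by (cases w) (simp_all add: sum_sum_type \<pi>V_def pV_def A_sum flip: sum_distrib_left)
  show "(\<Sum>w\<in>UNIV. \<pi>V w w') = pV w'" for w'
    by (cases w') (simp_all add: sum_sum_type \<pi>V_def pV_def balance[of _ x for x] A_sum flip: sum_distrib_left)
  show "(\<Sum>w'\<in>UNIV. \<pi>B w w') = pB w" for w
    by (cases w) (simp_all add: sum_sum_type \<pi>B_def pB_def sum_UNIV_prod[of "\<lambda>k c. bit_pair k (u k) c" for u] bit_pair_sums)
  show "(\<Sum>w\<in>UNIV. \<pi>B w w') = pB w'" for w'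
    by (cases w') (simp_all add: sum_sum_type \<pi>B_def pB_def sum_UNIV_prod[of "\<lambda>k b. bit_pair k b (v k)" for v] bit_pair_sums)
  show "(\<Sum>w\<in>UNIV. \<Sum>w'\<in>UNIV. \<pi>V w w' * (X k w * X l w')) = (if k = l then lam k else 0)" for k l
  proof -
    have "(\<Sum>w\<in>UNIV. \<Sum>w'\<in>UNIV. \<pi>V w w' * (X k w * X l w'))
        = (\<Sum>x\<in>UNIV. \<mu> $ x * \<phi> k x * (\<Sum>y\<in>UNIV. A $ x $ y * \<phi> l y))"
      by (simp add: sum_sum_type \<pi>V_def X_def sum_distrib_left mult_ac)
    also have "\<dots> = lam l * (\<Sum>x\<in>UNIV. \<mu> $ x * (\<phi> k x * \<phi> l x))"
      unfolding \<phi>_eigen by (simp add: sum_distrib_left mult_ac)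
    finally show ?thesis by (simp add: \<phi>_orthonormal)
  qed
  show "(\<Sum>k\<in>UNIV. X k w * X k w' * pV w') = (if w = w' then 1 else 0)" if "pV w \<noteq> 0" for w w'
    using that \<phi>_complete by (cases w; cases w') (auto simp: X_def pV_def)
qed (use gap \<pi>B_X \<pi>B_reverse_hyper r_ge_1 in auto)

lemma pexp_Inl: "finite N \<Longrightarrow> pexp N (\<lambda>_. pV) H = pexp N (\<lambda>_. ($) \<mu>) (\<lambda>x. H (restrict (\<lambda>i. Inl (x i)) N))"
  by (rule pexp_push) (auto simp: sum_sum_type pV_def)

lemma pexp2_Inl: "finite N \<Longrightarrow> pexp2 N (\<lambda>_. \<pi>V) H = pexp2 N (\<lambda>_ u v. \<mu> $ u * A $ u $ v)
    (\<lambda>x y. H (restrict (\<lambda>i. Inl (x i)) N) (restrict (\<lambda>i. Inl (y i)) N))"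
  by (rule pexp2_push) (auto simp: sum_sum_type \<pi>V_def)

end

section \<open>Choice of the parameters\<close>

lemma power_half_le: "(1 - 1 / 2 ^ t :: real) ^ (k * 2 ^ t) \<le> 1 / 2 ^ k"
proof -
  have e: "exp (- 1) \<le> (1 / 2 :: real)"
    using exp_ge_add_one_self[of 1] by (simp add: exp_minus field_simps)
  have "(1 - 1 / 2 ^ t :: real) \<le> exp (- (1 / 2 ^ t))" using exp_ge_add_one_self[of "- (1 / 2 ^ t)"] by simp
  then have "(1 - 1 / 2 ^ t :: real) ^ 2 ^ t \<le> exp (- (1 / 2 ^ t)) ^ 2 ^ t" by (intro power_mono) auto
  also have "\<dots> = exp (- 1)" by (simp flip: exp_of_nat_mult)
  finally have "(1 - 1 / 2 ^ t :: real) ^ 2 ^ t \<le> 1 / 2" using e by linarith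
  then have "((1 - 1 / 2 ^ t :: real) ^ 2 ^ t) ^ k \<le> (1 / 2) ^ k" by (intro power_mono) auto
  then show ?thesis by (simp add: power_divide mult.commute flip: power_mult)
qed

lemma ex_power2_ge: "\<exists>q. (z::real) \<le> 2 ^ q"
  using real_arch_pow[of 2 z] by (auto intro: less_imp_le)

text \<open>All parameters are packed into one integer: densities 2^-m, an inner product
  polynomially small in 2^-m, and \<open>K\<close> of size doubly exponential in m. One exponential
  comes from the degree, roughly the inverse of the error level, the other from the hypercontractive
  constant, exponential in the degree. With m + 1 in place of m, \<open>c\<close> absorbs additive
  constants also at m = 0.\<close>

definition junta_constant :: "('w::finite \<Rightarrow> real) \<Rightarrow> ('w \<Rightarrow> 'w \<Rightarrow> real) \<Rightarrow> nat \<Rightarrow> bool" where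
  "junta_constant p \<pi> c \<longleftrightarrow> (\<forall>m (N :: nat set) F G. finite N \<longrightarrow>
      (\<forall>x. 0 \<le> F x \<and> F x \<le> 1) \<longrightarrow> (\<forall>x. 0 \<le> G x \<and> G x \<le> 1) \<longrightarrow>
      1 / 2 ^ m \<le> pexp N (\<lambda>_. p) F \<longrightarrow> 1 / 2 ^ m \<le> pexp N (\<lambda>_. p) G \<longrightarrow>
      pexp2 N (\<lambda>_. \<pi>) (\<lambda>x y. F x * G y) \<le> 1 / 2 ^ (c * (m + 1)) \<longrightarrow>
      (\<exists>K\<subseteq>N. card K \<le> 2 ^ 2 ^ (c * (m + 1)) \<and>
        (pexp N (\<lambda>_. p) F / 16 \<le> deviation p N K F \<or> pexp N (\<lambda>_. p) G / 16 \<le> deviation p N K G)))"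

context spectral_chain
begin

text \<open>
  The numerical choices behind \<open>dichotomy\<close>: everything is a power of two, the error level
  \<open>2 ^ - h\<close> is polynomial in \<open>2 ^ - m\<close>, and the degree cut-off \<open>D\<close> enters \<open>s\<close> exponentially.
\<close>

lemma junta_constant_embedded: "\<exists>c. junta_constant pV \<pi>V c"
proof -
  obtain l where l: "1 / (1 - L) \<le> 2 ^ l" using ex_power2_ge by blast
  have l': "1 / 2 ^ l \<le> 1 - L" using l gap by (simp add: field_simps)
  obtain q where q: "3 * Bd \<le> 2 ^ q" using ex_power2_ge by blast
  have q1: "2 \<le> (2::real) ^ q" using q Bd_ge_1 by linarith
  define b :: real where "b = 1 / 2 ^ q"
  have b: "0 < b" "4 * b\<^sup>2 \<le> 1" "3 * b ^ 4 * Bd \<le> 1"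
  proof -
    show "0 < b" by (simp add: b_def)
    have b2: "b \<le> 1 / 2" using q1 by (simp add: b_def field_simps)
    then have "b\<^sup>2 \<le> (1 / 2)\<^sup>2" using \<open>0 < b\<close> by (intro power_mono) auto
    then show "4 * b\<^sup>2 \<le> 1" by (simp add: power2_eq_square)
    have "b ^ 4 \<le> b ^ 1" using b2 \<open>0 < b\<close> by (intro power_decreasing) auto
    then have "3 * b ^ 4 * Bd \<le> b * (3 * Bd)" using Bd_ge_1 by (simp add: mult_right_mono)
    also have "\<dots> \<le> b * 2 ^ q" using q \<open>0 < b\<close> by (intro mult_left_mono) auto
    finally show "3 * b ^ 4 * Bd \<le> 1" by (simp add: b_def)
  qed
  define c where "c = 4 * r + 10 * q + l + 40"
  have "junta_constant pV \<pi>V c"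
    unfolding junta_constant_def
  proof (intro allI impI)
    fix m and N :: "nat set" and F G :: "(nat \<Rightarrow> 'v + ('v \<Rightarrow> bool)) \<Rightarrow> real"
    assume fin: "finite N" and F: "\<forall>x. 0 \<le> F x \<and> F x \<le> 1" and G: "\<forall>x. 0 \<le> G x \<and> G x \<le> 1"
      and m: "1 / 2 ^ m \<le> pexp N (\<lambda>_. pV) F" "1 / 2 ^ m \<le> pexp N (\<lambda>_. pV) G"
      and small: "pexp2 N (\<lambda>_. \<pi>V) (\<lambda>x y. F x * G y) \<le> 1 / 2 ^ (c * (m + 1))"
    \<comment> \<open>For density 2^-m the main term is 2^-a / 2. \<open>h\<close> makes 3 \<eta> a
      small part of it and 32 \<eta> at most 2^-m; \<open>t\<close> makes 2 (1 - \<theta>) equal to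
      \<eta> / 2^l; \<open>D\<close> gives \<theta>^D <= \<eta> / 4 by \<open>power_half_le\<close>;
      \<open>u\<close> collects the factors that \<open>s\<close> has to beat, namely b^(-4 D),
      \<open>Bd\<close>, \<open>D\<close> and \<eta>^(-3).\<close>
    define a where "a = (2 * m + 2) * r"
    define h where "h = a + 5 + m"
    define \<eta> :: real where "\<eta> = 1 / 2 ^ h"
    define t where "t = h + l + 1"
    define \<theta> :: real where "\<theta> = 1 - 1 / 2 ^ t"
    define D where "D = (h + 2) * 2 ^ t"
    define u where "u = 3 * h + 6 + q + 4 * q * D + D"
    define s :: real where "s = 1 / 2 ^ u"
    have \<eta>: "0 < \<eta>" "32 * \<eta> \<le> 1 / 2 ^ m"
      by (simp_all add: \<eta>_def h_def power_add field_simps)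
    have \<theta>: "0 < \<theta>" "\<theta> \<le> 1" "L \<le> \<theta>" "2 * (1 - \<theta>) \<le> \<eta> * (1 - L)"
    proof -
      have "(2::real) ^ 1 \<le> 2 ^ t" by (intro power_increasing) (auto simp: t_def)
      then show "0 < \<theta>" by (simp add: \<theta>_def field_simps)
      show "\<theta> \<le> 1" by (simp add: \<theta>_def)
      have "2 * (1 - \<theta>) = \<eta> * (1 / 2 ^ l)" by (simp add: \<theta>_def t_def \<eta>_def power_add)
      also have "\<dots> \<le> \<eta> * (1 - L)" using l' \<eta> by (intro mult_left_mono) auto
      finally show "2 * (1 - \<theta>) \<le> \<eta> * (1 - L)" .
      have "(2::real) ^ l \<le> 2 ^ t" by (intro power_increasing) (auto simp: t_def)
      then have "1 / 2 ^ t \<le> (1 / 2 ^ l :: real)" by (intro divide_left_mono) auto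
      then show "L \<le> \<theta>" using l' by (simp add: \<theta>_def)
    qed
    have \<theta>D: "\<theta> ^ D \<le> \<eta> / 4"
      using power_half_le[of t "h + 2"] by (simp add: \<theta>_def D_def \<eta>_def power_add)
    have D2: "real D \<le> 2 ^ D" by (simp add: less_imp_le of_nat_less_two_power)
    have s: "0 < s" by (simp add: s_def)
    have sb: "4 * s * (1 + Bd * ((1 / b) ^ (2 * D))\<^sup>2) * real D \<le> \<eta> ^ 3 / 8"
    proof -
      have C: "((1 / b) ^ (2 * D))\<^sup>2 = 2 ^ (4 * q * D)"
        by (simp add: b_def mult_ac flip: power_mult)
      have "1 + Bd * ((1 / b) ^ (2 * D))\<^sup>2 \<le> 2 ^ q * 2 ^ (4 * q * D)"
      proof -
        have "1 \<le> (2::real) ^ (4 * q * D)" by simp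
        then have "1 + Bd * 2 ^ (4 * q * D) \<le> (1 + Bd) * 2 ^ (4 * q * D)" by (simp add: distrib_right)
        also have "\<dots> \<le> 2 ^ q * 2 ^ (4 * q * D)" using q Bd_ge_1 by (intro mult_right_mono) auto
        finally show ?thesis by (simp only: C)
      qed
      then have "4 * s * (1 + Bd * ((1 / b) ^ (2 * D))\<^sup>2) * real D \<le> 4 * s * (2 ^ q * 2 ^ (4 * q * D)) * 2 ^ D"
        using s D2 Bd_ge_1 by (intro mult_mono) (auto intro!: mult_nonneg_nonneg)
      also have "\<dots> = \<eta> ^ 3 / 16"
        by (simp add: s_def u_def \<eta>_def power_add power_divide field_simps flip: power_mult)
      also have "\<dots> \<le> \<eta> ^ 3 / 8" using \<eta> by simp
      finally show ?thesis .
    qed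
    have large: "1 / 2 ^ (c * (m + 1)) < ((1 / 2 ^ m)\<^sup>2 / 4) ^ r / 2 - 3 * \<eta>"
    proof -
      have "(1 / 2 ^ m)\<^sup>2 / 4 = (1 / 2 ^ (2 * m + 2) :: real)"
        by (simp add: power_divide power_add mult.commute flip: power_mult)
      then have "((1 / 2 ^ m)\<^sup>2 / 4) ^ r = (1 / 2 ^ a :: real)"
        by (simp only: a_def power_divide power_one power_mult)
      moreover have "3 * \<eta> \<le> 3 / 32 * (1 / 2 ^ a)"
        by (simp add: \<eta>_def h_def power_add field_simps)
      moreover have "1 / 2 ^ (c * (m + 1)) \<le> (1 / 2 ^ (a + 2) :: real)"
        by (intro divide_left_mono power_increasing) (auto simp: a_def c_def algebra_simps)
      then have "1 / 2 ^ (c * (m + 1)) \<le> 1 / 4 * (1 / 2 ^ a :: real)" by (simp add: power_add)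
      moreover have "0 < (1 / 2 ^ a :: real)" by simp
      ultimately show ?thesis by linarith
    qed
    have "\<not> (\<forall>K\<subseteq>N. real (card K) * s\<^sup>2 \<le> 2 * real D \<longrightarrow>
        deviation pV N K F < pexp N (\<lambda>_. pV) F / 16 \<and> deviation pV N K G < pexp N (\<lambda>_. pV) G / 16)"
    proof
      assume "\<forall>K\<subseteq>N. real (card K) * s\<^sup>2 \<le> 2 * real D \<longrightarrow>
        deviation pV N K F < pexp N (\<lambda>_. pV) F / 16 \<and> deviation pV N K G < pexp N (\<lambda>_. pV) G / 16"
      then have "((1 / 2 ^ m)\<^sup>2 / 4) ^ r / 2 - 3 * \<eta> \<le> pexp2 N (\<lambda>_. \<pi>V) (\<lambda>x y. F x * G y)"
        using m F G by (intro dichotomy[OF fin _ _ _ _ _ _ _ \<theta> \<theta>D b s \<eta> sb]) auto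
      then show False using small large by linarith
    qed
    then obtain K where K: "K \<subseteq> N" "real (card K) * s\<^sup>2 \<le> 2 * real D"
      "pexp N (\<lambda>_. pV) F / 16 \<le> deviation pV N K F \<or> pexp N (\<lambda>_. pV) G / 16 \<le> deviation pV N K G"
      by (auto simp: not_less)
    have "card K \<le> 2 ^ 2 ^ (c * (m + 1))"
    proof -
      have ss: "s\<^sup>2 * 2 ^ (2 * u) = 1" by (simp add: s_def power_divide mult.commute flip: power_mult)
      have "real (card K) = real (card K) * s\<^sup>2 * 2 ^ (2 * u)" by (simp add: mult.assoc ss)
      also have "\<dots> \<le> 2 * real D * 2 ^ (2 * u)" using K(2) by (intro mult_right_mono) auto
      also have "\<dots> \<le> 2 * 2 ^ D * 2 ^ (2 * u)" using D2 by (intro mult_right_mono mult_left_mono) auto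
      also have "\<dots> = 2 ^ (1 + D + 2 * u)" by (simp add: power_add)
      finally have "real (card K) \<le> real (2 ^ (1 + D + 2 * u))" by (simp only: of_nat_power of_nat_numeral)
      then have "card K \<le> 2 ^ (1 + D + 2 * u)" by (simp only: of_nat_le_iff)
      also have "(2::nat) ^ (1 + D + 2 * u) \<le> 2 ^ 2 ^ (c * (m + 1))"
      proof (intro power_increasing)
        define W where "W = (2::nat) ^ (2 * (h + 2) + l)"
        have "D \<le> 2 ^ (h + 2) * 2 ^ t" unfolding D_def by (intro mult_right_mono less_imp_le[OF less_exp]) simp
        also have "\<dots> = 2 ^ (h + 2 + t)" by (simp add: power_add)
        also have "\<dots> \<le> W" unfolding W_def by (intro power_increasing) (auto simp: t_def)
        finally have DW: "D \<le> W" .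
        have "h \<le> 2 ^ h" by (simp add: less_imp_le)
        also have "\<dots> \<le> W" unfolding W_def by (intro power_increasing) auto
        finally have hW: "h \<le> W" .
        have W1: "1 \<le> W" by (simp add: W_def)
        have "1 + D + 2 * u = 13 + 6 * h + 2 * q + (8 * q + 3) * D" by (simp add: u_def algebra_simps)
        also have "\<dots> \<le> 13 * W + 6 * W + 2 * q * W + (8 * q + 3) * W"
          using DW hW W1 by (intro add_mono mult_left_mono) auto
        also have "\<dots> = (22 + 10 * q) * W" by (simp add: algebra_simps)
        also have "\<dots> \<le> 2 ^ (22 + 10 * q) * W" by (intro mult_right_mono less_imp_le[OF less_exp]) simp
        also have "\<dots> = 2 ^ (22 + 10 * q + (2 * (h + 2) + l))" by (simp only: W_def power_add)
        also have "\<dots> \<le> 2 ^ (c * (m + 1))"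
          by (intro power_increasing) (auto simp: c_def h_def a_def algebra_simps)
        finally show "1 + D + 2 * u \<le> 2 ^ (c * (m + 1))" .
      qed simp
      finally show ?thesis .
    qed
    then show "\<exists>K\<subseteq>N. card K \<le> 2 ^ 2 ^ (c * (m + 1)) \<and>
        (pexp N (\<lambda>_. pV) F / 16 \<le> deviation pV N K F \<or> pexp N (\<lambda>_. pV) G / 16 \<le> deviation pV N K G)"
      using K by blast
  qed
  then show ?thesis ..
qed

text \<open>\<open>projl\<close> is arbitrary on bit vectors, but \<open>pV\<close> gives them
  weight 0, so expectations, inner products and deviations of the lifted functions are those of the
  chain.\<close>

lemma junta_constant_exists: "\<exists>c. junta_constant (($) \<mu>) (\<lambda>u v. \<mu> $ u * A $ u $ v) c"
proof -
  obtain c where c: "junta_constant pV \<pi>V c" using junta_constant_embedded by blast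
  have "junta_constant (($) \<mu>) (\<lambda>u v. \<mu> $ u * A $ u $ v) c"
    unfolding junta_constant_def
  proof (intro allI impI)
    fix m and N :: "nat set" and F G :: "(nat \<Rightarrow> 'v) \<Rightarrow> real"
    assume fin: "finite N" and F: "\<forall>x. 0 \<le> F x \<and> F x \<le> 1"
      and G: "\<forall>x. 0 \<le> G x \<and> G x \<le> 1"
      and m: "1 / 2 ^ m \<le> pexp N (\<lambda>_. ($) \<mu>) F" "1 / 2 ^ m \<le> pexp N (\<lambda>_. ($) \<mu>) G"
      and small: "pexp2 N (\<lambda>_ u v. \<mu> $ u * A $ u $ v) (\<lambda>x y. F x * G y) \<le> 1 / 2 ^ (c * (m + 1))"
    define lift where "lift F z = F (restrict (\<lambda>i. projl (z i)) N)" for F :: "(nat \<Rightarrow> 'v) \<Rightarrow> real" and z :: "nat \<Rightarrow> 'v + ('v \<Rightarrow> bool)"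
    have b: "\<forall>z. 0 \<le> lift F z \<and> lift F z \<le> 1" "\<forall>z. 0 \<le> lift G z \<and> lift G z \<le> 1"
      using F G by (auto simp: lift_def)
    have eq: "restrict (\<lambda>i. projl (restrict (\<lambda>i. Inl (x i)) N i)) N = x" if "x \<in> N \<rightarrow>\<^sub>E UNIV" for x :: "nat \<Rightarrow> 'v"
      using that by (auto simp: fun_eq_iff restrict_def PiE_iff extensional_def)
    have E: "pexp N (\<lambda>_. pV) (lift F) = pexp N (\<lambda>_. ($) \<mu>) F" for F
      unfolding pexp_Inl[OF fin] lift_def by (intro pexp_cong fin refl) (simp only: eq)
    have E2: "pexp2 N (\<lambda>_. \<pi>V) (\<lambda>x y. lift F x * lift G y) = pexp2 N (\<lambda>_ u v. \<mu> $ u * A $ u $ v) (\<lambda>x y. F x * G y)"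
      unfolding pexp2_Inl[OF fin] lift_def by (intro pexp2_cong fin refl) (simp only: eq)
    have dev: "deviation pV N K (lift F) = deviation (($) \<mu>) N K F"
      if K: "K \<subseteq> N" for K F
    proof -
      have fK: "finite K" "finite (N - K)" using K fin finite_subset by auto
      have eqK: "restrict (\<lambda>i. projl (override_on (restrict (\<lambda>i. Inl (y i)) (N - K)) (restrict (\<lambda>i. Inl (a i)) K) K i)) N
          = override_on y a K" if "y \<in> N - K \<rightarrow>\<^sub>E UNIV" for y a :: "nat \<Rightarrow> 'v"
        using that K by (auto simp: fun_eq_iff restrict_def override_on_def PiE_iff extensional_def)
      have "pexp (N - K) (\<lambda>_. pV) (\<lambda>y. lift F (override_on y (restrict (\<lambda>i. Inl (a i)) K) K))
          = pexp (N - K) (\<lambda>_. ($) \<mu>) (\<lambda>y. F (override_on y a K))" for a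
        unfolding pexp_Inl[OF fK(2)] lift_def by (intro pexp_cong fK refl) (simp only: eqK)
      then show ?thesis unfolding deviation_def E pexp_Inl[OF fK(1)] by simp
    qed
    obtain K where "K \<subseteq> N" "card K \<le> 2 ^ 2 ^ (c * (m + 1))"
      "pexp N (\<lambda>_. pV) (lift F) / 16 \<le> deviation pV N K (lift F) \<or> pexp N (\<lambda>_. pV) (lift G) / 16 \<le> deviation pV N K (lift G)"
      using c[unfolded junta_constant_def, rule_format, of N "lift F" "lift G" m] fin b m small unfolding E E2 by auto
    then show "\<exists>K\<subseteq>N. card K \<le> 2 ^ 2 ^ (c * (m + 1)) \<and>
        (pexp N (\<lambda>_. ($) \<mu>) F / 16 \<le> deviation (($) \<mu>) N K F \<or> pexp N (\<lambda>_. ($) \<mu>) G / 16 \<le> deviation (($) \<mu>) N K G)"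
      unfolding E by (intro exI[of _ K]) (auto simp: dev)
  qed
  then show ?thesis ..
qed

end

section \<open>Entropy increment\<close>

text \<open>The product form has value 0 at 0, which is the convention 0 ln 0 = 0.\<close>

definition xlnx :: "real \<Rightarrow> real" where "xlnx t = t * ln t"

text \<open>Convexity in tangent form, from ln z <= z - 1 at z = \<alpha> / t.\<close>

lemma xlnx_tangent:
  assumes "0 \<le> t" "0 < \<alpha>" shows "xlnx \<alpha> + (1 + ln \<alpha>) * (t - \<alpha>) \<le> xlnx t"
proof (cases "t = 0")
  case False
  then have t: "0 < t" using assms by simp
  have "ln (\<alpha> / t) \<le> \<alpha> / t - 1" using t assms by (intro ln_le_minus_one) auto
  then have "t * (ln \<alpha> - ln t) \<le> t * (\<alpha> / t - 1)"
    using t assms by (intro mult_left_mono) (auto simp: ln_div)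
  also have "t * (\<alpha> / t - 1) = \<alpha> - t" using t by (simp add: right_diff_distrib)
  finally show ?thesis by (simp add: xlnx_def algebra_simps)
qed (use assms in \<open>simp add: xlnx_def algebra_simps\<close>)

text \<open>
  The tangent at \<open>\<alpha> (1 - 1 / 128)\<close> improves the tangent at \<open>\<alpha>\<close> on most of \<open>[0, \<alpha>]\<close>.
\<close>

lemma xlnx_tangent_gain:
  assumes "0 \<le> t" "0 < \<alpha>"
  shows "xlnx \<alpha> + (1 + ln \<alpha>) * (t - \<alpha>) + (- ln (127 / 128)) * ((\<bar>t - \<alpha>\<bar> - (t - \<alpha>)) / 2) - \<alpha> * (- ln (127 / 128) - 1 / 128) \<le> xlnx t"
proof (cases "t \<le> \<alpha>")
  case True
  have "xlnx (\<alpha> * (127 / 128)) + (1 + ln (\<alpha> * (127 / 128))) * (t - \<alpha> * (127 / 128)) \<le> xlnx t"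
    using assms by (intro xlnx_tangent) auto
  moreover have "ln (\<alpha> * (127 / 128)) = ln \<alpha> + ln (127 / 128)" using assms by (intro ln_mult_pos) auto
  moreover have e: "(\<bar>t - \<alpha>\<bar> - (t - \<alpha>)) / 2 = \<alpha> - t" using True by simp
  ultimately show ?thesis unfolding e by (simp add: xlnx_def algebra_simps)
next
  case False
  have "ln (127 / 128) \<le> 127 / 128 - (1 :: real)" by (intro ln_le_minus_one) auto
  then have "0 \<le> \<alpha> * (- ln (127 / 128) - 1 / 128)" using assms by (intro mult_nonneg_nonneg) auto
  moreover have "\<bar>t - \<alpha>\<bar> - (t - \<alpha>) = 0" using False by simp
  ultimately show ?thesis using xlnx_tangent[OF assms] by simp
qed

locale prob_weights =
  fixes p :: "'w::finite \<Rightarrow> real"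
  assumes p_nonneg: "0 \<le> p w" and p_sum: "(\<Sum>w\<in>UNIV. p w) = 1"
begin

definition ent :: "'i set \<Rightarrow> 'i set \<Rightarrow> (('i \<Rightarrow> 'w) \<Rightarrow> real) \<Rightarrow> real" where
  "ent N J F = pexp J (\<lambda>_. p) (\<lambda>x. xlnx (pexp (N - J) (\<lambda>_. p) (\<lambda>y. F (override_on y x J))))"

lemma pexp_p_nonneg: "finite N \<Longrightarrow> (\<And>x. 0 \<le> F x) \<Longrightarrow> 0 \<le> pexp N (\<lambda>_. p) F"
  using p_nonneg by (intro pexp_nonneg) auto

lemma jensen_xlnx:
  assumes fin: "finite J" and d: "\<And>x. 0 \<le> d x"
  shows "xlnx (pexp J (\<lambda>_. p) d) \<le> pexp J (\<lambda>_. p) (\<lambda>x. xlnx (d x))"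
proof -
  let ?\<alpha> = "pexp J (\<lambda>_. p) d"
  have tan: "xlnx \<beta> + (1 + ln \<beta>) * (?\<alpha> - \<beta>) \<le> pexp J (\<lambda>_. p) (\<lambda>x. xlnx (d x))" if "0 < \<beta>" for \<beta>
  proof -
    have "pexp J (\<lambda>_. p) (\<lambda>x. xlnx \<beta> + (1 + ln \<beta>) * (d x - \<beta>)) \<le> pexp J (\<lambda>_. p) (\<lambda>x. xlnx (d x))"
      using fin p_nonneg d that by (intro pexp_mono xlnx_tangent) auto
    then show ?thesis unfolding pexp_add pexp_cmult pexp_diff pexp_const[OF fin p_sum] .
  qed
  show ?thesis
  proof (cases "?\<alpha> = 0")
    case False
    then have "0 < ?\<alpha>" using pexp_p_nonneg[OF fin, of d] d by simp
    from tan[OF this] show ?thesis by simp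
  next
    case True
    \<comment> \<open>There is no tangent at 0; the tangents at \<beta> give the lower bound
      -\<beta>, and \<beta> tends to 0.\<close>
    have "- \<beta> \<le> pexp J (\<lambda>_. p) (\<lambda>x. xlnx (d x))" if "0 < \<beta>" for \<beta>
      using tan[OF that] unfolding True by (simp add: xlnx_def algebra_simps)
    then have "0 \<le> pexp J (\<lambda>_. p) (\<lambda>x. xlnx (d x)) + \<beta>" if "0 < \<beta>" for \<beta>
      using that by (metis add.commute diff_ge_0_iff_ge diff_minus_eq_add)
    then have "0 \<le> pexp J (\<lambda>_. p) (\<lambda>x. xlnx (d x))" by (rule field_le_epsilon)
    then show ?thesis unfolding True by (simp add: xlnx_def)
  qed
qed

lemma ent_jensen:
  assumes fin: "finite N" and J: "J \<subseteq> N" and F: "\<And>x. 0 \<le> F x"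
  shows "xlnx (pexp N (\<lambda>_. p) F) \<le> ent N J F"
  unfolding ent_def pexp_split_subset[OF fin J]
  using finite_subset[OF J fin] fin F by (intro jensen_xlnx pexp_p_nonneg) auto

text \<open>Chain rule: conditioning on \<open>J\<close> first makes the entropy of a union a mean
  of entropies of restrictions, so a refinement can be judged piece by piece.\<close>

lemma ent_union:
  assumes fin: "finite N" and JL: "J \<union> L \<subseteq> N" "J \<inter> L = {}"
  shows "ent N (J \<union> L) F = pexp J (\<lambda>_. p) (\<lambda>x. ent (N - J) L (\<lambda>y. F (override_on y x J)))"
proof -
  have "finite J" "finite L" using JL fin by (auto intro: finite_subset)
  moreover have "override_on y (override_on a x J) (J \<union> L) = override_on (override_on y a L) x J" for x y a :: "'a \<Rightarrow> 'w"
    using JL by (auto simp: fun_eq_iff override_on_def)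
  moreover have "N - (J \<union> L) = N - J - L" by auto
  ultimately show ?thesis using JL by (simp add: ent_def pexp_split)
qed

lemma ent_mono:
  assumes fin: "finite N" and JJ: "J \<subseteq> J'" "J' \<subseteq> N" and F: "\<And>x. 0 \<le> F x"
  shows "ent N J F \<le> ent N J' F"
proof -
  have "J \<union> (J' - J) = J'" using JJ by auto
  moreover have "ent N (J \<union> (J' - J)) F = pexp J (\<lambda>_. p) (\<lambda>x. ent (N - J) (J' - J) (\<lambda>y. F (override_on y x J)))"
    using JJ by (intro ent_union fin) auto
  moreover have "ent N J F \<le> pexp J (\<lambda>_. p) (\<lambda>x. ent (N - J) (J' - J) (\<lambda>y. F (override_on y x J)))"
    unfolding ent_def[of N J]
    using finite_subset[of J N] JJ fin p_nonneg F by (intro pexp_mono ent_jensen) auto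
  ultimately show ?thesis by simp
qed

text \<open>The negative part of d - \<alpha> has mean half the deviation, at least \<alpha> / 32.
  At slope at least 1 / 128 it earns \<alpha> / 4096, and shifting the tangent point costs at most 2
  \<alpha> / 128^2 = \<alpha> / 8192.\<close>

lemma ent_gain:
  assumes fin: "finite N" and K: "K \<subseteq> N" and F: "\<And>x. 0 \<le> F x"
    and \<alpha>: "\<alpha> = pexp N (\<lambda>_. p) F" "0 < \<alpha>"
    and dev: "\<alpha> / 16 \<le> deviation p N K F"
  shows "xlnx \<alpha> + \<alpha> / 8192 \<le> ent N K F"
proof -
  have fK: "finite K" using K fin by (rule finite_subset)
  define d where "d a = pexp (N - K) (\<lambda>_. p) (\<lambda>y. F (override_on y a K))" for a
  define l where "l = - ln (127 / 128 :: real)"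
  have l: "1 / 128 \<le> l" "l \<le> 1 / 128 + 2 * (1 / 128)\<^sup>2"
    using ln_le_minus_one[of "127 / 128 :: real"] ln_one_minus_pos_lower_bound[of "1 / 128 :: real"]
    by (simp_all add: l_def)
  have Ed: "pexp K (\<lambda>_. p) d = \<alpha>" unfolding \<alpha>(1) d_def by (rule pexp_split_subset[OF fin K, symmetric])
  have d0: "0 \<le> d a" for a unfolding d_def using fin F by (intro pexp_p_nonneg) auto
  have "pexp K (\<lambda>_. p) (\<lambda>a. xlnx \<alpha> + (1 + ln \<alpha>) * (d a - \<alpha>) + l * ((1 / 2) * (\<bar>d a - \<alpha>\<bar> - (d a - \<alpha>))) - \<alpha> * (l - 1 / 128))
      \<le> pexp K (\<lambda>_. p) (\<lambda>a. xlnx (d a))"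
    using xlnx_tangent_gain[OF d0 \<alpha>(2)] fK p_nonneg by (intro pexp_mono) (auto simp: l_def)
  then have "xlnx \<alpha> + l * ((1 / 2) * pexp K (\<lambda>_. p) (\<lambda>a. \<bar>d a - \<alpha>\<bar>)) - \<alpha> * (l - 1 / 128) \<le> ent N K F"
    unfolding ent_def d_def[symmetric] pexp_add pexp_cmult pexp_diff pexp_const[OF fK p_sum] Ed by simp
  moreover have "1 / 128 * (1 / 2 * (\<alpha> / 16)) \<le> l * ((1 / 2) * pexp K (\<lambda>_. p) (\<lambda>a. \<bar>d a - \<alpha>\<bar>))"
    using l dev \<alpha> by (intro mult_mono) (auto simp: d_def deviation_def)
  moreover have "\<alpha> * (l - 1 / 128) \<le> \<alpha> * (2 * (1 / 128)\<^sup>2)" using l \<alpha>(2) by (intro mult_left_mono) auto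
  ultimately show ?thesis by (simp add: power2_eq_square)
qed

lemma ent_nonpos:
  assumes fin: "finite N" and J: "J \<subseteq> N" and F: "\<And>x. 0 \<le> F x" "\<And>x. F x \<le> 1"
  shows "ent N J F \<le> 0"
proof -
  have fJ: "finite J" using J fin by (rule finite_subset)
  have "xlnx t \<le> 0" if "0 \<le> t" "t \<le> 1" for t
    using that by (cases "t = 0") (auto simp: xlnx_def mult_nonneg_nonpos)
  moreover have "pexp (N - J) (\<lambda>_. p) (\<lambda>y. F (override_on y x J)) \<le> 1" for x
  proof -
    have "pexp (N - J) (\<lambda>_. p) (\<lambda>y. F (override_on y x J)) \<le> pexp (N - J) (\<lambda>_. p) (\<lambda>y. 1)"
      using fin p_nonneg F by (intro pexp_mono) auto
    then show ?thesis using fin p_sum by (simp add: pexp_const)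
  qed
  moreover have "0 \<le> pexp (N - J) (\<lambda>_. p) (\<lambda>y. F (override_on y x J))" for x
    using fin F by (intro pexp_p_nonneg) auto
  ultimately have "ent N J F \<le> pexp J (\<lambda>_. p) (\<lambda>_. 0)"
    unfolding ent_def using fJ p_nonneg by (intro pexp_mono) auto
  then show ?thesis using fJ p_sum by (simp add: pexp_const)
qed

end

text \<open>
  Greedily matching weight along edges leaves an independent remainder, while an independent set
  misses at least one end of every matched edge.
\<close>

lemma fractional_matching:
  fixes w :: "'a \<Rightarrow> real"
  assumes "finite E" "finite X" "E \<subseteq> X \<times> X" "\<And>x. 0 \<le> w x"
  shows "\<exists>w'. (\<forall>x. 0 \<le> w' x \<and> w' x \<le> w x) \<and> (\<forall>(x, y)\<in>E. w' x = 0 \<or> w' y = 0) \<and>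
    (\<forall>U. (\<forall>(x, y)\<in>E. \<not> (x \<in> U \<and> y \<in> U)) \<longrightarrow> (\<Sum>x\<in>X. w x - w' x) \<le> 2 * (\<Sum>x\<in>X - U. w x - w' x))"
  using assms(1,3)
proof (induction E)
  case empty
  show ?case by (rule exI[of _ w]) (use assms(4) in auto)
next
  case (insert e E)
  obtain a b where e: "e = (a, b)" by (cases e)
  have ab: "a \<in> X" "b \<in> X" using insert.prems e by auto
  have "E \<subseteq> X \<times> X" using insert.prems by auto
  from insert.IH[OF this] obtain w' where
    IH: "\<forall>x. 0 \<le> w' x \<and> w' x \<le> w x" "\<forall>(x, y)\<in>E. w' x = 0 \<or> w' y = 0"
      "\<forall>U. (\<forall>(x, y)\<in>E. \<not> (x \<in> U \<and> y \<in> U)) \<longrightarrow> (\<Sum>x\<in>X. w x - w' x) \<le> 2 * (\<Sum>x\<in>X - U. w x - w' x)"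
    by (elim exE conjE)
  have w': "\<And>x. 0 \<le> w' x" "\<And>x. w' x \<le> w x" "\<And>x y. (x, y) \<in> E \<Longrightarrow> w' x = 0 \<or> w' y = 0"
    using IH(1,2) by auto
  have cover: "(\<Sum>x\<in>X. w x - w' x) \<le> 2 * (\<Sum>x\<in>X - U. w x - w' x)"
    if "\<forall>(x, y)\<in>E. \<not> (x \<in> U \<and> y \<in> U)" for U
    using IH(3)[THEN spec[of _ U], THEN mp, OF that] .
  \<comment> \<open>Matching along the new edge stops when one end is exhausted. In \<delta> the
    second summand is dropped for a loop, whose vertex loses \<open>m\<close> only once.\<close>
  define m where "m = min (w' a) (w' b)"
  define \<delta> where "\<delta> x = (if x = a then m else 0) + (if x = b \<and> b \<noteq> a then m else 0)" for x
  have m: "0 \<le> m" using w' by (simp add: m_def)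
  have \<delta>: "0 \<le> \<delta> x" "\<delta> x \<le> w' x" for x using w'(1) by (auto simp: \<delta>_def m_def)
  show ?case
  proof (intro exI[of _ "\<lambda>x. w' x - \<delta> x"] conjI allI impI ballI)
    fix x
    show "0 \<le> w' x - \<delta> x" "w' x - \<delta> x \<le> w x" using \<delta>[of x] w'(2)[of x] by auto
  next
    fix z assume z: "z \<in> insert e E"
    show "case z of (x, y) \<Rightarrow> w' x - \<delta> x = 0 \<or> w' y - \<delta> y = 0"
    proof (cases "z = e")
      case True
      then show ?thesis unfolding e by (auto simp: \<delta>_def m_def min_def)
    next
      case False
      obtain x y where xy: "z = (x, y)" by (cases z)
      then have "w' x = 0 \<or> w' y = 0" using False z w'(3) by auto
      then show ?thesis using \<delta>[of x] \<delta>[of y] unfolding xy by auto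
    qed
  next
    fix U assume U: "\<forall>(x, y)\<in>insert e E. \<not> (x \<in> U \<and> y \<in> U)"
    have \<delta>sum: "(\<Sum>x\<in>X. \<delta> x) \<le> 2 * m"
      using ab assms(2) m by (cases "a = b") (simp_all add: \<delta>_def sum.distrib)
    \<comment> \<open>An independent \<open>U\<close> misses an end of the new edge, and the full
      amount \<open>m\<close> is taken there.\<close>
    have "\<exists>x\<in>X - U. \<delta> x = m" using U e ab by (auto simp: \<delta>_def)
    then obtain x where "x \<in> X - U" "\<delta> x = m" by blast
    then have "m \<le> (\<Sum>x\<in>X - U. \<delta> x)" using \<delta>(1) assms(2) member_le_sum[of x "X - U" \<delta>] by auto
    then have "(\<Sum>x\<in>X. \<delta> x) \<le> 2 * (\<Sum>x\<in>X - U. \<delta> x)" using \<delta>sum by linarith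
    moreover have "(\<Sum>x\<in>X. w x - w' x) \<le> 2 * (\<Sum>x\<in>X - U. w x - w' x)" using U by (intro cover) auto
    ultimately have "(\<Sum>x\<in>X. w x - w' x) + (\<Sum>x\<in>X. \<delta> x) \<le> 2 * ((\<Sum>x\<in>X - U. w x - w' x) + (\<Sum>x\<in>X - U. \<delta> x))"
      unfolding distrib_left by (intro add_mono)
    moreover have "w x - (w' x - \<delta> x) = (w x - w' x) + \<delta> x" for x by simp
    ultimately show "(\<Sum>x\<in>X. w x - (w' x - \<delta> x)) \<le> 2 * (\<Sum>x\<in>X - U. w x - (w' x - \<delta> x))"
      by (simp only: sum.distrib)
  qed
qed

lemma pexp2_ge_term:
  assumes fin: "finite J" and xy: "x \<in> J \<rightarrow>\<^sub>E UNIV" "y \<in> J \<rightarrow>\<^sub>E UNIV"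
    and nn: "\<And>i u v. 0 \<le> \<pi> i u v" "\<And>x y. 0 \<le> h x y"
  shows "(\<Prod>i\<in>J. \<pi> i (x i) (y i)) * h x y \<le> pexp2 J \<pi> h"
proof -
  define z where "z = restrict (\<lambda>i. (x i, y i)) J"
  have z: "restrict (\<lambda>i. fst (z i)) J = x" "restrict (\<lambda>i. snd (z i)) J = y"
    using xy by (auto simp: z_def fun_eq_iff restrict_def PiE_iff extensional_def)
  let ?f = "\<lambda>z. (\<Prod>i\<in>J. case z i of (u, v) \<Rightarrow> \<pi> i u v) * h (restrict (\<lambda>i. fst (z i)) J) (restrict (\<lambda>i. snd (z i)) J)"
  have "?f z \<le> (\<Sum>z\<in>J \<rightarrow>\<^sub>E UNIV. ?f z)"
    using fin nn by (intro member_le_sum) (auto simp: z_def finite_PiE case_prod_unfold intro!: prod_nonneg mult_nonneg_nonneg)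
  moreover have "(\<Prod>i\<in>J. case z i of (u, v) \<Rightarrow> \<pi> i u v) = (\<Prod>i\<in>J. \<pi> i (x i) (y i))"
    by (intro prod.cong) (auto simp: z_def)
  ultimately show ?thesis by (simp add: pexp2_def pexp_def z)
qed

section \<open>One refinement of the coordinate set\<close>

context spectral_chain
begin

sublocale prob_weights "($) \<mu>"
  by standard (auto simp: \<mu>_sum less_imp_le[OF \<mu>_pos])

abbreviation step :: "'v \<Rightarrow> 'v \<Rightarrow> real" where
  "step u v \<equiv> \<mu> $ u * A $ u $ v"

text \<open>Independence in combinatorial form; only the zeros of \<open>A\<close> count because all
  weights of \<mu> are positive.\<close>

definition no_edge :: "'i set \<Rightarrow> ('i \<Rightarrow> 'v) set \<Rightarrow> bool" where
  "no_edge N U \<longleftrightarrow> (\<forall>x\<in>U. \<forall>y\<in>U. \<exists>i\<in>N. A $ x i $ y i = 0)"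

lemma step_nonneg: "0 \<le> step u v"
  using \<mu>_pos A_nonneg by (simp add: less_imp_le)

text \<open>Finitely many positive numbers are bounded below. The bound is the reciprocal of a sum
  of reciprocals, in which zero weights contribute 0.\<close>

lemma step_lower_bound: obtains k where "\<And>u v. A $ u $ v \<noteq> 0 \<Longrightarrow> 1 / 2 ^ k \<le> step u v"
proof -
  obtain k where k: "(\<Sum>u\<in>UNIV. \<Sum>v\<in>UNIV. 1 / step u v) \<le> 2 ^ k" using ex_power2_ge by blast
  show thesis
  proof (rule that[of k])
    fix u v assume "A $ u $ v \<noteq> 0"
    then have pos: "0 < step u v" using \<mu>_pos[of u] A_nonneg[of u v] by simp
    have nn: "0 \<le> 1 / step u v" for u v using step_nonneg by simp
    have "1 / step u v \<le> (\<Sum>v\<in>UNIV. 1 / step u v)" using nn by (intro member_le_sum) auto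
    also have "\<dots> \<le> (\<Sum>u\<in>UNIV. \<Sum>v\<in>UNIV. 1 / step u v)"
      using nn by (intro member_le_sum[of u UNIV "\<lambda>u. \<Sum>v\<in>UNIV. 1 / step u v"]) (auto intro: sum_nonneg)
    also note k
    finally show "1 / 2 ^ k \<le> step u v" using pos by (simp add: field_simps)
  qed
qed

text \<open>
  The pieces of density at least \<open>M / 4\<close> that no small set of coordinates shatters are independent,
  so the shattered pieces carry a fixed fraction of the mass of \<open>F\<close>.
\<close>

lemma entropy_increment:
  fixes N :: "nat set" and F :: "(nat \<Rightarrow> 'v) \<Rightarrow> real"
  assumes c: "junta_constant (($) \<mu>) step c"
    and k: "\<And>u v. A $ u $ v \<noteq> 0 \<Longrightarrow> 1 / 2 ^ k \<le> step u v"
    and fin: "finite N" and F: "\<And>x. 0 \<le> F x" "\<And>x. F x \<le> 1"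
    and M: "M = pexp N (\<lambda>_. ($) \<mu>) F" "1 / 2 ^ m \<le> M"
    and far: "\<And>U. U \<subseteq> N \<rightarrow>\<^sub>E UNIV \<Longrightarrow> no_edge N U \<Longrightarrow> M \<le> 2 * pexp N (\<lambda>_. ($) \<mu>) (\<lambda>x. if x \<in> U then 0 else F x)"
    and J: "J \<subseteq> N" and small: "pexp2 N (\<lambda>_. step) (\<lambda>x y. F x * F y) \<le> 1 / 2 ^ (c * (m + 3) + k * card J)"
  shows "\<exists>J'\<subseteq>N. card J' \<le> card J + CARD('v) ^ card J * 2 ^ 2 ^ (c * (m + 3)) \<and> ent N J F + M / 32768 \<le> ent N J' F"
proof -
  let ?E = "\<lambda>S. pexp S (\<lambda>_. ($) \<mu>)"
  let ?S = "N - J"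
  have fJ: "finite J" using J fin by (rule finite_subset)
  have M0: "0 < M" using M(2) by (smt (verit) zero_less_divide_1_iff zero_less_power)
  define f where "f x y = F (override_on y x J)" for x y
  define d where "d x = ?E ?S (f x)" for x
  have d0: "0 \<le> d x" for x unfolding d_def f_def using fin F by (intro pexp_p_nonneg) auto
  let ?shatter = "\<lambda>x K. K \<subseteq> ?S \<and> card K \<le> 2 ^ 2 ^ (c * (m + 3)) \<and>
    d x / 16 \<le> deviation (($) \<mu>) ?S K (f x)"
  define S where "S = {x \<in> J \<rightarrow>\<^sub>E UNIV. 0 < d x \<and> (\<exists>K. ?shatter x K)}"
  \<comment> \<open>The dense restrictions that are not shattered; \<open>U\<close> is the cylinder
    above them. Adjacency of two points on all of \<open>N\<close> entails adjacency of their
    restrictions to \<open>J\<close>.\<close>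
  define T where "T = {x \<in> J \<rightarrow>\<^sub>E UNIV. M / 4 \<le> d x} - S"
  define U where "U = {z \<in> N \<rightarrow>\<^sub>E UNIV. restrict z J \<in> T}"
  have fS: "finite S" unfolding S_def using fJ by (simp add: finite_PiE)
  have "no_edge N U"
    unfolding no_edge_def
  proof (intro ballI, rule ccontr)
    fix z z' assume zU: "z \<in> U" "z' \<in> U" and "\<not> (\<exists>i\<in>N. A $ z i $ z' i = 0)"
    then have edge: "A $ z i $ z' i \<noteq> 0" if "i \<in> N" for i using that by blast
    define x x' where "x = restrict z J" and "x' = restrict z' J"
    have xT: "x \<in> T" "x' \<in> T" using zU by (auto simp: U_def x_def x'_def)
    have xP: "x \<in> J \<rightarrow>\<^sub>E UNIV" "x' \<in> J \<rightarrow>\<^sub>E UNIV" using xT by (auto simp: T_def)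
    have dx: "M / 4 \<le> d x" "M / 4 \<le> d x'" using xT by (auto simp: T_def)
    have inner: "0 \<le> pexp2 ?S (\<lambda>_. step) (\<lambda>y y'. f x y * f x' y')" for x x'
      unfolding f_def using fin step_nonneg F by (intro pexp2_nonneg) auto
    \<comment> \<open>An edge has weight at least 2^-k per coordinate, so passing from the whole
      inner product to one pair of restrictions costs at most 2^(k * card J), which
      \<open>small\<close> provides for.\<close>
    have "(1 / 2 ^ k) ^ card J = (\<Prod>i\<in>J. 1 / 2 ^ k :: real)" by simp
    also have "\<dots> \<le> (\<Prod>i\<in>J. step (x i) (x' i))"
      using k[OF edge] J by (intro prod_mono) (auto simp: x_def x'_def)
    finally have "(1 / 2 ^ k) ^ card J * pexp2 ?S (\<lambda>_. step) (\<lambda>y y'. f x y * f x' y')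
        \<le> (\<Prod>i\<in>J. step (x i) (x' i)) * pexp2 ?S (\<lambda>_. step) (\<lambda>y y'. f x y * f x' y')"
      by (intro mult_right_mono inner)
    also have "\<dots> \<le> pexp2 J (\<lambda>_. step) (\<lambda>x x'. pexp2 ?S (\<lambda>_. step) (\<lambda>y y'. f x y * f x' y'))"
      using pexp2_ge_term[OF fJ xP, of "\<lambda>_. step" "\<lambda>x x'. pexp2 ?S (\<lambda>_. step) (\<lambda>y y'. f x y * f x' y')"]
        step_nonneg inner by simp
    also have "\<dots> = pexp2 N (\<lambda>_. step) (\<lambda>x y. F x * F y)"
      unfolding f_def by (rule pexp2_split_subset[OF fin J, symmetric])
    also note small
    finally have "pexp2 ?S (\<lambda>_. step) (\<lambda>y y'. f x y * f x' y') \<le> 1 / 2 ^ (c * (m + 3))"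
      by (simp add: power_add power_divide field_simps flip: power_mult)
    \<comment> \<open>Density M / 4 replaces m by m + 2, whence m + 3 in the bounds.\<close>
    then have 1: "pexp2 ?S (\<lambda>_. step) (\<lambda>y y'. f x y * f x' y') \<le> 1 / 2 ^ (c * ((m + 2) + 1))"
      by (simp only: add.assoc) simp
    have 2: "(1::real) / 2 ^ (m + 2) \<le> M / 4" using M(2) by (simp add: power_add)
    have "1 / 2 ^ (m + 2) \<le> ?E ?S (f x)" "1 / 2 ^ (m + 2) \<le> ?E ?S (f x')"
      using 2 dx unfolding d_def by linarith+
    moreover have "\<forall>y. 0 \<le> f x y \<and> f x y \<le> 1" for x using F by (auto simp: f_def)
    ultimately have "\<exists>K\<subseteq>?S. card K \<le> 2 ^ 2 ^ (c * ((m + 2) + 1)) \<and>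
        (?E ?S (f x) / 16 \<le> deviation (($) \<mu>) ?S K (f x) \<or> ?E ?S (f x') / 16 \<le> deviation (($) \<mu>) ?S K (f x'))"
      using c[unfolded junta_constant_def, rule_format, of ?S "f x" "f x'" "m + 2"] 1 fin by blast
    moreover have "(m + 2) + 1 = m + 3" by simp
    ultimately obtain K where "?shatter x K \<or> ?shatter x' K"
      unfolding d_def by (metis (no_types, lifting))
    moreover have "0 < d x" "0 < d x'" using dx M0 by linarith+
    ultimately have "x \<in> S \<or> x' \<in> S" using xP unfolding S_def by blast
    then show False using xT by (auto simp: T_def)
  qed
  then have "M \<le> 2 * ?E N (\<lambda>x. if x \<in> U then 0 else F x)"
    by (intro far) (auto simp: U_def)
  also have "?E N (\<lambda>x. if x \<in> U then 0 else F x) = ?E J (\<lambda>x. (if x \<in> T then 0 else 1) * d x)"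
    unfolding pexp_split_subset[OF fin J]
  proof (intro pexp_cong fJ refl)
    fix x assume x: "x \<in> J \<rightarrow>\<^sub>E (UNIV :: 'v set)"
    show "?E ?S (\<lambda>y. if override_on y x J \<in> U then 0 else F (override_on y x J)) = (if x \<in> T then 0 else 1) * d x"
      unfolding d_def pexp_cmult[symmetric]
    proof (intro pexp_cong refl)
      fix y assume y: "y \<in> ?S \<rightarrow>\<^sub>E (UNIV :: 'v set)"
      have "override_on y x J \<in> N \<rightarrow>\<^sub>E UNIV" using x y J by (auto simp: PiE_iff extensional_def override_on_def)
      moreover have "restrict (override_on y x J) J = x"
        using x by (auto simp: fun_eq_iff restrict_def override_on_def PiE_iff extensional_def)
      ultimately have "override_on y x J \<in> U \<longleftrightarrow> x \<in> T" by (simp add: U_def)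
      then show "(if override_on y x J \<in> U then 0 else F (override_on y x J)) = (if x \<in> T then 0 else 1) * f x y"
        by (simp add: f_def)
    qed (use fin in auto)
  qed
  \<comment> \<open>A restriction outside \<open>T\<close> is shattered or has density below M / 4.
    So of the mass M / 2 outside \<open>U\<close>, at least M / 4 is shattered.\<close>
  also have "\<dots> \<le> ?E J (\<lambda>x. M / 4 + (if x \<in> S then 1 else 0) * d x)"
  proof (intro pexp_mono fJ p_nonneg)
    fix x assume "x \<in> J \<rightarrow>\<^sub>E (UNIV :: 'v set)"
    then show "(if x \<in> T then 0 else 1) * d x \<le> M / 4 + (if x \<in> S then 1 else 0) * d x"
      using M0 d0[of x] by (auto simp: T_def)
  qed
  also have "\<dots> = M / 4 + ?E J (\<lambda>x. (if x \<in> S then 1 else 0) * d x)"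
    unfolding pexp_add pexp_const[OF fJ p_sum] ..
  finally have mass: "M / 4 \<le> ?E J (\<lambda>x. (if x \<in> S then 1 else 0) * d x)" by simp
  have "\<forall>x\<in>S. \<exists>K. ?shatter x K" by (auto simp: S_def)
  then obtain K where K: "\<And>x. x \<in> S \<Longrightarrow> ?shatter x (K x)" by metis
  \<comment> \<open>A single set serves all restrictions: the union of their individual choices, of
    which there are at most |V|^|J|.\<close>
  define L where "L = (\<Union>x\<in>S. K x)"
  have L: "L \<subseteq> ?S" using K by (auto simp: L_def)
  have JL: "J \<union> L \<subseteq> N" "J \<inter> L = {}" using L J by auto
  have "card L \<le> (\<Sum>x\<in>S. card (K x))" unfolding L_def by (rule card_UN_le[OF fS])
  also have "\<dots> \<le> (\<Sum>x\<in>S. 2 ^ 2 ^ (c * (m + 3)))" using K by (intro sum_mono) auto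
  also have "\<dots> = card S * 2 ^ 2 ^ (c * (m + 3))" by simp
  also have "card S \<le> card (J \<rightarrow>\<^sub>E (UNIV :: 'v set))"
    using fJ by (intro card_mono) (auto simp: S_def finite_PiE)
  also have "\<dots> = CARD('v) ^ card J" using fJ by (simp add: card_PiE)
  finally have "card (J \<union> L) \<le> card J + CARD('v) ^ card J * 2 ^ 2 ^ (c * (m + 3))"
    using card_Un_le[of J L] by simp
  moreover have "ent N J F + M / 32768 \<le> ent N (J \<union> L) F"
  proof -
    \<comment> \<open>The relative gain 1 / 8192 from \<open>ent_gain\<close>, on mass at least M /
      4.\<close>
    have "ent N J F + M / 32768 \<le> ent N J F + (1 / 8192) * ?E J (\<lambda>x. (if x \<in> S then 1 else 0) * d x)"
      using mass by simp
    also have "\<dots> = ?E J (\<lambda>x. xlnx (d x) + (1 / 8192) * ((if x \<in> S then 1 else 0) * d x))"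
      unfolding pexp_add pexp_cmult ent_def d_def f_def ..
    also have "\<dots> \<le> ?E J (\<lambda>x. ent ?S L (f x))"
    proof (intro pexp_mono fJ p_nonneg)
      fix x assume "x \<in> J \<rightarrow>\<^sub>E (UNIV :: 'v set)"
      have f0: "0 \<le> f x y" for y by (simp add: f_def F)
      show "xlnx (d x) + (1 / 8192) * ((if x \<in> S then 1 else 0) * d x) \<le> ent ?S L (f x)"
      proof (cases "x \<in> S")
        case True
        have "xlnx (d x) + d x / 8192 \<le> ent ?S (K x) (f x)"
          using K[OF True] True fin f0 by (intro ent_gain) (auto simp: d_def S_def)
        also have "\<dots> \<le> ent ?S L (f x)" using True fin L f0 by (intro ent_mono) (auto simp: L_def)
        finally show ?thesis using True by simp
      next
        case False
        then show ?thesis using ent_jensen[of ?S L "f x"] fin L f0 by (simp add: d_def)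
      qed
    qed
    also have "\<dots> = ent N (J \<union> L) F" unfolding f_def by (rule ent_union[OF fin JL, symmetric])
    finally show ?thesis .
  qed
  ultimately show ?thesis using JL by blast
qed

end

section \<open>Growth of the coordinate set against the tower function\<close>

primrec junta_bound :: "nat \<Rightarrow> nat \<Rightarrow> nat \<Rightarrow> nat" where
  "junta_bound q C 0 = 0"
| "junta_bound q C (Suc t) = junta_bound q C t + q ^ junta_bound q C t * 2 ^ C"

lemma junta_bound_mono: "s \<le> t \<Longrightarrow> junta_bound q C s \<le> junta_bound q C t"
  by (induction t) (auto simp: le_Suc_eq)

lemma tower_gt: "t < tower t"
proof (induction t)
  case (Suc t)
  have "Suc t \<le> tower t" using Suc by simp
  also have "\<dots> < 2 ^ tower t" by (rule less_exp)
  finally show ?case by simp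
qed simp

lemma tower_mono: "s \<le> t \<Longrightarrow> tower s \<le> tower t"
proof (induction t)
  case (Suc t)
  have "tower t \<le> tower (Suc t)" using less_exp[of "tower t"] by simp
  with Suc show ?case by (auto simp: le_Suc_eq simp del: tower.simps intro: order_trans)
qed simp

lemma sq_le_power2: "6 \<le> X \<Longrightarrow> X * X + X + 1 \<le> (2::nat) ^ X"
proof (induction X rule: dec_induct)
  case (step n)
  have "Suc n * Suc n + Suc n + 1 \<le> 2 * (n * n + n + 1)"
  proof -
    have "2 * n \<le> n * n" using step(1) by (intro mult_right_mono) auto
    then have n: "n + 1 \<le> n * n" using step(1) by linarith
    have "Suc n * Suc n + Suc n + 1 = n * n + 3 * n + 3" by simp
    also have "\<dots> \<le> 2 * (n * n + n + 1)" using n unfolding distrib_left by linarith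
    finally show ?thesis .
  qed
  then show ?case using step by simp
qed simp

text \<open>With X = tower (b + 2 t), a step multiplies powers of 2 with exponents at most X^2 and
  X, and X^2 + X + 1 <= 2^X. The new bound 2^(2^X) lies two levels higher, whence 2 t.\<close>

lemma junta_bound_le_tower:
  assumes "6 \<le> b" "e \<le> b" "q \<le> 2 ^ e" "C \<le> tower b"
  shows "junta_bound q C t \<le> tower (b + 2 * t)"
proof (induction t)
  case (Suc t)
  let ?X = "tower (b + 2 * t)"
  have X: "b \<le> ?X" using tower_gt[of "b + 2 * t"] by linarith
  have C: "C \<le> ?X" using assms(4) tower_mono[of b "b + 2 * t"] by linarith
  have "q ^ junta_bound q C t \<le> (2 ^ e) ^ ?X"
  proof (cases "q = 0")
    case False
    have "q ^ junta_bound q C t \<le> q ^ ?X" using Suc False by (intro power_increasing) auto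
    also have "\<dots> \<le> (2 ^ e) ^ ?X" using assms(3) by (intro power_mono) auto
    finally show ?thesis .
  next
    case True
    then show ?thesis by (cases "junta_bound q C t") auto
  qed
  also have "\<dots> = 2 ^ (e * ?X)" by (simp add: power_mult)
  also have "\<dots> \<le> 2 ^ (?X * ?X)" using assms(2) X by (intro power_increasing mult_right_mono) auto
  finally have "q ^ junta_bound q C t * 2 ^ C \<le> 2 ^ (?X * ?X) * 2 ^ ?X"
    using C by (intro mult_mono power_increasing) auto
  moreover have "junta_bound q C t \<le> 2 ^ (?X * ?X) * 2 ^ ?X"
  proof -
    have "junta_bound q C t \<le> 1 * 2 ^ ?X" using Suc less_exp[of ?X] by linarith
    also have "\<dots> \<le> 2 ^ (?X * ?X) * 2 ^ ?X" by (intro mult_right_mono) auto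
    finally show ?thesis .
  qed
  ultimately have "junta_bound q C (Suc t) \<le> 2 ^ (?X * ?X + ?X + 1)" by (simp add: power_add)
  also have "\<dots> \<le> 2 ^ 2 ^ ?X" using sq_le_power2[of ?X] X assms(1) by (intro power_increasing) auto
  finally show ?case by simp
qed simp

context spectral_chain
begin

lemma matched_bound:
  obtains a b where "\<And>m (N :: nat set) F. finite N \<Longrightarrow> (\<And>x. 0 \<le> F x) \<Longrightarrow> (\<And>x. F x \<le> 1) \<Longrightarrow>
      1 / 2 ^ m \<le> pexp N (\<lambda>_. ($) \<mu>) F \<Longrightarrow>
      (\<And>U. U \<subseteq> N \<rightarrow>\<^sub>E UNIV \<Longrightarrow> no_edge N U \<Longrightarrow>
        pexp N (\<lambda>_. ($) \<mu>) F \<le> 2 * pexp N (\<lambda>_. ($) \<mu>) (\<lambda>x. if x \<in> U then 0 else F x)) \<Longrightarrow>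
      1 / real (tower (a * m + b)) < pexp2 N (\<lambda>_. step) (\<lambda>x y. F x * F y)"
proof -
  obtain c where c: "junta_constant (($) \<mu>) step c" using junta_constant_exists by blast
  obtain k where k: "\<And>u v. A $ u $ v \<noteq> 0 \<Longrightarrow> 1 / 2 ^ k \<le> step u v" using step_lower_bound by blast
  define e where "e = CARD('v)"
  have e: "CARD('v) \<le> 2 ^ e" unfolding e_def by (rule less_imp_le[OF less_exp])
  \<comment> \<open>The height is Suc (Suc (b + 2 T)) with \<open>b\<close> and \<open>T\<close> as
    defined below: two levels for each of 32768 m + 1 steps explain 65536, \<open>b\<close>
    contributes c m, and two final levels turn the bound X into 2^(2^X).\<close>
  show thesis
  proof (rule that[of "c + 65536" "3 * c + e + k + 10"])
    fix m and N :: "nat set" and F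
    assume fin: "finite N" and F: "\<And>x. 0 \<le> F x" "\<And>x. F x \<le> 1"
      and M1: "1 / 2 ^ m \<le> pexp N (\<lambda>_. ($) \<mu>) F"
      and far: "\<And>U. U \<subseteq> N \<rightarrow>\<^sub>E UNIV \<Longrightarrow> no_edge N U \<Longrightarrow>
        pexp N (\<lambda>_. ($) \<mu>) F \<le> 2 * pexp N (\<lambda>_. ($) \<mu>) (\<lambda>x. if x \<in> U then 0 else F x)"
    define M where "M = pexp N (\<lambda>_. ($) \<mu>) F"
    \<comment> \<open>One step more than the potential allows: it starts at M ln M >= - M m, never
      exceeds 0 and gains M / 32768 each time.\<close>
    define T where "T = 32768 * m + 1"
    define b where "b = c * (m + 3) + e + k + 6"
    define C where "C = (2::nat) ^ (c * (m + 3))"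
    let ?B = "junta_bound (CARD('v)) C"
    have M0: "0 < M" "1 / 2 ^ m \<le> M" using M1 unfolding M_def by (smt (verit) zero_less_divide_1_iff zero_less_power)+
    have big: "1 / 2 ^ (c * (m + 3) + k * ?B T) < pexp2 N (\<lambda>_. step) (\<lambda>x y. F x * F y)"
    proof (rule ccontr)
      assume "\<not> ?thesis"
      then have small: "pexp2 N (\<lambda>_. step) (\<lambda>x y. F x * F y) \<le> 1 / 2 ^ (c * (m + 3) + k * ?B T)" by simp
      have "\<exists>J\<subseteq>N. card J \<le> ?B t \<and> xlnx M + real t * (M / 32768) \<le> ent N J F" if "t \<le> T" for t
        using that
      proof (induction t)
        case 0
        have "ent N {} F = xlnx M" by (simp add: ent_def M_def override_on_def)
        then show ?case by (intro exI[of _ "{}"]) auto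
      next
        case (Suc t)
        then obtain J where J: "J \<subseteq> N" "card J \<le> ?B t" "xlnx M + real t * (M / 32768) \<le> ent N J F" by auto
        \<comment> \<open>The sizes increase, so smallness relative to the last bound implies
          smallness relative to the present \<open>J\<close>.\<close>
        have "card J \<le> ?B T" using J(2) junta_bound_mono[of t T] Suc.prems by (metis Suc_leD order_trans)
        then have "(1::real) / 2 ^ (c * (m + 3) + k * ?B T) \<le> 1 / 2 ^ (c * (m + 3) + k * card J)"
          by (intro divide_left_mono power_increasing add_left_mono mult_left_mono) auto
        with small have "pexp2 N (\<lambda>_. step) (\<lambda>x y. F x * F y) \<le> 1 / 2 ^ (c * (m + 3) + k * card J)"
          by linarith
        from entropy_increment[OF c k fin F M_def M0(2) far[folded M_def] J(1) this]
        obtain J' where J': "J' \<subseteq> N" "card J' \<le> card J + CARD('v) ^ card J * 2 ^ 2 ^ (c * (m + 3))"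
          "ent N J F + M / 32768 \<le> ent N J' F" by auto
        have "card J + CARD('v) ^ card J * 2 ^ C \<le> ?B (Suc t)"
          using J(2) by (simp add: add_mono power_increasing)
        then have "card J' \<le> ?B (Suc t)" using J'(2) unfolding C_def by linarith
        moreover have "xlnx M + real (Suc t) * (M / 32768) \<le> ent N J' F"
          using J(3) J'(3) by (simp add: distrib_right add_divide_distrib)
        ultimately show ?case using J'(1) by blast
      qed
      then obtain J where J: "J \<subseteq> N" "xlnx M + real T * (M / 32768) \<le> ent N J F" by blast
      have "ent N J F \<le> 0" by (rule ent_nonpos[OF fin J(1) F])
      then have "M * (real T / 32768) \<le> M * (- ln M)" using J(2) by (simp add: xlnx_def mult.commute)
      then have "real T / 32768 \<le> - ln M" using M0(1) by (rule mult_left_le_imp_le)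
      also have "- ln M \<le> real m"
      proof -
        have "ln (1 / 2 ^ m) \<le> ln M" using M0 by (subst ln_le_cancel_iff) auto
        moreover have "ln (1 / 2 ^ m :: real) = - (real m * ln 2)" by (simp add: ln_div ln_realpow)
        moreover have "real m * ln 2 \<le> real m * 1" using ln_2_less_1 by (intro mult_left_mono) auto
        ultimately show ?thesis by linarith
      qed
      finally show False by (simp add: T_def)
    qed
    let ?X = "tower (b + 2 * T)"
    have C: "C \<le> tower b"
    proof -
      have "c * (m + 3) \<le> b - 1" by (simp add: b_def)
      also have "b - 1 \<le> tower (b - 1)" using tower_gt[of "b - 1"] by simp
      finally have "C \<le> 2 ^ tower (b - 1)" unfolding C_def by (intro power_increasing) auto
      also have "\<dots> = tower (Suc (b - 1))" by simp
      also have "Suc (b - 1) = b" by (simp add: b_def)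
      finally show ?thesis .
    qed
    have X: "b + 2 * T < ?X" by (rule tower_gt)
    have "c * (m + 3) + k * ?B T \<le> ?X + ?X * ?X"
      using junta_bound_le_tower[of b e "CARD('v)" C T] e C X
      by (intro add_mono mult_mono) (auto simp: b_def)
    also have "\<dots> \<le> 2 ^ ?X" using sq_le_power2[of ?X] X by (simp add: b_def)
    finally have "1 / 2 ^ (2 ^ ?X) \<le> (1::real) / 2 ^ (c * (m + 3) + k * ?B T)"
      by (intro divide_left_mono power_increasing) auto
    moreover have "(c + 65536) * m + (3 * c + e + k + 10) = Suc (Suc (b + 2 * T))"
      by (simp add: b_def T_def algebra_simps)
    then have "real (tower ((c + 65536) * m + (3 * c + e + k + 10))) = 2 ^ (2 ^ ?X)"
      by (simp only: tower.simps of_nat_power of_nat_numeral)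
    ultimately show "1 / real (tower ((c + 65536) * m + (3 * c + e + k + 10)))
        < pexp2 N (\<lambda>_. step) (\<lambda>x y. F x * F y)"
      using big by simp
  qed
qed

end

section \<open>The removal bound\<close>

context spectral_chain
begin

lemma prod_expectation_eq: "prod_expectation \<mu> n f = pexp {..<n} (\<lambda>_. ($) \<mu>) f"
  by (simp add: prod_expectation_def pexp_def cube_def)

lemma prod_inner_chain_eq: "prod_inner \<mu> n f (prod_chain A n g) = pexp2 {..<n} (\<lambda>_. step) (\<lambda>x y. f x * g y)"
proof -
  have "prod_chain A n g x = pexp {..<n} (\<lambda>i v. A $ x i $ v) g" for x
    by (simp add: prod_chain_def pexp_def cube_def)
  then show ?thesis
    using pexp2_kernel[of "{..<n}" "\<lambda>_. ($) \<mu>" "\<lambda>_ u v. A $ u $ v" "\<lambda>x y. f x * g y"]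
    by (simp add: prod_inner_def prod_expectation_eq pexp_cmult)
qed

lemma no_edge_independent:
  assumes "U \<subseteq> cube n" "no_edge {..<n} U" shows "independent_set A \<mu> n U"
proof -
  have "pexp2 {..<n} (\<lambda>_. step) (\<lambda>x y. indicator U x * indicator U y) = pexp2 {..<n} (\<lambda>_. step) (\<lambda>x y. 0 * 0)"
  proof (intro pexp2_cong refl)
    fix x y :: "nat \<Rightarrow> 'v" assume "\<And>i. i \<in> {..<n} \<Longrightarrow> step (x i) (y i) \<noteq> 0"
    then have "\<not> (x \<in> U \<and> y \<in> U)" using assms(2) by (fastforce simp: no_edge_def)
    then show "indicator U x * indicator U y = 0 * (0::real)" by (auto simp: indicator_def)
  qed simp
  also have "\<dots> = 0" by (simp only: pexp2_cmult)
  finally show ?thesis using assms(1) by (simp add: independent_set_def prod_inner_chain_eq)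
qed

text \<open>\<open>F\<close> is the matched part of \<open>g\<close>, written as a density. Its mean
  exceeds \<epsilon> because the unmatched part lives on an independent set, off which
  \<open>F\<close> equals \<open>g\<close>; being at most \<open>g\<close>, it bounds the inner
  product from below.\<close>

lemma removal_bound:
  obtains a b where "\<And>m n g \<epsilon>. 1 / 2 ^ m \<le> \<epsilon> \<Longrightarrow> g \<in> cube n \<rightarrow> {0..1} \<Longrightarrow> far_from_independent A \<mu> n \<epsilon> g \<Longrightarrow>
      1 / real (tower (a * m + b)) < prod_inner \<mu> n g (prod_chain A n g)"
proof -
  obtain a b where ab: "\<And>m (N :: nat set) F. finite N \<Longrightarrow> (\<And>x. 0 \<le> F x) \<Longrightarrow> (\<And>x. F x \<le> 1) \<Longrightarrow>
      1 / 2 ^ m \<le> pexp N (\<lambda>_. ($) \<mu>) F \<Longrightarrow>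
      (\<And>U. U \<subseteq> N \<rightarrow>\<^sub>E UNIV \<Longrightarrow> no_edge N U \<Longrightarrow>
        pexp N (\<lambda>_. ($) \<mu>) F \<le> 2 * pexp N (\<lambda>_. ($) \<mu>) (\<lambda>x. if x \<in> U then 0 else F x)) \<Longrightarrow>
      1 / real (tower (a * m + b)) < pexp2 N (\<lambda>_. step) (\<lambda>x y. F x * F y)"
    by (rule matched_bound) blast
  show thesis
  proof (rule that[of a b])
    fix m n g \<epsilon>
    assume m: "1 / 2 ^ m \<le> \<epsilon>" and g: "g \<in> cube n \<rightarrow> {0..1}" and far: "far_from_independent A \<mu> n \<epsilon> g"
    let ?N = "{..<n}"
    define W where "W x = (\<Prod>i<n. \<mu> $ x i)" for x :: "nat \<Rightarrow> 'v"
    have W: "0 < W x" for x unfolding W_def by (intro prod_pos) (simp add: \<mu>_pos)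
    have fc: "finite (cube n :: (nat \<Rightarrow> 'v) set)" by (simp add: cube_def finite_PiE)
    have g01: "0 \<le> g x" "g x \<le> 1" if "x \<in> cube n" for x using g that by auto
    \<comment> \<open>Masses rather than densities: a matching takes equal mass from both ends of an
      edge, whatever their weights under \<mu>.\<close>
    define w where "w x = (if x \<in> cube n then W x * g x else 0)" for x
    define E where "E = {(x, y) \<in> cube n \<times> cube n. \<forall>i<n. A $ x i $ y i \<noteq> 0}"
    have Ec: "E \<subseteq> cube n \<times> cube n" by (auto simp: E_def)
    then have fE: "finite E" using fc by (meson finite_SigmaI finite_subset)
    have wn: "0 \<le> w x" for x using W[of x] g01 by (simp add: w_def less_imp_le)
    obtain w' where w': "\<forall>x. 0 \<le> w' x \<and> w' x \<le> w x" "\<forall>(x, y)\<in>E. w' x = 0 \<or> w' y = 0"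
      and cover: "\<forall>U. (\<forall>(x, y)\<in>E. \<not> (x \<in> U \<and> y \<in> U)) \<longrightarrow>
        (\<Sum>x\<in>cube n. w x - w' x) \<le> 2 * (\<Sum>x\<in>cube n - U. w x - w' x)"
      using fractional_matching[of E "cube n" w, OF fE fc Ec wn] by (elim exE conjE)
    define F where "F x = (if x \<in> cube n then (w x - w' x) / W x else 0)" for x
    have F: "0 \<le> F x" "F x \<le> 1" "x \<in> cube n \<Longrightarrow> F x \<le> g x" for x
    proof -
      have "F x \<le> g x \<and> 0 \<le> F x" if "x \<in> cube n"
        using that w'(1)[rule_format, of x] W[of x] by (simp add: F_def w_def divide_le_eq mult.commute)
      then show "0 \<le> F x" "F x \<le> 1" "x \<in> cube n \<Longrightarrow> F x \<le> g x"
        using g01[of x] by (cases "x \<in> cube n"; simp add: F_def; fail | force simp: F_def)+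
    qed
    have sumF: "pexp ?N (\<lambda>_. ($) \<mu>) (\<lambda>x. if x \<in> U then 0 else F x) = (\<Sum>x\<in>cube n - U. w x - w' x)" for U
    proof -
      have "pexp ?N (\<lambda>_. ($) \<mu>) (\<lambda>x. if x \<in> U then 0 else F x) = (\<Sum>x\<in>cube n. W x * (if x \<in> U then 0 else F x))"
        by (simp add: pexp_def W_def cube_def)
      also have "\<dots> = (\<Sum>x\<in>cube n. if x \<in> cube n - U then w x - w' x else 0)"
      proof (intro sum.cong refl)
        fix x assume "x \<in> (cube n :: (nat \<Rightarrow> 'v) set)"
        then show "W x * (if x \<in> U then 0 else F x) = (if x \<in> cube n - U then w x - w' x else 0)"
          using W[of x] by (simp add: F_def)
      qed
      also have "\<dots> = (\<Sum>x\<in>cube n - U. w x - w' x)"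
        using fc by (intro sum.mono_neutral_cong_right) auto
      finally show ?thesis .
    qed
    have EF: "pexp ?N (\<lambda>_. ($) \<mu>) F = (\<Sum>x\<in>cube n. w x - w' x)" using sumF[of "{}"] by simp
    have cov: "pexp ?N (\<lambda>_. ($) \<mu>) F \<le> 2 * pexp ?N (\<lambda>_. ($) \<mu>) (\<lambda>x. if x \<in> U then 0 else F x)"
      if "no_edge ?N U" for U
    proof -
      have "\<forall>(x, y)\<in>E. \<not> (x \<in> U \<and> y \<in> U)" using that by (force simp: E_def no_edge_def)
      then show ?thesis unfolding EF sumF using cover by blast
    qed
    define U0 where "U0 = {x \<in> cube n. w' x \<noteq> 0}"
    have "no_edge ?N U0"
      unfolding no_edge_def
    proof (intro ballI, rule ccontr)
      fix x y assume xy: "x \<in> U0" "y \<in> U0" "\<not> (\<exists>i\<in>?N. A $ x i $ y i = 0)"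
      then have "(x, y) \<in> E" by (auto simp: E_def U0_def)
      then show False using w'(2) xy by (auto simp: U0_def)
    qed
    then have "independent_set A \<mu> n U0" by (intro no_edge_independent) (auto simp: U0_def)
    then have "\<epsilon> < prod_expectation \<mu> n (\<lambda>x. indicator (cube n - U0) x * g x)"
      using far by (simp add: far_from_independent_def)
    also have "\<dots> = (\<Sum>x\<in>cube n. W x * (indicator (cube n - U0) x * g x))"
      by (simp add: prod_expectation_def W_def)
    also have "\<dots> \<le> (\<Sum>x\<in>cube n. w x - w' x)"
    proof (intro sum_mono)
      fix x assume x: "x \<in> (cube n :: (nat \<Rightarrow> 'v) set)"
      show "W x * (indicator (cube n - U0) x * g x) \<le> w x - w' x"
        using x w'(1)[rule_format, of x] by (auto simp: U0_def w_def indicator_def)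
    qed
    finally have "1 / 2 ^ m \<le> pexp ?N (\<lambda>_. ($) \<mu>) F" using m unfolding EF by linarith
    then have "1 / real (tower (a * m + b)) < pexp2 ?N (\<lambda>_. step) (\<lambda>x y. F x * F y)"
      using F cov by (intro ab) auto
    also have "\<dots> \<le> pexp2 ?N (\<lambda>_. step) (\<lambda>x y. g x * g y)"
    proof (intro pexp2_mono step_nonneg)
      fix x y :: "nat \<Rightarrow> 'v" assume "x \<in> ?N \<rightarrow>\<^sub>E UNIV" "y \<in> ?N \<rightarrow>\<^sub>E UNIV"
      then have "x \<in> cube n" "y \<in> cube n" by (auto simp: cube_def)
      then show "F x * F y \<le> g x * g y" using F g01 by (intro mult_mono) auto
    qed simp
    finally show "1 / real (tower (a * m + b)) < prod_inner \<mu> n g (prod_chain A n g)"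
      by (simp only: prod_inner_chain_eq)
  qed
qed

end

text \<open>Near 0 the logarithm exceeds 1, so it absorbs \<open>b\<close> and the rounding: as ln 2
  >= 1 / 2, the ceiling is at most 2 l + 1 <= 3 l.\<close>

lemma log_bigo:
  fixes a b :: nat
  shows "(\<lambda>\<epsilon>. real (a * nat \<lceil>log 2 (1 / \<epsilon>)\<rceil> + b)) \<in> O[at_right 0](\<lambda>\<epsilon>. ln (1 / \<epsilon>))"
proof (rule bigoI[where c = "real (3 * a + b)"])
  have "\<forall>\<^sub>F \<epsilon> in at_right (0::real). \<epsilon> < exp (- 1)" "\<forall>\<^sub>F \<epsilon> in at_right (0::real). 0 < \<epsilon>"
    by (auto simp: eventually_at_right_field intro: exI[of _ "exp (- 1)"] exI[of _ 1])
  then show "\<forall>\<^sub>F \<epsilon> in at_right 0. norm (real (a * nat \<lceil>log 2 (1 / \<epsilon>)\<rceil> + b)) \<le> real (3 * a + b) * norm (ln (1 / \<epsilon>))"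
  proof eventually_elim
    case (elim \<epsilon>)
    define l where "l = ln (1 / \<epsilon>)"
    have "ln \<epsilon> < ln (exp (- 1))" using elim by (subst ln_less_cancel_iff) auto
    then have l: "1 \<le> l" using elim by (simp add: l_def ln_div)
    have "1 / 2 \<le> ln (2::real)" using ln_le_minus_one[of "1 / 2 :: real"] by (simp add: ln_div)
    then have "l / ln 2 \<le> 2 * l" using l by (simp add: divide_le_eq)
    moreover have "log 2 (1 / \<epsilon>) = l / ln 2" by (simp add: log_def l_def)
    moreover have "0 \<le> l / ln 2" using l by simp
    ultimately have "real (nat \<lceil>log 2 (1 / \<epsilon>)\<rceil>) \<le> 3 * l" using l by linarith
    then have "real a * real (nat \<lceil>log 2 (1 / \<epsilon>)\<rceil>) \<le> real a * (3 * l)" by (intro mult_left_mono) auto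
    moreover have "real b * 1 \<le> real b * l" using l by (intro mult_left_mono) auto
    ultimately show ?case using l by (simp add: l_def[symmetric] algebra_simps)
  qed
qed

theorem theorem3p1:
  fixes A :: "real ^ 'v ^ 'v::finite" and \<mu> :: "real ^ 'v"
  assumes "transition_matrix A"
    and "irreducible_chain A"
    and "aperiodic_chain A"
    and "stationary_measure A \<mu>"
    and "reversible_chain A \<mu>"
  shows "(\<forall>\<epsilon>>0. \<exists>\<delta>>0. \<forall>n\<ge>1. \<forall>g \<in> cube n \<rightarrow> {0..1}.
            far_from_independent A \<mu> n \<epsilon> g \<longrightarrow> prod_inner \<mu> n g (prod_chain A n g) > \<delta>)
       \<and> (\<exists>h :: real \<Rightarrow> nat.
            (\<lambda>\<epsilon>. real (h \<epsilon>)) \<in> O[at_right 0](\<lambda>\<epsilon>. ln (1 / \<epsilon>)) \<and>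
            (\<forall>\<epsilon>>0. \<forall>n\<ge>1. \<forall>g \<in> cube n \<rightarrow> {0..1}.
               far_from_independent A \<mu> n \<epsilon> g \<longrightarrow>
                 prod_inner \<mu> n g (prod_chain A n g) > 1 / real (tower (h \<epsilon>))))"
proof -
  obtain \<phi> lam e0 L where "spectral_chain A \<mu> \<phi> lam e0 L"
  proof (rule reversible_spectrum[OF assms])
    fix \<phi> :: "'v \<Rightarrow> 'v \<Rightarrow> real" and lam e0 L
    assume "\<And>x. \<phi> e0 x = 1"
      "\<And>k l. (\<Sum>x\<in>UNIV. \<mu> $ x * (\<phi> k x * \<phi> l x)) = (if k = l then 1 else 0)"
      "\<And>x y. (\<Sum>k\<in>UNIV. \<phi> k x * \<phi> k y * \<mu> $ y) = (if x = y then 1 else 0)"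
      "\<And>k x. (\<Sum>y\<in>UNIV. A $ x $ y * \<phi> k y) = lam k * \<phi> k x"
      "0 \<le> L" "L < 1" "\<And>k. k \<noteq> e0 \<Longrightarrow> \<bar>lam k\<bar> \<le> L"
    then have "spectral_chain A \<mu> \<phi> lam e0 L"
      using stationary_measure_pos[OF assms(1,2,4)] assms
      by unfold_locales (auto simp: transition_matrix_def stationary_measure_def reversible_chain_def)
    then show thesis by (rule that)
  qed
  then interpret spectral_chain A \<mu> \<phi> lam e0 L .
  obtain a b where ab: "\<And>m n g \<epsilon>. 1 / 2 ^ m \<le> \<epsilon> \<Longrightarrow> g \<in> cube n \<rightarrow> {0..1} \<Longrightarrow> far_from_independent A \<mu> n \<epsilon> g \<Longrightarrow>
      1 / real (tower (a * m + b)) < prod_inner \<mu> n g (prod_chain A n g)"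
    by (rule removal_bound) blast
  \<comment> \<open>For \<epsilon> >= 1 the conversion \<open>nat\<close> cuts the exponent off at
    0, and 1 / 2 ^ 0 <= \<epsilon> still holds.\<close>
  define h where "h \<epsilon> = a * nat \<lceil>log 2 (1 / \<epsilon>)\<rceil> + b" for \<epsilon> :: real
  have main: "\<forall>\<epsilon>>0. \<forall>n\<ge>1. \<forall>g \<in> cube n \<rightarrow> {0..1}. far_from_independent A \<mu> n \<epsilon> g \<longrightarrow>
      prod_inner \<mu> n g (prod_chain A n g) > 1 / real (tower (h \<epsilon>))"
  proof (intro allI ballI impI)
    fix \<epsilon> :: real and n g
    assume \<epsilon>: "0 < \<epsilon>" and g: "g \<in> cube n \<rightarrow> {0..1}" "far_from_independent A \<mu> n \<epsilon> g"
    have "1 / \<epsilon> = 2 powr log 2 (1 / \<epsilon>)" using \<epsilon> by simp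
    also have "\<dots> \<le> 2 powr real (nat \<lceil>log 2 (1 / \<epsilon>)\<rceil>)" by (intro powr_mono) linarith+
    finally have "1 / 2 ^ nat \<lceil>log 2 (1 / \<epsilon>)\<rceil> \<le> \<epsilon>" using \<epsilon> by (simp add: powr_realpow field_simps)
    from ab[OF this g] show "prod_inner \<mu> n g (prod_chain A n g) > 1 / real (tower (h \<epsilon>))"
      by (simp add: h_def)
  qed
  have "\<exists>\<delta>>0. \<forall>n\<ge>1. \<forall>g \<in> cube n \<rightarrow> {0..1}. far_from_independent A \<mu> n \<epsilon> g \<longrightarrow>
      prod_inner \<mu> n g (prod_chain A n g) > \<delta>" if "0 < \<epsilon>" for \<epsilon>
  proof (intro exI[of _ "1 / real (tower (h \<epsilon>))"] conjI)
    show "0 < 1 / real (tower (h \<epsilon>))" using tower_gt[of "h \<epsilon>"] by simp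
  qed (use main that in blast)
  moreover have "(\<lambda>\<epsilon>. real (h \<epsilon>)) \<in> O[at_right 0](\<lambda>\<epsilon>. ln (1 / \<epsilon>))"
    unfolding h_def by (rule log_bigo)
  ultimately show ?thesis using main by blast
qed

end
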